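(* Let $n\ge2$, $w\in \mathcal D_n$ and $k\geq 0$. Then the $k$-truncation $\mathfrak D_w^{[k]}(\mathbf z,\mathbf x)$ of the type $D$ Schubert polynomial $\mathfrak D_w(\mathbf z,\mathbf x)$ is equal to the sum of monomials over all reduced $d$-signed pipe dreams in $\mathrm{PD}_{\mathcal D_n}^k(w)$: \[ \sum_{D\in\mathrm{PD}_{\mathcal D_n}^k(w)}\mathbf x^{\alpha(D)}\mathbf z^{\beta(D)}=\sum_{\substack{u v=w\\ \ell(u)+\ell(v)=\ell(w) \\ v \in \mathcal S_{n}}}\ \sum_{\substack{\mathbf a \in R(u)\\ \mathbf x^{\alpha} \in \mathscr A_{x}(\mathbf{a})\\\alpha_{k+1}=\alpha_{k+2}=\ldots=0}}\ \sum_{\substack{\mathbf b \in R(v)\\ \mathbf z^{\beta} \in \mathscr A_{z}(\mathbf b)}} 2^{i(\alpha)-o(\mathbf a)} \mathbf x^{\alpha} \mathbf z^{\beta}=\mathfrak D_w^{[k]}(\mathbf z,\mathbf x). \]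
   Context: **Groups.** $\mathcal D_n$ is the group of permutations $w$ of $\{\pm1,\dots,\pm n\}$ with $w(-i)=-w(i)$ and with an even number of $i\in\{1,\dots,n\}$ such that $w(i)<0$. Its generators are $s_i=(i\leftrightarrow i+1)$ (also exchanging $-i,-(i+1)$), $1\le i\le n-1$, and $s_{\hat 1}$ defined by $1\mapsto-2$, $2\mapsto -1$, fixing $3,\dots,n$. Products are compositions of maps, $(uv)(i)=u(v(i))$. $\mathcal S_n\subset\mathcal D_n$ is the symmetric group generated by $s_1,\dots,s_{n-1}$. $\ell$ is the Coxeter length with respect to these generators, $R(w)$ the set of reduced words of $w$; $\mathcal D_\infty=\bigcup_n\mathcal D_n$. **Schubert polynomials of type $D$.** Let $\mathbb Q[\mathbf z,p_1(\mathbf x),p_3(\mathbf x),\dots]$ be the ring of polynomials in $z_1,z_2,\dots$ and the odd power sums $p_k(\mathbf x)=\sum_{i\ge1}x_i^k$ (algebraically independent generators). $\mathcal D_\infty$ acts on it by ring automorphisms: $s_i$ ($i\ge1$) exchanges $z_i$ and $z_{i+1}$ and fixes each $p_k(\mathbf x)$; $s_{\hat1}$ sends $z_1\mapsto -z_2$, $z_2\mapsto-z_1$, fixes $z_j$ ($j\ge 3$), and sends $p_k(\mathbf x)\mapsto p_k(\mathbf x)+z_1^k+z_2^k$. Put $\partial_if=\frac{f-s_if}{z_i-z_{i+1}}$ ($i\ge1$), $\partial_{\hat1}f=\frac{f-s_{\hat1}f}{-z_1-z_2}$. The polynomials $\mathfrak D_w$, $w\in\mathcal D_\infty$, are the unique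 homogeneous elements ($\deg z_i=1$, $\deg p_k(\mathbf x)=k$) with $\mathfrak D_{\mathrm{id}}=1$ and, for all $i\in\{\hat1,1,2,\dots\}$, $\partial_i\mathfrak D_w=\mathfrak D_{ws_i}$ if $\ell(ws_i)<\ell(w)$ and $\partial_i\mathfrak D_w=0$ otherwise (existence and uniqueness are due to Billey and Haiman). The $k$-truncation is $\mathfrak D_w^{[k]}(\mathbf z,\mathbf x)=\mathfrak D_w(\mathbf z;x_1,\dots,x_k,0,0,\dots)$. **Admissible monomials.** Let $\mathbf a=s_{a_1}\cdots s_{a_l}$ be a reduced word. Its peak set is $P(\mathbf a)=\{i\in\{2,\dots,l-1\}: a_{i-1}<a_i>a_{i+1}\}$, where for comparisons $\hat1=1<2<3<\cdots$. A sequence of positive integers $j_1\ge\dots\ge j_l$ is $x$-admissible for $\mathbf a$ if $j_{i-1}=j_i=j_{i+1}$ implies $i\notin P(\mathbf a)$; $\mathscr A_x(\mathbf a)$ is the set of monomials $\mathbf x^\alpha=x_{j_1}\cdots x_{j_l}$ of such sequences. If $\mathbf a$ is a reduced word of an element of $\mathcal S_n$ (in $s_1,\dots,s_{n-1}$), a sequence of positive integers $j_1\le\dots\le j_l$ is $z$-admissible for $\mathbf a$ if $j_i\le a_i$ for all $i$ and $j_i=j_{i+1}$ implies $a_i>a_{i+1}$; $\mathscr A_z(\mathbf a)$ is the set of monomials $\mathbf z^\beta=z_{j_1}\cdots z_{j_l}$ of such sequences. $i(\alpha)$ is the number of distinct variables occurring in $\mathbf x^\alpha$ with nonzero exponent;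 $o(\mathbf a)$ is the total number of occurrences of the letters $s_1$ and $s_{\hat1}$ in $\mathbf a$. **$d$-signed pipe dreams.** The base $B^k_{\mathcal D_n}$ consists of a staircase block and $k$ $\Gamma$-blocks numbered $1,\dots,k$ from bottom to top, all lying above the staircase block. The staircase block has boxes $(i,j)$, $1\le i\le n-1$, $1\le j\le n-i$ (row $i$ from the top, column $j$ from the left); the box $(i,j)$ is indexed by $i+j-1$ and has variable $z_i$. Each $\Gamma$-block has a corner box indexed by the symbol $1'$, boxes indexed $2,\dots,n-1$ from left to right in the same row as the corner and to its right (together with the corner: the horizontal part), and boxes indexed $2,\dots,n-1$ from top to bottom in a column below the corner (together with the corner: the vertical part); all boxes of the $m$-th $\Gamma$-block have variable $x_m$. A $d$-signed pipe dream $D$ is a filling of the base in which each corner $1'$ contains one of four elements: an elbow (weight $0$, no letter), a cross (weight $1$, letter $s_1$), a cross with a faucet (weight $1$, letter $s_{\hat1}$), an elbow with two faucets (weight $2$, the two commuting letters $s_1,s_{\hat1}$ in either order); every other box, of index $i$, contains either an elbow (weight $0$, no letter) or a cross (weight $1$, letter $s_i$). The words of $D$ are obtained by reading the letters from top to bottom and in each row from right to left: i.e. the $\Gamma$-blocks $k,k-1,\dots,1$, in each of them first the horizontal boxes $n-1,\dots,2$, then the corner, then the vertical boxes $2,\dots,n-1$; then the staircase rows $1,\dots,n-1$, each from right to left; for each elbow with two faucets one may choose the order of its two letters, so if there are $r(D)$ such elbows one gets $2^{r(D)}$ words, all representing the same group element. $\mathbf x^{\alpha(D)}\mathbf z^{\beta(D)}$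 is the product over all boxes of the variable of the box raised to the weight of its element. $D$ is reduced of shape $w$ if its words are reduced words of $w\in\mathcal D_n$; $\mathrm{PD}^k_{\mathcal D_n}(w)$ is the set of reduced $d$-signed pipe dreams with $k$ $\Gamma$-blocks of shape $w$. *)

theory Defs
  imports Complex_Main "HOL-Library.Poly_Mapping" "HOL-Library.FuncSet" "HOL-Combinatorics.Permutations"
begin

section \<open>Even signed permutations\<close>

text \<open>
  Signed permutations are represented as functions on all integers that are the identity
  outside \<open>{\<plusminus>1,\<dots>,\<plusminus>n}\<close>, so that the inclusions of the groups of type D of growing rank are
  literal inclusions of sets.
\<close>

definition D_group :: "nat \<Rightarrow> (int \<Rightarrow> int) set" where
  "D_group n = {w. w permutes {i. 1 \<le> \<bar>i\<bar> \<and> \<bar>i\<bar> \<le> int n} \<and> (\<forall>i. w (- i) = - w i) \<and>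
     even (card {i \<in> {1..int n}. w i < 0})}"

definition D_infty :: "(int \<Rightarrow> int) set" where
  "D_infty = (\<Union>n. D_group n)"

text \<open>\<open>Hat1\<close> stands for \<open>s\<^sub>1\<close> with a hat over its index, \<open>Simple i\<close> for \<open>s\<^sub>i\<close>, where \<open>i \<ge> 1\<close>.\<close>

datatype letter = Hat1 | Simple nat

definition letters :: "letter set" where
  "letters = insert Hat1 {Simple i | i. 1 \<le> i}"

fun gen :: "letter \<Rightarrow> int \<Rightarrow> int" where
  "gen Hat1 = transpose 1 (- 2) \<circ> transpose 2 (- 1)"
| "gen (Simple i) = transpose (int i) (int i + 1) \<circ> transpose (- int i) (- (int i + 1))"

definition word_perm :: "letter list \<Rightarrow> int \<Rightarrow> int" where
  "word_perm a = foldr (\<lambda>c f. gen c \<circ> f) a id"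

text \<open>The generators are involutions, so products of generators exhaust the generated group.\<close>

definition S_group :: "nat \<Rightarrow> (int \<Rightarrow> int) set" where
  "S_group n = {word_perm a | a. set a \<subseteq> {Simple i | i. 1 \<le> i \<and> i < n}}"

definition cox_length :: "(int \<Rightarrow> int) \<Rightarrow> nat" where
  "cox_length w = (LEAST l. \<exists>a. set a \<subseteq> letters \<and> word_perm a = w \<and> length a = l)"

definition reduced_words :: "(int \<Rightarrow> int) \<Rightarrow> letter list set" where
  "reduced_words w = {a. set a \<subseteq> letters \<and> word_perm a = w \<and> length a = cox_length w}"


section \<open>Polynomials\<close>

text \<open>
  \<open>Pvar r\<close> is a formal generator standing for the power sum \<open>p\<^sub>r(x)\<close>; only odd \<open>r\<close> occur in the
  ring \<open>zp_ring\<close> below. \<open>Zvar i\<close> and \<open>Xvar i\<close> are \<open>z\<^sub>i\<close> and \<open>x\<^sub>i\<close> with indices \<open>i \<ge> 1\<close>.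
\<close>

datatype mvar = Zvar nat | Xvar nat | Pvar nat

type_synonym monomial = "mvar \<Rightarrow>\<^sub>0 nat"
type_synonym mpoly = "monomial \<Rightarrow>\<^sub>0 rat"

definition pvar :: "mvar \<Rightarrow> mpoly" where
  "pvar v = Poly_Mapping.single (Poly_Mapping.single v 1) 1"

text \<open>The algebra homomorphism that sends each variable \<open>v\<close> to \<open>\<phi> v\<close>.\<close>

definition psubst :: "(mvar \<Rightarrow> mpoly) \<Rightarrow> mpoly \<Rightarrow> mpoly" where
  "psubst \<phi> f = (\<Sum>m \<in> Poly_Mapping.keys f.
     Poly_Mapping.single 0 (Poly_Mapping.lookup f m) *
     (\<Prod>v \<in> Poly_Mapping.keys m. \<phi> v ^ Poly_Mapping.lookup m v))"

definition zp_ring :: "mpoly set" where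
  "zp_ring = {f. \<forall>m \<in> Poly_Mapping.keys f.
     Poly_Mapping.keys m \<subseteq> {Zvar i | i. 1 \<le> i} \<union> {Pvar r | r. odd r}}"

fun var_degree :: "mvar \<Rightarrow> nat" where
  "var_degree (Zvar i) = 1"
| "var_degree (Xvar i) = 1"
| "var_degree (Pvar r) = r"

definition homogeneous :: "mpoly \<Rightarrow> bool" where
  "homogeneous f \<longleftrightarrow> (\<exists>d. \<forall>m \<in> Poly_Mapping.keys f.
     (\<Sum>v \<in> Poly_Mapping.keys m. Poly_Mapping.lookup m v * var_degree v) = d)"


section \<open>Schubert polynomials of type D\<close>

fun act_var :: "letter \<Rightarrow> mvar \<Rightarrow> mpoly" where
  "act_var (Simple i) (Zvar j) = pvar (Zvar (transpose i (i + 1) j))"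
| "act_var (Simple i) (Xvar j) = pvar (Xvar j)"
| "act_var (Simple i) (Pvar r) = pvar (Pvar r)"
| "act_var Hat1 (Zvar j) =
     (if j = 1 then - pvar (Zvar 2) else if j = 2 then - pvar (Zvar 1) else pvar (Zvar j))"
| "act_var Hat1 (Xvar j) = pvar (Xvar j)"
| "act_var Hat1 (Pvar r) = pvar (Pvar r) + pvar (Zvar 1) ^ r + pvar (Zvar 2) ^ r"

definition act :: "letter \<Rightarrow> mpoly \<Rightarrow> mpoly" where
  "act a = psubst (act_var a)"

fun simple_root :: "letter \<Rightarrow> mpoly" where
  "simple_root Hat1 = - pvar (Zvar 1) - pvar (Zvar 2)"
| "simple_root (Simple i) = pvar (Zvar i) - pvar (Zvar (i + 1))"

text \<open>The exact quotient of \<open>f - act a f\<close> by \<open>simple_root a\<close>, unique as the ring is an integral domain.\<close>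

definition divided_diff :: "letter \<Rightarrow> mpoly \<Rightarrow> mpoly" where
  "divided_diff a f = (THE g. simple_root a * g = f - act a f)"

text \<open>
  By Billey and Haiman, these conditions are satisfied by exactly one family indexed by
  \<open>D_infty\<close>; values of \<open>\<DD>\<close> outside \<open>D_infty\<close> are irrelevant.
\<close>

definition schubert_D_family :: "((int \<Rightarrow> int) \<Rightarrow> mpoly) \<Rightarrow> bool" where
  "schubert_D_family \<DD> \<longleftrightarrow>
     \<DD> id = 1 \<and>
     (\<forall>w \<in> D_infty. \<DD> w \<in> zp_ring \<and> homogeneous (\<DD> w) \<and>
       (\<forall>a \<in> letters. divided_diff a (\<DD> w) =
          (if cox_length (w \<circ> gen a) < cox_length w then \<DD> (w \<circ> gen a) else 0)))"

fun truncate_var :: "nat \<Rightarrow> mvar \<Rightarrow> mpoly" where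
  "truncate_var k (Zvar i) = pvar (Zvar i)"
| "truncate_var k (Xvar i) = pvar (Xvar i)"
| "truncate_var k (Pvar r) = (\<Sum>i = 1..k. pvar (Xvar i) ^ r)"

text \<open>Setting \<open>x\<^sub>i = 0\<close> for \<open>i > k\<close> turns \<open>p\<^sub>r(x)\<close> into the power sum in \<open>x\<^sub>1,\<dots>,x\<^sub>k\<close>.\<close>

definition x_truncation :: "nat \<Rightarrow> mpoly \<Rightarrow> mpoly" where
  "x_truncation k = psubst (truncate_var k)"


section \<open>Admissible monomials\<close>

text \<open>The numerical value used to compare letters, identifying the hatted index with \<open>1\<close>.\<close>

fun letter_val :: "letter \<Rightarrow> nat" where
  "letter_val Hat1 = 1"
| "letter_val (Simple i) = i"

text \<open>Positions in lists are counted from \<open>0\<close>.\<close>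

definition peaks :: "letter list \<Rightarrow> nat set" where
  "peaks a = {i. 1 \<le> i \<and> i + 1 < length a \<and>
     letter_val (a ! (i - 1)) < letter_val (a ! i) \<and> letter_val (a ! i) > letter_val (a ! (i + 1))}"

definition x_admissible :: "letter list \<Rightarrow> nat list \<Rightarrow> bool" where
  "x_admissible a js \<longleftrightarrow> length js = length a \<and> (\<forall>j \<in> set js. 1 \<le> j) \<and> sorted_wrt (\<ge>) js \<and>
     (\<forall>i. 1 \<le> i \<and> i + 1 < length js \<and> js ! (i - 1) = js ! i \<and> js ! i = js ! (i + 1) \<longrightarrow>
        i \<notin> peaks a)"

definition x_monomials :: "letter list \<Rightarrow> monomial set" where
  "x_monomials a = {\<Sum>j\<leftarrow>js. Poly_Mapping.single (Xvar j) 1 | js. x_admissible a js}"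

definition z_admissible :: "letter list \<Rightarrow> nat list \<Rightarrow> bool" where
  "z_admissible a js \<longleftrightarrow> length js = length a \<and> (\<forall>j \<in> set js. 1 \<le> j) \<and> sorted_wrt (\<le>) js \<and>
     (\<forall>i < length js. js ! i \<le> letter_val (a ! i)) \<and>
     (\<forall>i. i + 1 < length js \<and> js ! i = js ! (i + 1) \<longrightarrow> letter_val (a ! i) > letter_val (a ! (i + 1)))"

definition z_monomials :: "letter list \<Rightarrow> monomial set" where
  "z_monomials a = {\<Sum>j\<leftarrow>js. Poly_Mapping.single (Zvar j) 1 | js. z_admissible a js}"

definition num_vars :: "monomial \<Rightarrow> nat" where
  "num_vars \<alpha> = card (Poly_Mapping.keys \<alpha>)"

definition num_ones :: "letter list \<Rightarrow> nat" where
  "num_ones a = length (filter (\<lambda>c. c = Simple 1 \<or> c = Hat1) a)"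


text \<open>
  The exponent of \<open>2\<close> may be negative. A reduced word of an element of \<open>S_group n\<close> contains only
  letters \<open>Simple i\<close> with \<open>i < n\<close>, so \<open>Hat1\<close> never meets the z-admissibility condition.
\<close>

definition admissible_sum :: "nat \<Rightarrow> nat \<Rightarrow> (int \<Rightarrow> int) \<Rightarrow> mpoly" where
  "admissible_sum n k w =
     (\<Sum>(u, v) \<in> {(u, v). u \<in> D_group n \<and> v \<in> S_group n \<and> u \<circ> v = w \<and>
                         cox_length u + cox_length v = cox_length w}.
      \<Sum>(a, \<alpha>) \<in> {(a, \<alpha>). a \<in> reduced_words u \<and> \<alpha> \<in> x_monomials a \<and>
                         (\<forall>j > k. Poly_Mapping.lookup \<alpha> (Xvar j) = 0)}.
      \<Sum>(b, \<beta>) \<in> {(b, \<beta>). b \<in> reduced_words v \<and> \<beta> \<in> z_monomials b}.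
        Poly_Mapping.single (\<alpha> + \<beta>) (2 powi (int (num_vars \<alpha>) - int (num_ones a))))"


section \<open>Signed pipe dreams of type D\<close>

text \<open>
  \<open>Corner m\<close>, \<open>Hor m i\<close>, \<open>Ver m i\<close> are the corner and the horizontal and vertical boxes of
  index \<open>i\<close> in the \<open>m\<close>-th \<open>\<Gamma>\<close>-block.
\<close>

datatype box = Stair nat nat | Corner nat | Hor nat nat | Ver nat nat

datatype tile = Elbow | Cross | Faucet_Cross | Faucet_Elbow

definition pd_base :: "nat \<Rightarrow> nat \<Rightarrow> box set" where
  "pd_base n k =
     {Stair i j | i j. 1 \<le> i \<and> i \<le> n - 1 \<and> 1 \<le> j \<and> j \<le> n - i} \<union>
     {Corner m | m. 1 \<le> m \<and> m \<le> k} \<union>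
     {Hor m i | m i. 1 \<le> m \<and> m \<le> k \<and> 2 \<le> i \<and> i \<le> n - 1} \<union>
     {Ver m i | m i. 1 \<le> m \<and> m \<le> k \<and> 2 \<le> i \<and> i \<le> n - 1}"

fun allowed_tiles :: "box \<Rightarrow> tile set" where
  "allowed_tiles (Corner m) = {Elbow, Cross, Faucet_Cross, Faucet_Elbow}"
| "allowed_tiles (Stair i j) = {Elbow, Cross}"
| "allowed_tiles (Hor m i) = {Elbow, Cross}"
| "allowed_tiles (Ver m i) = {Elbow, Cross}"

fun box_index :: "box \<Rightarrow> nat" where
  "box_index (Stair i j) = i + j - 1"
| "box_index (Corner m) = 1"
| "box_index (Hor m i) = i"
| "box_index (Ver m i) = i"

fun box_var :: "box \<Rightarrow> mvar" where
  "box_var (Stair i j) = Zvar i"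
| "box_var (Corner m) = Xvar m"
| "box_var (Hor m i) = Xvar m"
| "box_var (Ver m i) = Xvar m"

fun tile_weight :: "tile \<Rightarrow> nat" where
  "tile_weight Elbow = 0"
| "tile_weight Cross = 1"
| "tile_weight Faucet_Cross = 1"
| "tile_weight Faucet_Elbow = 2"

fun tile_words :: "box \<Rightarrow> tile \<Rightarrow> letter list set" where
  "tile_words b Elbow = {[]}"
| "tile_words b Cross = {[Simple (box_index b)]}"
| "tile_words b Faucet_Cross = {[Hat1]}"
| "tile_words b Faucet_Elbow = {[Simple 1, Hat1], [Hat1, Simple 1]}"

text \<open>The boxes of the base listed from top to bottom and in each row from right to left.\<close>

definition reading_order :: "nat \<Rightarrow> nat \<Rightarrow> box list" where
  "reading_order n k =
     concat (map (\<lambda>m. map (Hor m) (rev [2..<n]) @ [Corner m] @ map (Ver m) [2..<n]) (rev [1..<k + 1])) @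
     concat (map (\<lambda>i. map (Stair i) (rev [1..<n - i + 1])) [1..<n])"

definition signed_pipe_dreams :: "nat \<Rightarrow> nat \<Rightarrow> (box \<Rightarrow> tile) set" where
  "signed_pipe_dreams n k = (\<Pi>\<^sub>E b \<in> pd_base n k. allowed_tiles b)"

definition pd_words :: "nat \<Rightarrow> nat \<Rightarrow> (box \<Rightarrow> tile) \<Rightarrow> letter list set" where
  "pd_words n k D =
     {concat us | us. list_all2 (\<lambda>b u. u \<in> tile_words b (D b)) (reading_order n k) us}"

definition pd_monomial :: "nat \<Rightarrow> nat \<Rightarrow> (box \<Rightarrow> tile) \<Rightarrow> monomial" where
  "pd_monomial n k D = (\<Sum>b \<in> pd_base n k. Poly_Mapping.single (box_var b) (tile_weight (D b)))"

definition reduced_pipe_dreams :: "nat \<Rightarrow> nat \<Rightarrow> (int \<Rightarrow> int) \<Rightarrow> (box \<Rightarrow> tile) set" where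
  "reduced_pipe_dreams n k w = {D \<in> signed_pipe_dreams n k. pd_words n k D \<subseteq> reduced_words w}"

definition pipe_dream_sum :: "nat \<Rightarrow> nat \<Rightarrow> (int \<Rightarrow> int) \<Rightarrow> mpoly" where
  "pipe_dream_sum n k w =
     (\<Sum>D \<in> reduced_pipe_dreams n k w. Poly_Mapping.single (pd_monomial n k D) 1)"

end

theory Submission
  imports Defs "HOL-Library.Countable" "HOL-Library.Multiset"
begin

text \<open>
  Each of the three sides, as a function of \<open>w\<close>, arises from the indicator function of the identity by
  the same sequence of operations \<open>step a t\<close>, which add \<open>t * f (w \<circ> gen a)\<close> to \<open>f w\<close> whenever \<open>a\<close> is a descent
  of \<open>w\<close>; there is one operation for each letter available in the base of the pipe dreams, in reading
  order, and \<open>t\<close> is the variable of its box. For pipe dreams this is the decision box by box whether to use a letter.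

  The equations for the divided differences say how a Schubert polynomial changes by a step when its
  arguments are moved by a generator. Moving a value \<open>t\<close> from a far position of the otherwise vanishing
  tail of the sequence \<open>z\<close> to position \<open>i\<close> produces the letters \<open>n - 1, \<dots>, i\<close>, a row of the staircase. If all
  \<open>z\<close> vanish, the hatted generator turns \<open>(t, 0, 0, \<dots>)\<close> into \<open>(0, - t, 0, \<dots>)\<close> and adjoins \<open>t\<close> to the arguments \<open>x\<close>
  of the power sums; moving \<open>- t\<close> back to infinity is inverse to the letters \<open>2, \<dots>, n - 1\<close>. Together these
  moves make up a \<open>\<Gamma>\<close>-block.

  An admissible sequence splits a reduced word into segments with constant variable. The segments of
  \<open>z\<^sub>i\<close> are the decreasing words, which are the words of the \<open>i\<close>-th staircase row. The segments of \<open>x\<^sub>m\<close> are the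
  words without peaks, and a reduced word without peaks is a word of the \<open>\<Gamma>\<close>-block: twice if its lowest
  letter exceeds \<open>1\<close> and so fits into both arms, once if it contains one letter of value \<open>1\<close>, and with weight one half if
  it contains both, as the elbow with two faucets counts once for two words.
\<close>

section \<open>Substitution homomorphisms\<close>

instance mvar :: countable
  by countable_datatype

text \<open>Any linear order on the variables makes \<open>mpoly\<close> an instance of \<open>idom\<close>.\<close>

instantiation mvar :: linorder
begin

definition less_eq_mvar :: "mvar \<Rightarrow> mvar \<Rightarrow> bool" where
  "less_eq_mvar a b \<longleftrightarrow> to_nat a \<le> to_nat b"

definition less_mvar :: "mvar \<Rightarrow> mvar \<Rightarrow> bool" where
  "less_mvar a b \<longleftrightarrow> to_nat a < to_nat b"

instance
  by standard (auto simp: less_eq_mvar_def less_mvar_def)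

end

definition monomial_subst :: "(mvar \<Rightarrow> mpoly) \<Rightarrow> monomial \<Rightarrow> mpoly" where
  "monomial_subst \<phi> m = (\<Prod>v \<in> Poly_Mapping.keys m. \<phi> v ^ Poly_Mapping.lookup m v)"

abbreviation const :: "rat \<Rightarrow> mpoly" where
  "const c \<equiv> Poly_Mapping.single 0 c"

lemma const_mult: "const (a * b) = const a * const b"
  by (simp add: mult_single)

lemma monomial_subst_superset:
  assumes "finite A" "Poly_Mapping.keys m \<subseteq> A"
  shows "monomial_subst \<phi> m = (\<Prod>v \<in> A. \<phi> v ^ Poly_Mapping.lookup m v)"
  unfolding monomial_subst_def using assms
  by (intro prod.mono_neutral_left) (auto simp: in_keys_iff)

lemma monomial_subst_0 [simp]: "monomial_subst \<phi> 0 = 1"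
  by (simp add: monomial_subst_def)

lemma monomial_subst_add: "monomial_subst \<phi> (m + m') = monomial_subst \<phi> m * monomial_subst \<phi> m'"
proof -
  let ?A = "Poly_Mapping.keys m \<union> Poly_Mapping.keys m'"
  have "monomial_subst \<phi> (m + m') = (\<Prod>v \<in> ?A. \<phi> v ^ Poly_Mapping.lookup (m + m') v)"
    using Poly_Mapping.keys_add[of m m'] by (intro monomial_subst_superset) auto
  also have "\<dots> = (\<Prod>v \<in> ?A. \<phi> v ^ Poly_Mapping.lookup m v) * (\<Prod>v \<in> ?A. \<phi> v ^ Poly_Mapping.lookup m' v)"
    by (simp add: lookup_add power_add prod.distrib)
  also have "\<dots> = monomial_subst \<phi> m * monomial_subst \<phi> m'"
    by (simp add: monomial_subst_superset[of ?A])
  finally show ?thesis .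
qed

lemma psubst_superset:
  assumes "finite A" "Poly_Mapping.keys f \<subseteq> A"
  shows "psubst \<phi> f = (\<Sum>m\<in>A. const (Poly_Mapping.lookup f m) * monomial_subst \<phi> m)"
  unfolding psubst_def monomial_subst_def using assms
  by (intro sum.mono_neutral_left) (auto simp: in_keys_iff)

lemma psubst_0 [simp]: "psubst \<phi> 0 = 0"
  by (simp add: psubst_def)

lemma psubst_single: "psubst \<phi> (Poly_Mapping.single m c) = const c * monomial_subst \<phi> m"
  by (subst psubst_superset[of "{m}"]) auto

lemma psubst_const [simp]: "psubst \<phi> (const c) = const c"
  by (simp add: psubst_single)

lemma psubst_1 [simp]: "psubst \<phi> 1 = 1"
  using psubst_const[of \<phi> 1] by simp

lemma psubst_pvar [simp]: "psubst \<phi> (pvar v) = \<phi> v"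
  by (simp add: pvar_def psubst_single monomial_subst_def)

lemma psubst_add: "psubst \<phi> (f + g) = psubst \<phi> f + psubst \<phi> g"
proof -
  let ?A = "Poly_Mapping.keys f \<union> Poly_Mapping.keys g"
  show ?thesis
    using Poly_Mapping.keys_add[of f g]
    by (simp add: psubst_superset[of ?A] lookup_add single_add distrib_right sum.distrib)
qed

lemma psubst_uminus: "psubst \<phi> (- f) = - psubst \<phi> f"
  using psubst_add[of \<phi> f "- f"] by (simp add: eq_neg_iff_add_eq_0 add.commute)

lemma psubst_diff: "psubst \<phi> (f - g) = psubst \<phi> f - psubst \<phi> g"
  using psubst_add[of \<phi> f "- g"] by (simp add: psubst_uminus)

lemma psubst_sum: "psubst \<phi> (\<Sum>i\<in>I. f i) = (\<Sum>i\<in>I. psubst \<phi> (f i))"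
  by (induction I rule: infinite_finite_induct) (auto simp: psubst_add)

lemma mpoly_expand: "f = (\<Sum>m\<in>Poly_Mapping.keys f. Poly_Mapping.single m (Poly_Mapping.lookup f m))"
proof (rule poly_mapping_eqI)
  fix k
  show "Poly_Mapping.lookup f k =
    Poly_Mapping.lookup (\<Sum>m\<in>Poly_Mapping.keys f. Poly_Mapping.single m (Poly_Mapping.lookup f m)) k"
    by (simp add: lookup_sum lookup_single when_def in_keys_iff)
qed

lemma psubst_mult: "psubst \<phi> (f * g) = psubst \<phi> f * psubst \<phi> g"
proof -
  have mono: "psubst \<phi> (Poly_Mapping.single m c * Poly_Mapping.single m' c') =
      psubst \<phi> (Poly_Mapping.single m c) * psubst \<phi> (Poly_Mapping.single m' c')" for m c m' c'
    by (simp add: mult_single psubst_single monomial_subst_add const_mult[symmetric])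
  have "psubst \<phi> (f * g) =
      psubst \<phi> ((\<Sum>m\<in>Poly_Mapping.keys f. Poly_Mapping.single m (Poly_Mapping.lookup f m)) *
        (\<Sum>m\<in>Poly_Mapping.keys g. Poly_Mapping.single m (Poly_Mapping.lookup g m)))"
    using mpoly_expand[of f] mpoly_expand[of g] by simp
  also have "\<dots> = psubst \<phi> (\<Sum>m\<in>Poly_Mapping.keys f. Poly_Mapping.single m (Poly_Mapping.lookup f m)) *
      psubst \<phi> (\<Sum>m\<in>Poly_Mapping.keys g. Poly_Mapping.single m (Poly_Mapping.lookup g m))"
    by (simp add: sum_product psubst_sum mono)
  also have "\<dots> = psubst \<phi> f * psubst \<phi> g"
    using mpoly_expand[of f] mpoly_expand[of g] by simp
  finally show ?thesis .
qed

lemma psubst_power: "psubst \<phi> (f ^ r) = psubst \<phi> f ^ r"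
  by (induction r) (auto simp: psubst_mult)

lemma psubst_prod: "psubst \<phi> (\<Prod>i\<in>I. f i) = (\<Prod>i\<in>I. psubst \<phi> (f i))"
  by (induction I rule: infinite_finite_induct) (auto simp: psubst_mult)

lemma psubst_psubst: "psubst \<phi> (psubst \<psi> f) = psubst (\<lambda>v. psubst \<phi> (\<psi> v)) f"
  by (simp add: psubst_def[of _ f] psubst_def[of \<psi> f] psubst_sum psubst_mult psubst_prod psubst_power)

section \<open>Variables of a polynomial and induction over them\<close>

definition mvars :: "mpoly \<Rightarrow> mvar set" where
  "mvars f = (\<Union>m\<in>Poly_Mapping.keys f. Poly_Mapping.keys m)"

lemma finite_mvars: "finite (mvars f)"
  by (simp add: mvars_def)

lemma zp_ring_iff: "f \<in> zp_ring \<longleftrightarrow> mvars f \<subseteq> {Zvar i | i. 1 \<le> i} \<union> {Pvar r | r. odd r}"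
  by (auto simp: zp_ring_def mvars_def)

lemma psubst_cong:
  assumes "\<And>v. v \<in> mvars f \<Longrightarrow> \<phi> v = \<psi> v"
  shows "psubst \<phi> f = psubst \<psi> f"
  unfolding psubst_def
  by (intro sum.cong refl arg_cong2[where f = "(*)"] prod.cong arg_cong2[where f = "(^)"] assms)
    (auto simp: mvars_def)

lemma pvar_power: "pvar v ^ r = Poly_Mapping.single (Poly_Mapping.single v r) 1"
  by (induction r) (auto simp: pvar_def mult_single single_add[symmetric])

lemma prod_single: "(\<Prod>i\<in>I. Poly_Mapping.single (f i) 1) = (Poly_Mapping.single (\<Sum>i\<in>I. f i) 1 :: mpoly)"
  by (induction I rule: infinite_finite_induct) (auto simp: mult_single)

lemma monomial_expand: "m = (\<Sum>v\<in>Poly_Mapping.keys m. Poly_Mapping.single v (Poly_Mapping.lookup m v))"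
  for m :: monomial
  by (rule poly_mapping_eqI) (simp add: lookup_sum lookup_single when_def in_keys_iff)

lemma monomial_subst_pvar: "monomial_subst pvar m = Poly_Mapping.single m 1"
  using monomial_expand[of m]
  by (simp add: monomial_subst_def pvar_power prod_single)

lemma psubst_pvar_id: "psubst pvar f = f"
proof -
  have "psubst pvar f = (\<Sum>m\<in>Poly_Mapping.keys f. Poly_Mapping.single m (Poly_Mapping.lookup f m))"
    by (simp add: psubst_superset[of "Poly_Mapping.keys f"] monomial_subst_pvar mult_single)
  then show ?thesis using mpoly_expand[of f] by simp
qed

text \<open>Substituting each variable for itself builds f from constants and variables by sums and
  products. Only variables occurring in f enter, so membership in \<open>zp_ring\<close> can
  restrict the variable case.\<close>

lemma psubst_induct:
  assumes const: "\<And>c. P (const c)"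
    and var: "\<And>v. v \<in> mvars f \<Longrightarrow> P (pvar v)"
    and add: "\<And>g h. P g \<Longrightarrow> P h \<Longrightarrow> P (g + h)"
    and mult: "\<And>g h. P g \<Longrightarrow> P h \<Longrightarrow> P (g * h)"
  shows "P f"
proof -
  have P0: "P 0" and P1: "P 1" using const[of 0] const[of 1] by auto
  have pw: "P (pvar v ^ r)" if "v \<in> mvars f" for v r
    by (induction r) (use that var mult P1 in auto)
  have pr: "P (\<Prod>v\<in>A. pvar v ^ e v)" if "A \<subseteq> mvars f" for A e
    using that by (induction A rule: infinite_finite_induct) (auto intro!: mult pw P1)
  have "P (\<Sum>m\<in>A. const (c m) * monomial_subst pvar m)" if "A \<subseteq> Poly_Mapping.keys f" for A c
    using that
  proof (induction A rule: infinite_finite_induct)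
    case (insert m A)
    then have "P (monomial_subst pvar m)"
      unfolding monomial_subst_def by (intro pr) (auto simp: mvars_def)
    then show ?case using insert by (simp add: add mult const)
  qed (auto simp: P0)
  then have "P (psubst pvar f)"
    by (simp add: psubst_superset[of "Poly_Mapping.keys f"])
  then show ?thesis by (simp add: psubst_pvar_id)
qed

section \<open>Divided differences\<close>

lemma act_simps:
  "act a (f + g) = act a f + act a g" "act a (f * g) = act a f * act a g" "act a (const c) = const c"
  "act a (pvar v) = act_var a v"
  by (simp_all add: act_def psubst_add psubst_mult)

lemma pvar_inject: "pvar u = pvar v \<longleftrightarrow> u = v"
proof
  assume "pvar u = pvar v"
  then have "Poly_Mapping.keys (pvar u) = Poly_Mapping.keys (pvar v)" by simp
  then have "Poly_Mapping.single u (1::nat) = Poly_Mapping.single v 1" by (simp add: pvar_def)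
  then have "Poly_Mapping.keys (Poly_Mapping.single u (1::nat)) = Poly_Mapping.keys (Poly_Mapping.single v (1::nat))" by simp
  then show "u = v" by simp
qed simp

lemma simple_root_nonzero: "simple_root a \<noteq> 0"
proof (cases a)
  case Hat1
  have "Poly_Mapping.lookup (simple_root Hat1) (Poly_Mapping.single (Zvar 1) 1) \<noteq> 0"
  proof -
    have "Poly_Mapping.single (Zvar 2) (1::nat) \<noteq> Poly_Mapping.single (Zvar 1) 1"
      by (metis keys_single mvar.inject(1) one_neq_zero singleton_inject numeral_One numeral_eq_iff semiring_norm(85))
    then show ?thesis by (simp add: pvar_def lookup_minus lookup_single when_def)
  qed
  then show ?thesis using Hat1 by (metis lookup_zero)
next
  case (Simple i)
  then show ?thesis by (simp add: pvar_inject)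
qed

text \<open>The map taking f to f - act a f is a twisted derivation: g h - act a (g h) = (g - act a
  g) h + act a g (h - act a h). Divisibility therefore only has to be checked on variables.\<close>

lemma simple_root_dvd:
  assumes "f \<in> zp_ring"
  shows "simple_root a dvd f - act a f"
proof -
  have "simple_root a dvd f - act a f" if "mvars f \<subseteq> {Zvar i | i. 1 \<le> i} \<union> {Pvar r | r. odd r}"
  proof (induction rule: psubst_induct[of _ f])
    case (1 c) then show ?case by (simp add: act_simps)
  next
    case (2 v)
    show ?case
    proof (cases a)
      case (Simple i)
      show ?thesis
      proof (cases v)
        case (Zvar j)
        consider "j = i" | "j = Suc i" | "j \<noteq> i" "j \<noteq> Suc i" by blast
        then show ?thesis
        proof cases
          assume "j = Suc i"
          then have "pvar v - act a (pvar v) = simple_root a * (- 1)"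
            using Simple Zvar by (simp add: act_simps)
          then show ?thesis by simp
        qed (use Simple Zvar in \<open>simp_all add: act_simps\<close>)
      qed (use Simple in \<open>auto simp: act_simps\<close>)
    next
      case Hat1
      show ?thesis
      proof (cases v)
        case (Zvar j)
        have "pvar (Zvar 1) + pvar (Zvar 2) = simple_root Hat1 * (- 1)" by simp
        then have "simple_root Hat1 dvd pvar (Zvar 1) + pvar (Zvar 2)" by (metis dvd_triv_left)
        then show ?thesis using Hat1 Zvar by (auto simp: act_simps add.commute)
      next
        case (Pvar r)
        then have "odd r" using 2 that by auto
        \<comment> \<open>Oddness of r turns the change of the power sum into a difference of r-th
          powers of -z_1 and z_2, which is divisible by -z_1 - z_2.\<close>
        then have "- (pvar (Zvar 1) ^ r + pvar (Zvar 2) ^ r) = (- pvar (Zvar 1)) ^ r - pvar (Zvar 2) ^ r"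
          by simp
        also have "simple_root Hat1 dvd \<dots>"
          by (simp add: power_diff_sumr2)
        finally show ?thesis using Hat1 Pvar by (simp add: act_simps diff_diff_eq)
      qed (use Hat1 in \<open>auto simp: act_simps\<close>)
    qed
  next
    case (3 g h)
    then have "simple_root a dvd (g - act a g) + (h - act a h)" by (rule dvd_add)
    then show ?case by (simp add: act_simps algebra_simps)
  next
    case (4 g h)
    then have "simple_root a dvd (g - act a g) * h + act a g * (h - act a h)" by (simp add: dvd_add)
    then show ?case by (simp add: act_simps algebra_simps)
  qed
  then show ?thesis using assms by (simp add: zp_ring_iff)
qed

text \<open>A quotient exists by divisibility and is unique by cancellation of the nonzero root, so
  the description operator picks it and divided differences become equations without
  division.\<close>

lemma divided_diff_eq:
  assumes "f \<in> zp_ring"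
  shows "simple_root a * divided_diff a f = f - act a f"
proof -
  obtain g where g: "simple_root a * g = f - act a f"
    using simple_root_dvd[OF assms, of a] by (metis dvdE)
  show ?thesis unfolding divided_diff_def
  proof (rule theI)
    show "simple_root a * g = f - act a f" by (rule g)
  next
    fix h assume "simple_root a * h = f - act a f"
    then have "simple_root a * h = simple_root a * g" using g by simp
    then show "h = g" using simple_root_nonzero by simp
  qed
qed

section \<open>Length and descents in type D\<close>

definition rank_letters :: "nat \<Rightarrow> letter set" where
  "rank_letters n = insert Hat1 {Simple i | i. 1 \<le> i \<and> i < n}"

text \<open>Up to sign, \<open>(low a, high a)\<close> is the only pair of nonzero integers, not opposite to each
  other, whose order is reversed by \<open>gen a\<close>.\<close>

fun low :: "letter \<Rightarrow> int" where
  "low Hat1 = - 2"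
| "low (Simple i) = int i"

fun high :: "letter \<Rightarrow> int" where
  "high Hat1 = 1"
| "high (Simple i) = int i + 1"

text \<open>Pairs (i, j) and (- j, - i) are inverted together, so each positive root of type D made
  negative is counted twice. Pairs with i = - j are left out, as they belong to roots of type B or C
  only.\<close>

definition inversions :: "(int \<Rightarrow> int) \<Rightarrow> (int \<times> int) set" where
  "inversions w = {(i, j). i \<noteq> 0 \<and> j \<noteq> 0 \<and> i < j \<and> i \<noteq> - j \<and> w j < w i}"

lemma inversions_id [simp]: "inversions id = {}"
  by (auto simp: inversions_def)

lemma rank_letters_subset: "rank_letters n \<subseteq> letters"
  by (auto simp: rank_letters_def letters_def)

lemma finite_rank_letters: "finite (rank_letters n)"
proof -
  have "{Simple i | i. 1 \<le> i \<and> i < n} = Simple ` {1..<n}" by auto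
  then show ?thesis by (simp add: rank_letters_def)
qed

section \<open>Generators as odd maps on the integers\<close>

lemma gen_Hat1: "gen Hat1 i =
    (if i = 1 then - 2 else if i = 2 then - 1 else if i = - 1 then 2 else if i = - 2 then 1 else i)"
  by (auto simp: transpose_def)

lemma gen_Simple: "1 \<le> m \<Longrightarrow> gen (Simple m) i =
    (if i = int m then int m + 1 else if i = int m + 1 then int m
     else if i = - int m then - int m - 1 else if i = - int m - 1 then - int m else i)"
  by (auto simp: transpose_def)

declare gen.simps [simp del]

lemma gen_involution: "a \<in> letters \<Longrightarrow> gen a (gen a i) = i"
  by (cases a) (auto simp: letters_def gen_Hat1 gen_Simple)

lemma gen_comp_gen: "a \<in> letters \<Longrightarrow> w \<circ> gen a \<circ> gen a = w"
  by (auto simp: fun_eq_iff gen_involution)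

lemma gen_minus: "a \<in> letters \<Longrightarrow> gen a (- i) = - gen a i"
  by (cases a) (auto simp: letters_def gen_Hat1 gen_Simple)

lemma gen_eq_0: "a \<in> letters \<Longrightarrow> gen a i = 0 \<longleftrightarrow> i = 0"
  by (cases a) (auto simp: letters_def gen_Hat1 gen_Simple)

lemma gen_low: "a \<in> letters \<Longrightarrow> gen a (low a) = high a"
  by (cases a) (auto simp: letters_def gen_Hat1 gen_Simple)

lemma gen_high: "a \<in> letters \<Longrightarrow> gen a (high a) = low a"
  by (cases a) (auto simp: letters_def gen_Hat1 gen_Simple)

lemma low_high: "a \<in> letters \<Longrightarrow> low a < high a \<and> low a \<noteq> - high a \<and> low a \<noteq> 0 \<and> high a \<noteq> 0"
  by (cases a) (auto simp: letters_def)

text \<open>The counterpart of the fact that a simple reflection permutes all positive roots but its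
  own.\<close>

lemma gen_less:
  assumes "a \<in> letters" "i \<noteq> 0" "j \<noteq> 0" "i < j" "i \<noteq> - j"
    and "(i, j) \<noteq> (low a, high a)" "(i, j) \<noteq> (- high a, - low a)"
  shows "gen a i < gen a j"
  using assms by (cases a) (auto simp: letters_def gen_Hat1 gen_Simple split: if_splits)

lemma inj_gen: "a \<in> letters \<Longrightarrow> inj (gen a)"
  by (metis gen_involution injI)

text \<open>Transport by \<open>gen a\<close> keeps the order of every pair except the two that
  represent the root of a; these become inverted because w has them in order.\<close>

lemma inversions_ascent:
  assumes a: "a \<in> letters" and odd: "\<And>i. w (- i) = - w i" and asc: "w (low a) < w (high a)"
  shows "inversions (w \<circ> gen a) =
    insert (low a, high a) (insert (- high a, - low a) (map_prod (gen a) (gen a) ` inversions w))"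
    (is "?L = ?R")
proof (intro set_eqI iffI)
  fix x assume "x \<in> ?L"
  then obtain i j where x: "x = (i, j)" and ij: "i \<noteq> 0" "j \<noteq> 0" "i < j" "i \<noteq> - j"
      and w: "w (gen a j) < w (gen a i)"
    by (auto simp: inversions_def)
  show "x \<in> ?R"
  proof (cases "x = (low a, high a) \<or> x = (- high a, - low a)")
    case False
    then have "gen a i < gen a j" using gen_less[OF a ij] x by auto
    moreover have "gen a i \<noteq> - gen a j"
      using ij(4) by (metis a gen_involution gen_minus)
    ultimately have "(gen a i, gen a j) \<in> inversions w"
      using ij w a by (auto simp: inversions_def gen_eq_0)
    moreover have "x = map_prod (gen a) (gen a) (gen a i, gen a j)"
      using x a by (simp add: gen_involution)
    ultimately show ?thesis by blast
  qed auto
next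
  fix x assume "x \<in> ?R"
  then consider "x = (low a, high a)" | "x = (- high a, - low a)"
    | i j where "(i, j) \<in> inversions w" "x = (gen a i, gen a j)" by auto
  then show "x \<in> ?L"
  proof cases
    case 1
    then show ?thesis using low_high[OF a] asc a by (auto simp: inversions_def gen_low gen_high)
  next
    case 2
    then show ?thesis using low_high[OF a] asc a
      by (auto simp: inversions_def gen_low gen_high gen_minus odd)
  next
    case 3
    then have ij: "i \<noteq> 0" "j \<noteq> 0" "i < j" "i \<noteq> - j" and w: "w j < w i" by (auto simp: inversions_def)
    have "(i, j) \<noteq> (low a, high a)" "(i, j) \<noteq> (- high a, - low a)" using w asc odd by auto
    then have "gen a i < gen a j" using gen_less[OF a ij] by auto
    moreover have "gen a i \<noteq> - gen a j"
      using ij(4) by (metis a gen_involution gen_minus)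
    ultimately show ?thesis using 3 ij w a by (auto simp: inversions_def gen_eq_0 gen_involution)
  qed
qed

lemma card_inversions_ascent:
  assumes a: "a \<in> letters" and odd: "\<And>i. w (- i) = - w i" and asc: "w (low a) < w (high a)"
    and fin: "finite (inversions w)"
  shows "card (inversions (w \<circ> gen a)) = card (inversions w) + 2"
proof -
  have inj: "inj (map_prod (gen a) (gen a))" using inj_gen[OF a] by (rule prod.inj_map[OF _ inj_gen[OF a]])
  have 1: "(low a, high a) \<notin> map_prod (gen a) (gen a) ` inversions w"
  proof
    assume "(low a, high a) \<in> map_prod (gen a) (gen a) ` inversions w"
    then obtain i j where "(i, j) \<in> inversions w" "low a = gen a i" "high a = gen a j" by auto
    then have "i = high a" "j = low a" "i < j"
      using a by (metis gen_involution gen_low, metis a gen_involution gen_high, auto simp: inversions_def)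
    then show False using low_high[OF a] by auto
  qed
  have 2: "(- high a, - low a) \<notin> map_prod (gen a) (gen a) ` inversions w"
  proof
    assume "(- high a, - low a) \<in> map_prod (gen a) (gen a) ` inversions w"
    then obtain i j where "(i, j) \<in> inversions w" "- high a = gen a i" "- low a = gen a j" by auto
    then have "i = - low a" "j = - high a" "i < j"
      using a by (metis gen_involution gen_minus gen_high, metis a gen_involution gen_minus gen_low,
        auto simp: inversions_def)
    then show False using low_high[OF a] by auto
  qed
  show ?thesis
    using 1 2 fin low_high[OF a]
    by (subst inversions_ascent[OF a odd asc]) (auto simp: card_image inj_on_subset[OF inj])
qed

section \<open>Elements of the groups of type D and their products with generators\<close>

lemma D_group_odd: "w \<in> D_group n \<Longrightarrow> w (- i) = - w i"
  by (simp add: D_group_def)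

lemma D_group_permutes: "w \<in> D_group n \<Longrightarrow> w permutes {i. 1 \<le> \<bar>i\<bar> \<and> \<bar>i\<bar> \<le> int n}"
  by (simp add: D_group_def)

lemma D_group_inj: "w \<in> D_group n \<Longrightarrow> w i = w j \<longleftrightarrow> i = j"
  by (metis D_group_permutes permutes_inj injD)

lemma D_group_eq_0: "w \<in> D_group n \<Longrightarrow> w i = 0 \<longleftrightarrow> i = 0"
  using D_group_odd[of w n 0] D_group_inj[of w n i 0] by auto

lemma D_group_fixes: "w \<in> D_group n \<Longrightarrow> \<bar>i\<bar> > int n \<Longrightarrow> w i = i"
  using permutes_not_in[OF D_group_permutes] by force

lemma D_group_bound: "w \<in> D_group n \<Longrightarrow> \<bar>i\<bar> \<le> int n \<Longrightarrow> \<bar>w i\<bar> \<le> int n"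
  using permutes_in_image[OF D_group_permutes, of w n i] D_group_eq_0[of w n i] by (cases "i = 0") auto

lemma finite_inversions:
  assumes "w \<in> D_group n"
  shows "finite (inversions w)"
proof (rule finite_subset)
  show "inversions w \<subseteq> {- int n..int n} \<times> {- int n..int n}"
  proof
    fix x assume "x \<in> inversions w"
    then obtain i j where x: "x = (i, j)" "i < j" "w j < w i" by (auto simp: inversions_def)
    have "\<bar>i\<bar> \<le> int n \<and> \<bar>j\<bar> \<le> int n"
    proof (cases "\<bar>i\<bar> \<le> int n"; cases "\<bar>j\<bar> \<le> int n")
    qed (use x D_group_fixes[OF assms, of i] D_group_fixes[OF assms, of j]
        D_group_bound[OF assms, of i] D_group_bound[OF assms, of j] in auto)
    then show "x \<in> {- int n..int n} \<times> {- int n..int n}" using x by auto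
  qed
qed simp

lemma D_group_mono:
  assumes "n \<le> m" "w \<in> D_group n"
  shows "w \<in> D_group m"
proof -
  have "w permutes {i. 1 \<le> \<bar>i\<bar> \<and> \<bar>i\<bar> \<le> int m}"
    using D_group_permutes[OF assms(2)] by (rule permutes_subset) (use assms(1) in auto)
  moreover have "{i \<in> {1..int m}. w i < 0} = {i \<in> {1..int n}. w i < 0}"
  proof -
    have "i \<le> int n" if "1 \<le> i" "w i < 0" for i
      using D_group_fixes[OF assms(2), of i] that by (cases "i \<le> int n") auto
    then show ?thesis using assms(1) by force
  qed
  ultimately show ?thesis using assms(2) by (simp add: D_group_def)
qed

lemma id_in_D_group: "id \<in> D_group n"
proof -
  have "{i \<in> {1..int n}. id i < 0} = {}" by auto
  then have "card {i \<in> {1..int n}. id i < 0} = 0" by (simp only: card.empty)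
  then show ?thesis unfolding D_group_def mem_Collect_eq by (simp only: permutes_id) simp
qed

lemma gen_permutes:
  assumes "2 \<le> n" "a \<in> rank_letters n"
  shows "gen a permutes {i. 1 \<le> \<bar>i\<bar> \<and> \<bar>i\<bar> \<le> int n}"
proof (cases a)
  case Hat1
  show ?thesis unfolding Hat1 gen.simps
    by (intro permutes_compose permutes_swap_id) (use assms in auto)
next
  case (Simple m)
  show ?thesis unfolding Simple gen.simps
    by (intro permutes_compose permutes_swap_id) (use assms Simple in \<open>auto simp: rank_letters_def\<close>)
qed

text \<open>Parity is the point: s_i only permutes the positions of negative values, while
  \<open>Hat1\<close> exchanges the first two values and negates both, which turns m negative ones
  among them into 2 - m.\<close>

lemma D_group_gen:
  assumes n: "2 \<le> n" and a: "a \<in> rank_letters n" and w: "w \<in> D_group n"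
  shows "w \<circ> gen a \<in> D_group n"
proof -
  have al: "a \<in> letters" using a rank_letters_subset by auto
  have "w \<circ> gen a permutes {i. 1 \<le> \<bar>i\<bar> \<and> \<bar>i\<bar> \<le> int n}"
    using gen_permutes[OF n a] D_group_permutes[OF w] by (rule permutes_compose)
  moreover have "\<forall>i. (w \<circ> gen a) (- i) = - (w \<circ> gen a) i"
    using al w by (simp add: gen_minus D_group_odd)
  moreover have "even (card {i \<in> {1..int n}. (w \<circ> gen a) i < 0})"
  proof (cases a)
    case (Simple m)
    then have m: "1 \<le> m" "m < n" using a by (auto simp: rank_letters_def)
    have r: "gen a i \<in> {1..int n}" if "i \<in> {1..int n}" for i
      using that m by (auto simp: Simple gen_Simple)
    have "{i \<in> {1..int n}. (w \<circ> gen a) i < 0} = gen a ` {i \<in> {1..int n}. w i < 0}"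
    proof (intro set_eqI iffI)
      fix x assume "x \<in> {i \<in> {1..int n}. (w \<circ> gen a) i < 0}"
      then have "gen a x \<in> {i \<in> {1..int n}. w i < 0}" using r by auto
      then have "gen a (gen a x) \<in> gen a ` {i \<in> {1..int n}. w i < 0}" by blast
      then show "x \<in> gen a ` {i \<in> {1..int n}. w i < 0}" using al by (simp only: gen_involution)
    next
      fix x assume "x \<in> gen a ` {i \<in> {1..int n}. w i < 0}"
      then obtain i where "i \<in> {1..int n}" "w i < 0" "x = gen a i" by auto
      then show "x \<in> {i \<in> {1..int n}. (w \<circ> gen a) i < 0}" using r al by (simp add: gen_involution)
    qed
    then have "card {i \<in> {1..int n}. (w \<circ> gen a) i < 0} = card {i \<in> {1..int n}. w i < 0}"
      using inj_gen[OF al] by (simp add: card_image inj_on_subset)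
    then show ?thesis using w by (simp add: D_group_def)
  next
    case Hat1
    have e: "card {i \<in> {1..int n}. v i < 0} =
        of_bool (v 1 < 0) + of_bool (v 2 < 0) + (\<Sum>i\<in>{3..int n}. of_bool (v i < 0))" for v :: "int \<Rightarrow> int"
    proof -
      have "card {i \<in> {1..int n}. v i < 0} = (\<Sum>i\<in>{1..int n}. of_bool (v i < 0))"
        by (simp add: of_bool_def sum.If_cases Int_def)
      also have "\<dots> = (\<Sum>i\<in>insert 1 (insert 2 {3..int n}). of_bool (v i < 0))"
        using n by (intro sum.cong) auto
      also have "(\<Sum>i\<in>insert 1 (insert 2 {3..int n}). of_bool (v i < 0)) =
          of_bool (v 1 < 0) + of_bool (v 2 < 0) + (\<Sum>i\<in>{3..int n}. of_bool (v i < 0) :: nat)"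
        by (subst sum.insert; simp)+
      finally show ?thesis .
    qed
    have g: "gen a 1 = - 2" "gen a 2 = - 1" "3 \<le> i \<Longrightarrow> gen a i = i" for i
      by (simp_all add: Hat1 gen_Hat1)
    have nz: "w 1 \<noteq> 0" "w 2 \<noteq> 0" using D_group_eq_0[OF w] by auto
    have "even (card {i \<in> {1..int n}. w i < 0})" using w by (simp add: D_group_def)
    moreover have "(\<Sum>i\<in>{3..int n}. of_bool ((w \<circ> gen a) i < 0)) = (\<Sum>i\<in>{3..int n}. of_bool (w i < 0) :: nat)"
      by (intro sum.cong) (auto simp: g)
    moreover have "even (of_bool ((w \<circ> gen a) 1 < 0) + of_bool ((w \<circ> gen a) 2 < 0) :: nat) \<longleftrightarrow>
        even (of_bool (w 1 < 0) + of_bool (w 2 < 0) :: nat)"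
      using nz by (auto simp: g D_group_odd[OF w, of 1] D_group_odd[OF w, of 2])
    ultimately show ?thesis
      unfolding e[of w] e[of "w \<circ> gen a"] by presburger
  qed
  ultimately show ?thesis by (simp add: D_group_def)
qed

text \<open>On odd maps the condition for \<open>Hat1\<close> says w 1 + w 2 < 0, the usual descent
  criterion of type D. By \<open>cox_length_less_iff\<close> it stands in for the comparison of
  lengths.\<close>

definition descent :: "(int \<Rightarrow> int) \<Rightarrow> letter \<Rightarrow> bool" where
  "descent w a \<longleftrightarrow> w (high a) < w (low a)"

text \<open>The root of a is represented by two pairs, so the count changes by two, which is one
  unit of length. The additive form avoids subtraction of natural numbers and covers ascents and
  descents at once.\<close>

lemma card_inversions_gen:
  assumes a: "a \<in> letters" and w: "w \<in> D_group n" and wa: "w \<circ> gen a \<in> D_group m"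
  shows "card (inversions (w \<circ> gen a)) + 2 * of_bool (descent w a) = card (inversions w) + 2 * of_bool (\<not> descent w a)"
proof (cases "descent w a")
  case True
  then have "(w \<circ> gen a) (low a) < (w \<circ> gen a) (high a)"
    using a by (simp add: descent_def gen_low gen_high)
  from card_inversions_ascent[OF a D_group_odd[OF wa] this finite_inversions[OF wa]] True
  show ?thesis using a by (simp add: gen_comp_gen)
next
  case False
  moreover have "w (low a) \<noteq> w (high a)" using D_group_inj[OF w] low_high[OF a] by auto
  ultimately have "w (low a) < w (high a)" by (auto simp: descent_def)
  from card_inversions_ascent[OF a D_group_odd[OF w] this finite_inversions[OF w]] False
  show ?thesis by simp
qed

text \<open>Without descents, - w 2 < w 1 < w 2 < ... < w n. The even number of negative values then
  forces w 1 > 0, and n increasing values between 1 and n leave only the identity.\<close>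

lemma exists_descent:
  assumes n: "2 \<le> n" and w: "w \<in> D_group n" and ne: "w \<noteq> id"
  shows "\<exists>a \<in> rank_letters n. descent w a"
proof (rule ccontr)
  assume no: "\<not> ?thesis"
  have up: "w (int i) < w (int i + 1)" if "1 \<le> i" "i < n" for i
  proof -
    have "Simple i \<in> rank_letters n" using that by (auto simp: rank_letters_def)
    then have "\<not> descent w (Simple i)" using no by blast
    then show ?thesis using D_group_inj[OF w, of "int i" "int i + 1"] by (auto simp: descent_def)
  qed
  have "\<not> descent w Hat1" using no by (auto simp: rank_letters_def)
  then have hat: "- w 2 < w 1"
    using D_group_inj[OF w, of "-2" 1] D_group_odd[OF w, of 2] by (auto simp: descent_def)
  have w2: "w 2 > 0" using hat up[of 1] n by auto
  have pos2: "w (int i) > 0" if "2 \<le> i" "i \<le> n" for i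
    using that
  proof (induction i rule: dec_induct)
    case (step i) then show ?case using up[of i] by (auto simp: add.commute)
  qed (use w2 in auto)
  have w1: "w 1 > 0"
  proof (rule ccontr)
    assume "\<not> w 1 > 0"
    then have "w 1 < 0" using D_group_eq_0[OF w, of 1] by auto
    moreover have "i = 1" if "i \<in> {1..int n}" "w i < 0" for i
      using pos2[of "nat i"] that by (cases "i = 1") (auto simp: nat_le_iff le_nat_iff)
    \<comment> \<open>Position 1 would carry the only negative value, contrary to evenness.\<close>
    ultimately have "{i \<in> {1..int n}. w i < 0} = {1}" using n by auto
    then show False using w by (auto simp: D_group_def)
  qed
  have lb: "int i \<le> w (int i)" if "1 \<le> i" "i \<le> n" for i
    using that
  proof (induction i rule: dec_induct)
    case (step i) then show ?case using up[of i] by (auto simp: add.commute)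
  qed (use w1 in auto)
  have ub: "w (int (n - d)) \<le> int (n - d)" if "d < n" for d
    using that
  proof (induction d)
    case 0
    then show ?case using D_group_bound[OF w, of "int n"] by auto
  next
    case (Suc d)
    have e: "int (n - d) = int (n - Suc d) + 1" using Suc.prems by auto
    have "w (int (n - Suc d)) < w (int (n - d))" using up[of "n - Suc d"] Suc.prems unfolding e by simp
    then show ?case using Suc e by simp
  qed
  have fixpos: "w (int i) = int i" if "1 \<le> i" "i \<le> n" for i
    using lb[OF that] ub[of "n - i"] that by auto
  have "w i = i" for i
  proof (cases "\<bar>i\<bar> \<le> int n")
    case True
    consider "i = 0" | "i > 0" | "i < 0" by linarith
    then show ?thesis
    proof cases
      case 1 then show ?thesis using D_group_eq_0[OF w] by auto
    next
      case 2 then show ?thesis using fixpos[of "nat i"] True by auto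
    next
      case 3 then show ?thesis using fixpos[of "nat (- i)"] True D_group_odd[OF w, of "- i"] by auto
    qed
  qed (use D_group_fixes[OF w] in auto)
  then show False using ne by auto
qed

section \<open>Words and Coxeter length\<close>

lemma word_perm_Nil [simp]: "word_perm [] = id"
  by (simp add: word_perm_def)

lemma word_perm_Cons: "word_perm (a # b) = gen a \<circ> word_perm b"
  by (simp add: word_perm_def)

lemma word_perm_append: "word_perm (a @ b) = word_perm a \<circ> word_perm b"
  by (induction a) (auto simp: word_perm_Cons)

lemma word_perm_snoc: "word_perm (a @ [c]) = word_perm a \<circ> gen c"
  by (simp add: word_perm_append word_perm_Cons)

lemma word_perm_in_D_group:
  assumes "2 \<le> n" "set a \<subseteq> rank_letters n"
  shows "word_perm a \<in> D_group n"
  using assms(2) by (induction a rule: rev_induct) (auto simp: word_perm_snoc id_in_D_group D_group_gen[OF assms(1)])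

lemma letters_in_rank:
  assumes "set a \<subseteq> letters"
  obtains n where "2 \<le> n" "set a \<subseteq> rank_letters n"
proof -
  have "\<exists>n \<ge> 2. set a \<subseteq> rank_letters n" using assms
  proof (induction a)
    case (Cons c a)
    then obtain n where n: "2 \<le> n" "set a \<subseteq> rank_letters n" by auto
    have "set (c # a) \<subseteq> rank_letters (n + letter_val c + 1)"
      using n(2) Cons.prems by (cases c) (force simp: rank_letters_def letters_def)+
    then show ?case using n(1) by (intro exI[of _ "n + letter_val c + 1"]) auto
  qed auto
  then show ?thesis using that by blast
qed

lemma D_inftyE:
  assumes "w \<in> D_infty"
  obtains n where "2 \<le> n" "w \<in> D_group n"
  using assms D_group_mono[of _ "max 2 _"] by (auto simp: D_infty_def) (meson D_group_mono max.cobounded1 max.cobounded2)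

lemma D_group_subset_D_infty: "w \<in> D_group n \<Longrightarrow> w \<in> D_infty"
  by (auto simp: D_infty_def)

lemma word_perm_in_D_infty: "set a \<subseteq> letters \<Longrightarrow> word_perm a \<in> D_infty"
  by (metis letters_in_rank word_perm_in_D_group D_group_subset_D_infty)

lemma card_inversions_word:
  assumes "2 \<le> n" "set a \<subseteq> rank_letters n"
  shows "card (inversions (word_perm a)) \<le> 2 * length a"
  using assms(2)
proof (induction a rule: rev_induct)
  case Nil
  then show ?case by (simp add: id_def[symmetric])
next
  case (snoc c a)
  have "word_perm a \<in> D_group n" "word_perm a \<circ> gen c \<in> D_group n"
    using snoc.prems assms(1) by (auto intro!: word_perm_in_D_group D_group_gen)
  moreover have "c \<in> letters" using snoc.prems rank_letters_subset by auto
  ultimately have "card (inversions (word_perm a \<circ> gen c)) \<le> card (inversions (word_perm a)) + 2"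
    using card_inversions_gen[of c "word_perm a" n n] by (auto simp: of_bool_def split: if_splits)
  also have "\<dots> \<le> 2 * length (a @ [c])" using snoc by simp
  finally show ?case by (simp only: word_perm_snoc)
qed

text \<open>Stripping descents from the right lowers the number of inversions by two each time and
  can only stop at the identity.\<close>

lemma exists_word:
  assumes n: "2 \<le> n" and w: "w \<in> D_group n"
  shows "\<exists>a. set a \<subseteq> rank_letters n \<and> word_perm a = w \<and> 2 * length a = card (inversions w)"
  using w
proof (induction "card (inversions w)" arbitrary: w rule: less_induct)
  case less
  show ?case
  proof (cases "w = id")
    case True
    then show ?thesis by (intro exI[of _ "[]"]) simp
  next
    case False
    then obtain c where c: "c \<in> rank_letters n" "descent w c"
      using exists_descent[OF n less.prems] by auto
    have cl: "c \<in> letters" using c rank_letters_subset by auto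
    have wc: "w \<circ> gen c \<in> D_group n" using D_group_gen[OF n c(1) less.prems] .
    have card: "card (inversions (w \<circ> gen c)) + 2 = card (inversions w)"
      using card_inversions_gen[OF cl less.prems wc] c(2) by simp
    obtain a where "set a \<subseteq> rank_letters n" "word_perm a = w \<circ> gen c"
        "2 * length a = card (inversions (w \<circ> gen c))"
      using less.hyps[OF _ wc] card by auto
    then show ?thesis using c card cl
      by (intro exI[of _ "a @ [c]"]) (auto simp: word_perm_snoc gen_comp_gen)
  qed
qed

lemma cox_length_le: "set a \<subseteq> letters \<Longrightarrow> cox_length (word_perm a) \<le> length a"
  unfolding cox_length_def by (rule Least_le) auto

text \<open>A letter adds at most two inversions, which bounds every word from below, and stripping
  descents attains the bound. A shortest word is not known to use only letters of the rank of w, so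
  the bound is applied in a rank m of its own.\<close>

lemma cox_length_inversions:
  assumes "w \<in> D_infty"
  shows "2 * cox_length w = card (inversions w)"
proof -
  obtain n where n: "2 \<le> n" "w \<in> D_group n" using assms by (rule D_inftyE)
  obtain a where a: "set a \<subseteq> rank_letters n" "word_perm a = w" "2 * length a = card (inversions w)"
    using exists_word[OF n] by auto
  then have al: "set a \<subseteq> letters" using rank_letters_subset by auto
  have "\<exists>b. set b \<subseteq> letters \<and> word_perm b = w \<and> length b = cox_length w"
    unfolding cox_length_def by (rule LeastI_ex) (use a al in blast)
  then obtain b where b: "set b \<subseteq> letters" "word_perm b = w" "length b = cox_length w" by auto
  obtain m where m: "2 \<le> m" "set b \<subseteq> rank_letters m" using letters_in_rank[OF b(1)] by auto
  show ?thesis using card_inversions_word[OF m] cox_length_le[OF al] a b by auto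
qed

lemma D_infty_gen:
  assumes "a \<in> letters" "w \<in> D_infty"
  shows "w \<circ> gen a \<in> D_infty"
proof -
  obtain n where n: "2 \<le> n" "w \<in> D_group n" using assms(2) by (rule D_inftyE)
  obtain m where m: "2 \<le> m" "set [a] \<subseteq> rank_letters m" using letters_in_rank[of "[a]"] assms by auto
  have "a \<in> rank_letters (max n m)" using m(2) by (auto simp: rank_letters_def)
  then have "w \<circ> gen a \<in> D_group (max n m)"
    using n D_group_mono[OF _ n(2), of "max n m"] by (intro D_group_gen) auto
  then show ?thesis by (rule D_group_subset_D_infty)
qed

lemma cox_length_descent:
  assumes "a \<in> letters" "w \<in> D_infty" "descent w a"
  shows "cox_length w = cox_length (w \<circ> gen a) + 1"
proof -
  obtain n m where "w \<in> D_group n" "w \<circ> gen a \<in> D_group m"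
    using assms D_infty_gen[OF assms(1,2)] by (auto simp: D_infty_def)
  from card_inversions_gen[OF assms(1) this] show ?thesis
    using assms cox_length_inversions[of w] cox_length_inversions[OF D_infty_gen[OF assms(1,2)]] by auto
qed

lemma cox_length_ascent:
  assumes "a \<in> letters" "w \<in> D_infty" "\<not> descent w a"
  shows "cox_length (w \<circ> gen a) = cox_length w + 1"
proof -
  obtain n m where "w \<in> D_group n" "w \<circ> gen a \<in> D_group m"
    using assms D_infty_gen[OF assms(1,2)] by (auto simp: D_infty_def)
  from card_inversions_gen[OF assms(1) this] show ?thesis
    using assms cox_length_inversions[of w] cox_length_inversions[OF D_infty_gen[OF assms(1,2)]] by auto
qed

lemma cox_length_less_iff:
  assumes "a \<in> letters" "w \<in> D_infty"
  shows "cox_length (w \<circ> gen a) < cox_length w \<longleftrightarrow> descent w a"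
  using cox_length_descent[OF assms] cox_length_ascent[OF assms] by fastforce

section \<open>Reduced words\<close>

lemma cox_length_id [simp]: "cox_length id = 0"
  using cox_length_le[of "[]"] by simp

lemma reduced_words_id: "reduced_words id = {[]}"
  by (auto simp: reduced_words_def)

lemma reduced_words_nonempty:
  assumes "w \<in> D_infty"
  shows "\<exists>a. a \<in> reduced_words w"
proof -
  obtain n where n: "2 \<le> n" "w \<in> D_group n" using assms by (rule D_inftyE)
  obtain a where a: "set a \<subseteq> rank_letters n" "word_perm a = w" "2 * length a = card (inversions w)"
    using exists_word[OF n] by auto
  then have "a \<in> reduced_words w"
    using cox_length_inversions[OF assms] rank_letters_subset by (auto simp: reduced_words_def)
  then show ?thesis by blast
qed

text \<open>Removing the last letter of a reduced word lowers the length, so that letter is a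
  descent. This recursion from the right is what matches \<open>step\<close>.\<close>

lemma snoc_in_reduced_words:
  assumes w: "w \<in> D_infty"
  shows "a @ [c] \<in> reduced_words w \<longleftrightarrow> c \<in> letters \<and> descent w c \<and> a \<in> reduced_words (w \<circ> gen c)"
proof
  assume r: "a @ [c] \<in> reduced_words w"
  then have c: "c \<in> letters" and a: "set a \<subseteq> letters" and wp: "word_perm a \<circ> gen c = w"
    and l: "length a + 1 = cox_length w" by (auto simp: reduced_words_def word_perm_snoc)
  have wa: "word_perm a = w \<circ> gen c" using c wp gen_comp_gen by metis
  have "cox_length (w \<circ> gen c) \<le> length a" using cox_length_le[OF a] wa by simp
  then have "descent w c" using l cox_length_less_iff[OF c w] by auto
  then show "c \<in> letters \<and> descent w c \<and> a \<in> reduced_words (w \<circ> gen c)"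
    using c a wa l cox_length_descent[OF c w] by (auto simp: reduced_words_def)
next
  assume r: "c \<in> letters \<and> descent w c \<and> a \<in> reduced_words (w \<circ> gen c)"
  then show "a @ [c] \<in> reduced_words w"
    using cox_length_descent[OF _ w, of c] by (auto simp: reduced_words_def word_perm_snoc gen_comp_gen)
qed

text \<open>Beyond n the map w is the identity and up to n its values stay at most n, so w cannot
  drop from i to i + 1 when i \<ge> n.\<close>

lemma descent_in_rank_letters:
  assumes w: "w \<in> D_group n" and c: "c \<in> letters" and d: "descent w c"
  shows "c \<in> rank_letters n"
proof (cases c)
  case (Simple i)
  have "i < n"
  proof (rule ccontr)
    assume "\<not> i < n"
    then have "w (int i) \<le> int i" "w (int i + 1) = int i + 1"
      using D_group_bound[OF w, of "int i"] D_group_fixes[OF w, of "int i"] D_group_fixes[OF w, of "int i + 1"]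
      by (cases "i = n"; auto)+
    then show False using d Simple by (simp add: descent_def)
  qed
  then show ?thesis using Simple c by (auto simp: rank_letters_def letters_def)
qed (simp add: rank_letters_def)

lemma reduced_words_rank:
  assumes n: "2 \<le> n" and "w \<in> D_group n" "a \<in> reduced_words w"
  shows "set a \<subseteq> rank_letters n"
  using assms(2,3)
proof (induction a arbitrary: w rule: rev_induct)
  case (snoc c a)
  have c: "c \<in> letters" "descent w c" "a \<in> reduced_words (w \<circ> gen c)"
    using snoc.prems snoc_in_reduced_words[OF D_group_subset_D_infty[OF snoc.prems(1)]] by auto
  then have cr: "c \<in> rank_letters n" using descent_in_rank_letters snoc.prems by blast
  then have "w \<circ> gen c \<in> D_group n" using D_group_gen n snoc.prems by blast
  then show ?case using snoc.IH c cr by auto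
qed simp

lemma finite_reduced_words:
  assumes "w \<in> D_infty"
  shows "finite (reduced_words w)"
proof -
  obtain n where n: "2 \<le> n" "w \<in> D_group n" using assms by (rule D_inftyE)
  have "reduced_words w \<subseteq> {a. set a \<subseteq> rank_letters n \<and> length a = cox_length w}"
    using reduced_words_rank[OF n] by (auto simp: reduced_words_def)
  then show ?thesis using finite_lists_length_eq[OF finite_rank_letters] by (rule finite_subset)
qed

text \<open>A shorter word for one factor would give a shorter word for w; hence both factors are
  reduced and their lengths add up.\<close>

lemma reduced_words_append:
  assumes "a @ b \<in> reduced_words w"
  shows "a \<in> reduced_words (word_perm a)" "b \<in> reduced_words (word_perm b)"
    "cox_length (word_perm a) + cox_length (word_perm b) = cox_length w"
proof -
  have ab: "set a \<subseteq> letters" "set b \<subseteq> letters" "word_perm a \<circ> word_perm b = w"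
    and l: "length a + length b = cox_length w"
    using assms by (auto simp: reduced_words_def word_perm_append)
  obtain a' b' where a'b': "a' \<in> reduced_words (word_perm a)" "b' \<in> reduced_words (word_perm b)"
    using ab word_perm_in_D_infty reduced_words_nonempty by meson
  have "cox_length w \<le> length (a' @ b')"
    using cox_length_le[of "a' @ b'"] a'b' ab by (auto simp: reduced_words_def word_perm_append)
  then have "cox_length w \<le> cox_length (word_perm a) + cox_length (word_perm b)"
    using a'b' by (auto simp: reduced_words_def)
  then have "cox_length (word_perm a) = length a" "cox_length (word_perm b) = length b"
    using cox_length_le[OF ab(1)] cox_length_le[OF ab(2)] l by auto
  then show "a \<in> reduced_words (word_perm a)" "b \<in> reduced_words (word_perm b)"
    "cox_length (word_perm a) + cox_length (word_perm b) = cox_length w"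
    using ab l by (auto simp: reduced_words_def)
qed

abbreviation simple_letters :: "nat \<Rightarrow> letter set" where
  "simple_letters n \<equiv> {Simple i | i. 1 \<le> i \<and> i < n}"

text \<open>Products of simple letters keep positive integers positive. Then \<open>Hat1\<close> is
  never a descent, and removing a simple letter preserves the property.\<close>

lemma S_group_reduced_words:
  assumes n: "2 \<le> n" and "v \<in> S_group n" "b \<in> reduced_words v"
  shows "set b \<subseteq> simple_letters n"
proof -
  obtain a where a: "set a \<subseteq> simple_letters n" "v = word_perm a"
    using assms(2) by (auto simp: S_group_def)
  then have ar: "set a \<subseteq> rank_letters n" by (auto simp: rank_letters_def)
  have pos: "0 < word_perm a i" if "set a \<subseteq> simple_letters n" "0 < i" for a i
    using that(1) by (induction a) (auto simp: that word_perm_Cons gen_Simple)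
  have vD: "v \<in> D_group n" using word_perm_in_D_group[OF n ar] a by simp
  have "\<forall>i>0. v i > 0" using pos a by auto
  with vD assms(3) show ?thesis
  proof (induction b arbitrary: v rule: rev_induct)
    case (snoc c b)
    have c: "c \<in> letters" "descent v c" "b \<in> reduced_words (v \<circ> gen c)"
      using snoc.prems snoc_in_reduced_words[OF D_group_subset_D_infty[OF snoc.prems(1)]] by auto
    then have cr: "c \<in> rank_letters n" using descent_in_rank_letters snoc.prems by blast
    have "v (- 2) < 0" "0 < v 1" using snoc.prems(3) D_group_odd[OF snoc.prems(1), of 2] by auto
    then have "c \<noteq> Hat1" using c(2) by (auto simp: descent_def)
    then have cs: "c \<in> simple_letters n" using cr by (auto simp: rank_letters_def)
    then have "\<forall>i>0. (v \<circ> gen c) i > 0" using snoc.prems(3) by (auto simp: gen_Simple)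
    then show ?case using snoc.IH[OF D_group_gen[OF n cr snoc.prems(1)] c(3)] cs by auto
  qed simp
qed

lemma gen_Hat1_Simple1: "gen Hat1 \<circ> gen (Simple 1) = gen (Simple 1) \<circ> gen Hat1"
  by (auto simp: fun_eq_iff gen_Hat1 gen_Simple)

section \<open>Substitutions into Schubert polynomials\<close>

text \<open>With f read as the sum of the terms f w u_w in the nil-Coxeter algebra, this is right
  multiplication by 1 + t u_a. Correspondingly \<open>delta_id\<close> is the unit of that
  algebra.\<close>

definition step :: "letter \<Rightarrow> mpoly \<Rightarrow> ((int \<Rightarrow> int) \<Rightarrow> mpoly) \<Rightarrow> (int \<Rightarrow> int) \<Rightarrow> mpoly" where
  "step a t f w = f w + (if descent w a then t * f (w \<circ> gen a) else 0)"

definition steps :: "(letter \<times> mpoly) list \<Rightarrow> ((int \<Rightarrow> int) \<Rightarrow> mpoly) \<Rightarrow> (int \<Rightarrow> int) \<Rightarrow> mpoly" where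
  "steps fs f = fold (\<lambda>(a, t). step a t) fs f"

definition delta_id :: "(int \<Rightarrow> int) \<Rightarrow> mpoly" where
  "delta_id w = (if w = id then 1 else 0)"

lemma steps_Nil [simp]: "steps [] f = f"
  by (simp add: steps_def)

lemma steps_Cons [simp]: "steps ((a, t) # fs) f = steps fs (step a t f)"
  by (simp add: steps_def)

lemma steps_append [simp]: "steps (fs @ gs) f = steps gs (steps fs f)"
  by (simp add: steps_def)

lemma descent_gen: "a \<in> letters \<Longrightarrow> descent (w \<circ> gen a) a \<longleftrightarrow> w (low a) < w (high a)"
  by (simp add: descent_def gen_low gen_high)

text \<open>This is (1 - t u_a)(1 + t u_a) = 1, which holds since u_a squares to 0: if a is a
  descent of w, it is none of \<open>w \<circ> gen a\<close>.\<close>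

lemma step_step_neg: "a \<in> letters \<Longrightarrow> step a t (step a (- t) f) = f"
  using descent_gen[of a] by (fastforce simp: step_def fun_eq_iff descent_def)

lemma steps_steps_neg:
  assumes "set as \<subseteq> letters"
  shows "steps (map (\<lambda>a. (a, t)) as) (steps (map (\<lambda>a. (a, - t)) (rev as)) f) = f"
  using assms by (induction as arbitrary: f) (auto simp: step_step_neg)

text \<open>Products with generators of rank n stay in \<open>D_group n\<close>, so an identity
  known only on that group can be used underneath further steps.\<close>

lemma step_cong:
  assumes "2 \<le> n" "a \<in> rank_letters n" "\<And>v. v \<in> D_group n \<Longrightarrow> f v = g v" "w \<in> D_group n"
  shows "step a t f w = step a t g w"
  using assms D_group_gen[OF assms(1,2,4)] by (simp add: step_def)

lemma steps_cong:
  assumes "2 \<le> n" "fst ` set fs \<subseteq> rank_letters n"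
    and "\<And>v. v \<in> D_group n \<Longrightarrow> f v = g v" "w \<in> D_group n"
  shows "steps fs f w = steps fs g w"
  using assms(2-4)
proof (induction fs arbitrary: f g)
  case (Cons p fs)
  obtain a t where p: "p = (a, t)" by force
  have "steps fs (step a t f) w = steps fs (step a t g) w"
    using Cons.prems p by (intro Cons.IH step_cong[OF assms(1)]) auto
  then show ?case by (simp add: p)
qed auto

text \<open>The values q r are arbitrary rather than power sums of chosen arguments, since only
  their change by the hatted generator matters.\<close>

fun specialize_var :: "(nat \<Rightarrow> mpoly) \<Rightarrow> (nat \<Rightarrow> mpoly) \<Rightarrow> mvar \<Rightarrow> mpoly" where
  "specialize_var y q (Zvar i) = y i"
| "specialize_var y q (Xvar i) = pvar (Xvar i)"
| "specialize_var y q (Pvar r) = q r"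

definition insert_at :: "nat \<Rightarrow> mpoly \<Rightarrow> (nat \<Rightarrow> mpoly) \<Rightarrow> nat \<Rightarrow> mpoly" where
  "insert_at i t y j = (if j < i then y j else if j = i then t else y (j - 1))"

section \<open>The letters of the base with their variables, in reading order\<close>

definition gamma_factors :: "nat \<Rightarrow> mpoly \<Rightarrow> (letter \<times> mpoly) list" where
  "gamma_factors n t = map (\<lambda>i. (Simple i, t)) (rev [2..<n]) @ [(Simple 1, t), (Hat1, t)] @
     map (\<lambda>i. (Simple i, t)) [2..<n]"

definition x_factors :: "nat \<Rightarrow> nat list \<Rightarrow> (letter \<times> mpoly) list" where
  "x_factors n ms = concat (map (\<lambda>m. gamma_factors n (pvar (Xvar m))) ms)"

definition z_factors :: "nat \<Rightarrow> nat list \<Rightarrow> (letter \<times> mpoly) list" where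
  "z_factors n is = concat (map (\<lambda>i. map (\<lambda>j. (Simple j, pvar (Zvar i))) (rev [i..<n])) is)"

lemma gamma_factors_rank: "2 \<le> n \<Longrightarrow> fst ` set (gamma_factors n t) \<subseteq> rank_letters n"
  by (auto simp: gamma_factors_def rank_letters_def)

lemma z_factors_rank: "\<forall>i\<in>set is. 1 \<le> i \<Longrightarrow> fst ` set (z_factors n is) \<subseteq> rank_letters n"
  by (fastforce simp: z_factors_def rank_letters_def)

locale schubert_family =
  fixes \<DD> :: "(int \<Rightarrow> int) \<Rightarrow> mpoly" and n :: nat
  assumes family: "schubert_D_family \<DD>" and n: "2 \<le> n"
begin

definition specialized :: "(nat \<Rightarrow> mpoly) \<Rightarrow> (nat \<Rightarrow> mpoly) \<Rightarrow> (int \<Rightarrow> int) \<Rightarrow> mpoly" where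
  "specialized y q w = psubst (specialize_var y q) (\<DD> w)"

lemma in_zp_ring: "w \<in> D_infty \<Longrightarrow> \<DD> w \<in> zp_ring"
  using family by (simp add: schubert_D_family_def)

text \<open>Schubert polynomials involve only power sums of odd index, so q may be altered at even
  r.\<close>

lemma specialized_cong:
  assumes "w \<in> D_infty" "\<And>i. Zvar i \<in> mvars (\<DD> w) \<Longrightarrow> y i = y' i" "\<And>r. odd r \<Longrightarrow> q r = q' r"
  shows "specialized y q w = specialized y' q' w"
  unfolding specialized_def
proof (rule psubst_cong)
  fix v assume v: "v \<in> mvars (\<DD> w)"
  then have "v \<in> {Zvar i | i. 1 \<le> i} \<union> {Pvar r | r. odd r}"
    using in_zp_ring[OF assms(1)] zp_ring_iff by blast
  then show "specialize_var y q v = specialize_var y' q' v" using assms v by auto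
qed

lemma act_family:
  assumes "w \<in> D_infty" "a \<in> letters"
  shows "act a (\<DD> w) = \<DD> w - simple_root a * (if descent w a then \<DD> (w \<circ> gen a) else 0)"
proof -
  have "divided_diff a (\<DD> w) = (if descent w a then \<DD> (w \<circ> gen a) else 0)"
    using family assms by (simp add: schubert_D_family_def cox_length_less_iff)
  then show ?thesis using divided_diff_eq[OF in_zp_ring[OF assms(1)], of a] by simp
qed

text \<open>Composing a specialization with the action of a amounts to a change of arguments. The
  divided difference equation turns this change into a step whose parameter is the negated value of
  the root.\<close>

lemma specialized_act:
  assumes "w \<in> D_infty" "a \<in> letters"
  shows "psubst (\<lambda>v. psubst (specialize_var y q) (act_var a v)) (\<DD> w) =
    step a (- psubst (specialize_var y q) (simple_root a)) (specialized y q) w"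
proof -
  have "psubst (\<lambda>v. psubst (specialize_var y q) (act_var a v)) (\<DD> w) =
      psubst (specialize_var y q) (act a (\<DD> w))"
    by (simp add: act_def psubst_psubst)
  then show ?thesis
    unfolding act_family[OF assms] by (simp add: psubst_diff psubst_mult step_def specialized_def)
qed

lemma specialized_transpose:
  assumes "w \<in> D_infty" "1 \<le> i"
  shows "specialized (y \<circ> transpose i (i + 1)) q w = step (Simple i) (y (i + 1) - y i) (specialized y q) w"
proof -
  have "specialize_var (y \<circ> transpose i (i + 1)) q = (\<lambda>v. psubst (specialize_var y q) (act_var (Simple i) v))"
  proof
    fix v show "specialize_var (y \<circ> transpose i (i + 1)) q v = psubst (specialize_var y q) (act_var (Simple i) v)"
      by (cases v) simp_all
  qed
  then show ?thesis
    using specialized_act[OF assms(1), of "Simple i" y q] assms(2)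
    by (simp add: letters_def psubst_diff specialized_def[of "y \<circ> _"])
qed

lemma specialized_hat:
  assumes "w \<in> D_infty"
  shows "specialized (y(1 := - y 2, 2 := - y 1)) (\<lambda>r. q r + y 1 ^ r + y 2 ^ r) w =
    step Hat1 (y 1 + y 2) (specialized y q) w"
proof -
  let ?y = "y(1 := - y 2, 2 := - y 1)" and ?q = "\<lambda>r. q r + y 1 ^ r + y 2 ^ r"
  have "specialize_var ?y ?q = (\<lambda>v. psubst (specialize_var y q) (act_var Hat1 v))"
  proof
    fix v show "specialize_var ?y ?q v = psubst (specialize_var y q) (act_var Hat1 v)"
      by (cases v) (simp_all add: psubst_uminus psubst_add psubst_power)
  qed
  moreover have "- psubst (specialize_var y q) (simple_root Hat1) = y 1 + y 2"
    by (simp add: psubst_diff psubst_uminus)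
  ultimately show ?thesis
    using specialized_act[OF assms(1), of Hat1 y q]
    by (simp only: specialized_def[of ?y]) (simp add: letters_def)
qed

text \<open>The value t trades places with its left neighbour y i, so the parameter of the step is t
  - y i.\<close>

lemma specialized_insert_step:
  assumes "w \<in> D_infty" "1 \<le> i"
  shows "specialized (insert_at i t y) q w =
    step (Simple i) (t - y i) (specialized (insert_at (i + 1) t y) q) w"
proof -
  have "insert_at i t y = insert_at (i + 1) t y \<circ> transpose i (i + 1)"
    by (auto simp: fun_eq_iff insert_at_def transpose_def)
  then show ?thesis
    using specialized_transpose[OF assms, of "insert_at (i + 1) t y" q]
    by (simp add: insert_at_def)
qed

lemma finite_Zvar_bound: "\<exists>M. \<forall>i. Zvar i \<in> mvars f \<longrightarrow> i < M"
proof -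
  have "inj Zvar" by (simp add: inj_def)
  then have "finite (Zvar -` mvars f)" using finite_mvars by (intro finite_vimageI)
  then obtain M where "\<forall>i \<in> Zvar -` mvars f. i < M" using finite_nat_set_iff_bounded by auto
  then show ?thesis by auto
qed

text \<open>Elements of \<open>D_group n\<close> have no descent at j \<ge> n, so t can be moved
  past the last variable of the polynomial, where it is invisible, without any change.\<close>

lemma specialized_insert_far:
  assumes w: "w \<in> D_group n" and i: "n \<le> i"
  shows "specialized (insert_at i t y) q w = specialized y q w"
proof -
  obtain M where M: "\<And>j. Zvar j \<in> mvars (\<DD> w) \<Longrightarrow> j < M" using finite_Zvar_bound by blast
  have wi: "w \<in> D_infty" using w by (rule D_group_subset_D_infty)
  have "i \<le> max i M" by simp
  then have "specialized (insert_at i t y) q w = specialized (insert_at (max i M) t y) q w"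
    using i
  proof (induction rule: inc_induct)
    case (step j)
    then have "\<not> descent w (Simple j)"
      using descent_in_rank_letters[OF w, of "Simple j"] n by (auto simp: letters_def rank_letters_def)
    then show ?case using step n specialized_insert_step[OF wi, of j t y q] by (simp add: step_def)
  qed simp
  also have "\<dots> = specialized y q w"
    using M by (intro specialized_cong[OF wi]) (force simp: insert_at_def)+
  finally show ?thesis .
qed

text \<open>The value travels from position n, where it has no effect, down to i. The entries that
  it passes vanish, hence every step has parameter t.\<close>

lemma specialized_insert:
  assumes i: "1 \<le> i" "i \<le> n" and y: "\<And>j. i \<le> j \<Longrightarrow> y j = 0" and w: "w \<in> D_group n"
  shows "specialized (insert_at i t y) q w =
    steps (map (\<lambda>j. (Simple j, t)) (rev [i..<n])) (specialized y q) w"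
  using i(2) i(1) y w
proof (induction i arbitrary: w rule: inc_induct)
  case base
  then show ?case by (simp add: specialized_insert_far)
next
  case (step i)
  have r: "Simple i \<in> rank_letters n" using step by (auto simp: rank_letters_def)
  have "specialized (insert_at i t y) q w = step (Simple i) t (specialized (insert_at (i + 1) t y) q) w"
    using specialized_insert_step[of w i t y q] step by (simp add: D_group_subset_D_infty)
  also have "\<dots> = step (Simple i) t (steps (map (\<lambda>j. (Simple j, t)) (rev [Suc i..<n])) (specialized y q)) w"
    using step by (intro step_cong[OF n r]) auto
  also have "\<dots> = steps (map (\<lambda>j. (Simple j, t)) (rev [i..<n])) (specialized y q) w"
    using step.hyps by (simp add: upt_conv_Cons)
  finally show ?case .
qed

lemma specialized_gamma:
  assumes w: "w \<in> D_group n"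
  shows "specialized (\<lambda>_. 0) (\<lambda>r. q r + t ^ r) w = steps (gamma_factors n t) (specialized (\<lambda>_. 0) q) w"
proof -
  let ?q = "\<lambda>r. q r + t ^ r" and ?up = "map Simple [2..<n]"
  have up: "set ?up \<subseteq> letters" "set ?up \<subseteq> rank_letters n" by (auto simp: letters_def rank_letters_def)
  \<comment> \<open>The letters 2, ..., n - 1 are inserted together with their inverse; the inverse,
    with parameter - t, is the move of the value - t from infinity to position 2.\<close>
  have "specialized (\<lambda>_. 0) ?q =
      steps (map (\<lambda>a. (a, t)) ?up) (steps (map (\<lambda>a. (a, - t)) (rev ?up)) (specialized (\<lambda>_. 0) ?q))"
    by (simp only: steps_steps_neg[OF up(1)])
  then have "specialized (\<lambda>_. 0) ?q w =
      steps (map (\<lambda>a. (a, t)) ?up) (steps (map (\<lambda>a. (a, - t)) (rev ?up)) (specialized (\<lambda>_. 0) ?q)) w"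
    by simp
  also have "\<dots> = steps (map (\<lambda>a. (a, t)) ?up) (specialized (insert_at 2 (- t) (\<lambda>_. 0)) ?q) w"
  proof (rule steps_cong[OF n _ _ w])
    fix v assume v: "v \<in> D_group n"
    show "steps (map (\<lambda>a. (a, - t)) (rev ?up)) (specialized (\<lambda>_. 0) ?q) v =
        specialized (insert_at 2 (- t) (\<lambda>_. 0)) ?q v"
      using specialized_insert[of 2 "\<lambda>_. 0" v "- t" ?q] v n by (simp add: rev_map[symmetric] comp_def)
  qed (use up in auto)
  also have "\<dots> = steps (map (\<lambda>a. (a, t)) ?up) (step Hat1 t (specialized (insert_at 1 t (\<lambda>_. 0)) q)) w"
  proof (rule steps_cong[OF n _ _ w])
    fix v assume v: "v \<in> D_group n"
    then have vi: "v \<in> D_infty" by (rule D_group_subset_D_infty)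
    let ?y = "insert_at 1 t (\<lambda>_. 0)"
    have sum: "?y 1 + ?y 2 = t" by (simp add: insert_at_def)
    have "insert_at 2 (- t) (\<lambda>_. 0) = ?y(1 := - ?y 2, 2 := - ?y 1)"
      by (auto simp: insert_at_def fun_eq_iff)
    \<comment> \<open>The hatted generator adds t ^ r + 0 ^ r to q r. For odd r the exponent is
      positive, so 0 ^ r vanishes.\<close>
    then have "specialized (insert_at 2 (- t) (\<lambda>_. 0)) ?q v =
        specialized (?y(1 := - ?y 2, 2 := - ?y 1)) (\<lambda>r. q r + ?y 1 ^ r + ?y 2 ^ r) v"
      using vi by (intro specialized_cong) (auto simp: insert_at_def elim!: oddE)
    then show "specialized (insert_at 2 (- t) (\<lambda>_. 0)) ?q v = step Hat1 t (specialized ?y q) v"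
      using specialized_hat[OF vi, of ?y q] unfolding sum by (rule trans)
  qed (use up in auto)
  also have "\<dots> = steps (map (\<lambda>a. (a, t)) ?up) (step Hat1 t
      (steps (map (\<lambda>j. (Simple j, t)) (rev [1..<n])) (specialized (\<lambda>_. 0) q))) w"
  proof (rule steps_cong[OF n _ _ w])
    fix v assume v: "v \<in> D_group n"
    show "step Hat1 t (specialized (insert_at 1 t (\<lambda>_. 0)) q) v =
        step Hat1 t (steps (map (\<lambda>j. (Simple j, t)) (rev [1..<n])) (specialized (\<lambda>_. 0) q)) v"
      using n v specialized_insert[of 1] by (intro step_cong[OF n]) (auto simp: rank_letters_def)
  qed (use up in auto)
  also have "rev [1..<n] = rev [2..<n] @ [1]"
    using n by (simp add: upt_conv_Cons numeral_2_eq_2)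
  finally show ?thesis by (simp add: gamma_factors_def comp_def)
qed

text \<open>If \<DD> w were 0, its divided difference at a descent would vanish too, although it is
  the nonzero polynomial of a shorter element.\<close>

lemma family_nonzero:
  assumes "w \<in> D_infty"
  shows "\<DD> w \<noteq> 0"
  using assms
proof (induction "cox_length w" arbitrary: w rule: less_induct)
  case less
  show ?case
  proof (cases "w = id")
    case True
    then show ?thesis using family by (simp add: schubert_D_family_def)
  next
    case False
    obtain m where m: "2 \<le> m" "w \<in> D_group m" using less.prems by (rule D_inftyE)
    then obtain a where a: "a \<in> letters" "descent w a" using exists_descent[OF m False] rank_letters_subset by blast
    then have "\<DD> (w \<circ> gen a) \<noteq> 0"
      using less cox_length_descent[OF a(1) less.prems a(2)] D_infty_gen by auto
    moreover have "0 = - (simple_root a * \<DD> (w \<circ> gen a))" if "\<DD> w = 0"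
      using act_family[OF less.prems a(1)] a(2) that by (simp add: act_def)
    ultimately show ?thesis using simple_root_nonzero by force
  qed
qed

text \<open>By homogeneity a nonzero constant term forces degree 0. A constant is fixed by every
  generator, so its divided difference at a descent would vanish, against
  \<open>family_nonzero\<close>.\<close>

lemma family_constant_term:
  assumes w: "w \<in> D_infty" "w \<noteq> id"
  shows "Poly_Mapping.lookup (\<DD> w) 0 = 0"
proof (rule ccontr)
  assume "Poly_Mapping.lookup (\<DD> w) 0 \<noteq> 0"
  then have 0: "0 \<in> Poly_Mapping.keys (\<DD> w)" by (simp add: in_keys_iff)
  obtain d where d: "\<And>m. m \<in> Poly_Mapping.keys (\<DD> w) \<Longrightarrow>
      (\<Sum>v \<in> Poly_Mapping.keys m. Poly_Mapping.lookup m v * var_degree v) = d"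
    using family w by (auto simp: schubert_D_family_def homogeneous_def)
  have "mvars (\<DD> w) = {}"
  proof (rule ccontr)
    assume "mvars (\<DD> w) \<noteq> {}"
    then obtain v where "v \<in> mvars (\<DD> w)" by blast
    then obtain m where v: "m \<in> Poly_Mapping.keys (\<DD> w)" "v \<in> Poly_Mapping.keys m" "v \<in> mvars (\<DD> w)"
      by (auto simp: mvars_def)
    then have "v \<in> {Zvar i | i. 1 \<le> i} \<union> {Pvar r | r. odd r}"
      using in_zp_ring[OF w(1)] zp_ring_iff by blast
    \<comment> \<open>All variables of the ring have positive degree, the power sums because their
      index is odd.\<close>
    then have "var_degree v \<noteq> 0" by (auto elim: oddE)
    moreover have "(\<Sum>v \<in> Poly_Mapping.keys m. Poly_Mapping.lookup m v * var_degree v) = 0"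
      using d[OF v(1)] d[OF 0] by simp
    ultimately show False using v by (auto simp: in_keys_iff)
  qed
  then have act: "act a (\<DD> w) = \<DD> w" for a
    unfolding act_def using psubst_cong[of "\<DD> w" "act_var a" pvar] by (simp add: psubst_pvar_id)
  obtain m where m: "2 \<le> m" "w \<in> D_group m" using w(1) by (rule D_inftyE)
  then obtain a where a: "a \<in> letters" "descent w a" using exists_descent[OF m w(2)] rank_letters_subset by blast
  have "simple_root a * \<DD> (w \<circ> gen a) = 0" using act_family[OF w(1) a(1)] a(2) act by simp
  then show False
    using simple_root_nonzero family_nonzero[OF D_infty_gen[OF a(1) w(1)]] by auto
qed

lemma specialized_zero:
  assumes "w \<in> D_infty"
  shows "specialized (\<lambda>_. 0) (\<lambda>_. 0) w = delta_id w"
proof -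
  have "monomial_subst (specialize_var (\<lambda>_. 0) (\<lambda>_. 0)) m = (if m = 0 then 1 else 0)"
    if "m \<in> Poly_Mapping.keys (\<DD> w)" for m
  proof (cases "m = 0")
    case False
    then obtain v where v: "v \<in> Poly_Mapping.keys m" using keys_eq_empty by blast
    then have "v \<in> mvars (\<DD> w)" using that by (auto simp: mvars_def)
    then have "v \<in> {Zvar i | i. 1 \<le> i} \<union> {Pvar r | r. odd r}"
      using in_zp_ring[OF assms] zp_ring_iff by blast
    then show ?thesis using v False
      by (auto simp: monomial_subst_def in_keys_iff intro!: bexI[of _ v])
  qed simp
  then have "specialized (\<lambda>_. 0) (\<lambda>_. 0) w = (\<Sum>m\<in>Poly_Mapping.keys (\<DD> w).
      const (Poly_Mapping.lookup (\<DD> w) m) * (if m = 0 then 1 else 0))"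
    unfolding specialized_def by (subst psubst_superset[of "Poly_Mapping.keys (\<DD> w)"]) (auto intro!: sum.cong)
  also have "\<dots> = (\<Sum>m\<in>Poly_Mapping.keys (\<DD> w).
      if m = 0 then const (Poly_Mapping.lookup (\<DD> w) m) else 0)"
    by (rule sum.cong) auto
  also have "\<dots> = const (Poly_Mapping.lookup (\<DD> w) 0)"
    by (simp add: in_keys_iff)
  finally show ?thesis
    using family_constant_term[OF assms] family by (auto simp: delta_id_def schubert_D_family_def)
qed

text \<open>The arguments are adjoined in the order x_k, ..., x_1, because each new block acts after
  the earlier ones and block k is read first.\<close>

lemma specialized_x:
  assumes "j \<le> k + 1" "w \<in> D_group n"
  shows "specialized (\<lambda>_. 0) (\<lambda>r. \<Sum>i = j..k. pvar (Xvar i) ^ r) w =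
    steps (x_factors n (rev [j..<k + 1])) delta_id w"
  using assms
proof (induction j arbitrary: w rule: inc_induct)
  case base
  then show ?case using specialized_zero by (simp add: x_factors_def D_group_subset_D_infty)
next
  case (step j)
  have "(\<lambda>r. \<Sum>i = j..k. pvar (Xvar i) ^ r) = (\<lambda>r. (\<Sum>i = Suc j..k. pvar (Xvar i) ^ r) + pvar (Xvar j) ^ r)"
    using step.hyps by (simp add: sum.atLeast_Suc_atMost add.commute)
  then have "specialized (\<lambda>_. 0) (\<lambda>r. \<Sum>i = j..k. pvar (Xvar i) ^ r) w =
      steps (gamma_factors n (pvar (Xvar j))) (specialized (\<lambda>_. 0) (\<lambda>r. \<Sum>i = Suc j..k. pvar (Xvar i) ^ r)) w"
    using specialized_gamma[OF step.prems] by simp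
  also have "\<dots> = steps (gamma_factors n (pvar (Xvar j))) (steps (x_factors n (rev [Suc j..<k + 1])) delta_id) w"
    using step gamma_factors_rank[OF n] by (intro steps_cong[OF n]) auto
  also have "\<dots> = steps (x_factors n (rev [j..<k + 1])) delta_id w"
    using step.hyps by (simp add: x_factors_def upt_conv_Cons del: upt_Suc)
  finally show ?case .
qed

section \<open>Adjoining the arguments z\<close>

definition z_prefix :: "nat \<Rightarrow> nat \<Rightarrow> mpoly" where
  "z_prefix m i = (if 1 \<le> i \<and> i \<le> m then pvar (Zvar i) else 0)"

lemma insert_z_prefix: "insert_at (m + 1) (pvar (Zvar (m + 1))) (z_prefix m) = z_prefix (m + 1)"
  by (auto simp: fun_eq_iff insert_at_def z_prefix_def)

lemma specialized_z:
  assumes "m < n" "w \<in> D_group n"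
  shows "specialized (z_prefix m) q w = steps (z_factors n [1..<m + 1]) (specialized (\<lambda>_. 0) q) w"
  using assms
proof (induction m arbitrary: w)
  case 0
  have "z_prefix 0 = (\<lambda>_. 0)" by (auto simp: z_prefix_def)
  then show ?case by (simp add: z_factors_def)
next
  case (Suc m)
  have "specialized (z_prefix (Suc m)) q w =
      steps (map (\<lambda>j. (Simple j, pvar (Zvar (m + 1)))) (rev [m + 1..<n])) (specialized (z_prefix m) q) w"
    using specialized_insert[of "m + 1" "z_prefix m" w "pvar (Zvar (m + 1))" q] Suc.prems insert_z_prefix[of m]
    by (simp add: z_prefix_def)
  also have "\<dots> = steps (map (\<lambda>j. (Simple j, pvar (Zvar (m + 1)))) (rev [m + 1..<n]))
      (steps (z_factors n [1..<m + 1]) (specialized (\<lambda>_. 0) q)) w"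
    using Suc by (intro steps_cong[OF n]) (auto simp: rank_letters_def)
  also have "\<dots> = steps (z_factors n [1..<Suc m + 1]) (specialized (\<lambda>_. 0) q) w"
    by (simp add: z_factors_def)
  finally show ?case .
qed

text \<open>Passing from m to m + 1 inserts a variable at position m + 1 \<ge> n, where it has no
  effect on \<open>D_group n\<close>.\<close>

lemma specialized_z_prefix_far:
  assumes "w \<in> D_group n" "n \<le> m + 1"
  shows "specialized (z_prefix m) q w = specialized (z_prefix (n - 1)) q w"
proof -
  have "n - 1 \<le> m" using assms(2) by simp
  then show ?thesis
  proof (induction m rule: dec_induct)
    case (step m)
    then show ?case
      using specialized_insert_far[OF assms(1), of "m + 1" "pvar (Zvar (m + 1))" "z_prefix m" q] insert_z_prefix[of m]
      by simp
  qed simp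
qed

lemma x_truncation_family:
  assumes w: "w \<in> D_group n"
  shows "x_truncation k (\<DD> w) = steps (x_factors n (rev [1..<k + 1]) @ z_factors n [1..<n]) delta_id w"
proof -
  have wi: "w \<in> D_infty" using w by (rule D_group_subset_D_infty)
  let ?q = "\<lambda>r. \<Sum>i = 1..k. pvar (Xvar i) ^ r"
  obtain M where M: "\<And>j. Zvar j \<in> mvars (\<DD> w) \<Longrightarrow> j < M" using finite_Zvar_bound by blast
  have Z1: "1 \<le> j" if "Zvar j \<in> mvars (\<DD> w)" for j
    using that in_zp_ring[OF wi] by (auto simp: zp_ring_iff)
  have "truncate_var k = specialize_var (\<lambda>i. pvar (Zvar i)) ?q"
  proof
    fix v show "truncate_var k v = specialize_var (\<lambda>i. pvar (Zvar i)) ?q v" by (cases v) auto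
  qed
  then have "x_truncation k (\<DD> w) = specialized (\<lambda>i. pvar (Zvar i)) ?q w"
    by (simp add: x_truncation_def specialized_def)
  \<comment> \<open>Only finitely many z occur in the polynomial, so a long enough prefix replaces
    the full sequence.\<close>
  also have "\<dots> = specialized (z_prefix (M + n)) ?q w"
    using M Z1 by (intro specialized_cong[OF wi]) (fastforce simp: z_prefix_def)+
  also have "\<dots> = specialized (z_prefix (n - 1)) ?q w"
    by (rule specialized_z_prefix_far[OF w]) simp
  also have "\<dots> = steps (z_factors n [1..<n]) (specialized (\<lambda>_. 0) ?q) w"
    using specialized_z[of "n - 1" w ?q] w n by simp
  also have "\<dots> = steps (z_factors n [1..<n]) (steps (x_factors n (rev [1..<k + 1])) delta_id) w"
    using w by (intro steps_cong[OF n] z_factors_rank specialized_x) auto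
  finally show ?thesis by simp
qed

end

section \<open>Pipe dreams\<close>

text \<open>The elbow with two faucets gets one fixed order of its commuting letters, so that every
  pipe dream has a single representative word.\<close>

fun tile_word :: "box \<Rightarrow> tile \<Rightarrow> letter list" where
  "tile_word b Elbow = []"
| "tile_word b Cross = [Simple (box_index b)]"
| "tile_word b Faucet_Cross = [Hat1]"
| "tile_word b Faucet_Elbow = [Simple 1, Hat1]"

fun box_factors :: "box \<Rightarrow> (letter \<times> mpoly) list" where
  "box_factors (Corner m) = [(Simple 1, pvar (Xvar m)), (Hat1, pvar (Xvar m))]"
| "box_factors b = [(Simple (box_index b), pvar (box_var b))]"

definition dream_word :: "box list \<Rightarrow> (box \<Rightarrow> tile) \<Rightarrow> letter list" where
  "dream_word bs D = concat (map (\<lambda>b. tile_word b (D b)) bs)"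

definition dream_weight :: "box set \<Rightarrow> (box \<Rightarrow> tile) \<Rightarrow> mpoly" where
  "dream_weight B D = (\<Prod>b\<in>B. pvar (box_var b) ^ tile_weight (D b))"

text \<open>Allowing any list of boxes makes induction along the reading order possible.\<close>

definition dream_sum :: "box list \<Rightarrow> (int \<Rightarrow> int) \<Rightarrow> mpoly" where
  "dream_sum bs w = (\<Sum>D \<in> (\<Pi>\<^sub>E b \<in> set bs. allowed_tiles b).
     if dream_word bs D \<in> reduced_words w then dream_weight (set bs) D else 0)"

lemma dream_sum_snoc:
  assumes "b \<notin> set bs"
  shows "dream_sum (bs @ [b]) w = (\<Sum>t \<in> allowed_tiles b. \<Sum>D \<in> (\<Pi>\<^sub>E b \<in> set bs. allowed_tiles b).
     if dream_word bs D @ tile_word b t \<in> reduced_words w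
     then pvar (box_var b) ^ tile_weight t * dream_weight (set bs) D else 0)"
proof -
  have inj: "inj_on (\<lambda>(y, g). g(b := y)) (allowed_tiles b \<times> (\<Pi>\<^sub>E b \<in> set bs. allowed_tiles b))"
  proof (rule inj_onI)
    fix p p' assume p: "p \<in> allowed_tiles b \<times> (\<Pi>\<^sub>E b \<in> set bs. allowed_tiles b)"
      "p' \<in> allowed_tiles b \<times> (\<Pi>\<^sub>E b \<in> set bs. allowed_tiles b)"
      "(\<lambda>(y, g). g(b := y)) p = (\<lambda>(y, g). g(b := y)) p'"
    obtain y g y' g' where yg: "p = (y, g)" "p' = (y', g')" by (metis surj_pair)
    then have eq: "g(b := y) = g'(b := y')" using p by simp
    \<comment> \<open>Fillings are \<open>undefined\<close> off their boxes, so the filling of the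
      earlier boxes is recovered by resetting b.\<close>
    have "g b = undefined" "g' b = undefined" using p yg assms by (auto simp: PiE_def extensional_def)
    then have "g = g'" using eq by (metis fun_upd_triv fun_upd_upd)
    moreover have "y = y'" using eq by (metis fun_upd_same)
    ultimately show "p = p'" using yg by simp
  qed
  have word: "dream_word (bs @ [b]) (D(b := t)) = dream_word bs D @ tile_word b t" for D t
  proof -
    have "map (\<lambda>c. tile_word c ((D(b := t)) c)) bs = map (\<lambda>c. tile_word c (D c)) bs"
      using assms by (intro map_cong) auto
    then show ?thesis unfolding dream_word_def map_append concat_append by (simp only:) simp
  qed
  have weight: "dream_weight (insert b (set bs)) (D(b := t)) =
      pvar (box_var b) ^ tile_weight t * dream_weight (set bs) D" for D t
  proof -
    have "(\<Prod>c\<in>set bs. pvar (box_var c) ^ tile_weight ((D(b := t)) c)) =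
        (\<Prod>c\<in>set bs. pvar (box_var c) ^ tile_weight (D c))"
      using assms by (intro prod.cong) auto
    then show ?thesis using assms by (simp add: dream_weight_def)
  qed
  have set: "set (bs @ [b]) = insert b (set bs)" by simp
  show ?thesis
    unfolding dream_sum_def set PiE_insert_eq
    by (subst sum.reindex[OF inj]) (auto simp: word weight sum.cartesian_product intro!: sum.cong)
qed

lemma reduced_words_snoc_two:
  assumes "w \<in> D_infty"
  shows "a @ [c, d] \<in> reduced_words w \<longleftrightarrow> c \<in> letters \<and> d \<in> letters \<and> descent w d \<and>
    descent (w \<circ> gen d) c \<and> a \<in> reduced_words (w \<circ> gen d \<circ> gen c)"
proof -
  have "a @ [c, d] \<in> reduced_words w \<longleftrightarrow> (a @ [c]) @ [d] \<in> reduced_words w" by simp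
  then show ?thesis
    unfolding snoc_in_reduced_words[OF assms] using snoc_in_reduced_words[OF D_infty_gen[OF _ assms]] by blast
qed

text \<open>The four tiles of a corner are the four terms of (1 + t u_1)(1 + t u_hat1); elsewhere
  elbow and cross are the two terms of 1 + t u_i.\<close>

lemma dream_sum_steps:
  assumes "distinct bs" "\<forall>b\<in>set bs. 1 \<le> box_index b" "w \<in> D_infty"
  shows "dream_sum bs w = steps (concat (map box_factors bs)) delta_id w"
  using assms
proof (induction bs arbitrary: w rule: rev_induct)
  case Nil
  have "[] \<in> reduced_words w \<longleftrightarrow> w = id"
    by (auto simp: reduced_words_def)
  moreover have "dream_sum [] w = (\<Sum>D\<in>{\<lambda>_. undefined}.
      if dream_word [] D \<in> reduced_words w then dream_weight {} D else 0)"
    unfolding dream_sum_def list.set PiE_empty_domain ..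
  ultimately show ?case by (simp add: dream_word_def dream_weight_def delta_id_def)
next
  case (snoc b bs)
  let ?P = "\<Pi>\<^sub>E b \<in> set bs. allowed_tiles b"
  let ?x = "pvar (box_var b)"
  define f where "f = steps (concat (map box_factors bs)) delta_id"
  have IH: "dream_sum bs v = f v" if "v \<in> D_infty" for v
    using snoc.IH[OF _ _ that] snoc.prems by (simp add: f_def)
  have b: "b \<notin> set bs" "Simple (box_index b) \<in> letters" "Simple 1 \<in> letters" "Hat1 \<in> letters"
    using snoc.prems by (auto simp: letters_def)
  have elbow: "(\<Sum>D\<in>?P. if dream_word bs D \<in> reduced_words w then dream_weight (set bs) D else 0) = f w"
    using IH[OF snoc.prems(3)] by (simp add: dream_sum_def)
  have pull: "(\<Sum>D\<in>?P. if Q D then x * g D else 0) = x * (\<Sum>D\<in>?P. if Q D then g D else 0)"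
    for Q x and g :: "(box \<Rightarrow> tile) \<Rightarrow> mpoly"
    unfolding sum_distrib_left by (rule sum.cong) auto
  have one: "(\<Sum>D\<in>?P. if dream_word bs D @ [c] \<in> reduced_words w then x * dream_weight (set bs) D else 0) =
      (if descent w c then x * f (w \<circ> gen c) else 0)" if "c \<in> letters" for c x
    using IH[OF D_infty_gen[OF that snoc.prems(3)]] that
    unfolding pull by (simp add: snoc_in_reduced_words[OF snoc.prems(3)] dream_sum_def)
  have two: "(\<Sum>D\<in>?P. if dream_word bs D @ [c, d] \<in> reduced_words w then x * dream_weight (set bs) D else 0) =
      (if descent w d then if descent (w \<circ> gen d) c then x * f (w \<circ> gen d \<circ> gen c) else 0 else 0)"
    if "c \<in> letters" "d \<in> letters" for c d x
    using IH[OF D_infty_gen[OF that(1) D_infty_gen[OF that(2) snoc.prems(3)]]] that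
    unfolding pull by (simp add: reduced_words_snoc_two[OF snoc.prems(3)] dream_sum_def)
  have single: ?case if "allowed_tiles b = {Elbow, Cross}" "box_factors b = [(Simple (box_index b), ?x)]"
    using that by (simp add: dream_sum_snoc[OF b(1)] elbow one[OF b(2)] step_def flip: f_def cong: if_cong)
  show ?case
  proof (cases b)
    case (Corner m)
    show ?thesis
      unfolding dream_sum_snoc[OF b(1)]
      by (simp add: Corner elbow one[OF b(3), simplified] one[OF b(4)] two[OF b(3,4), simplified]
          step_def power2_eq_square flip: f_def cong: if_cong)
        (simp add: algebra_simps)
  qed (use single in auto)
qed

section \<open>The reading order of the base\<close>

lemma set_reading_order: "set (reading_order n k) = pd_base n k"
proof -
  have "set (reading_order n k) =
      (\<Union>m\<in>{1..<k + 1}. Hor m ` {2..<n} \<union> {Corner m} \<union> Ver m ` {2..<n}) \<union>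
      (\<Union>i\<in>{1..<n}. Stair i ` {1..<n - i + 1})"
    by (simp add: reading_order_def del: upt_Suc)
  also have "\<dots> = pd_base n k"
    unfolding pd_base_def by (auto simp: image_iff)
  finally show ?thesis .
qed

lemma distinct_reading_order: "distinct (reading_order n k)"
  unfolding reading_order_def
  by (auto simp: distinct_map inj_on_def intro!: distinct_concat) linarith+

lemma reading_order_factors:
  assumes "2 \<le> n"
  shows "concat (map box_factors (reading_order n k)) = x_factors n (rev [1..<k + 1]) @ z_factors n [1..<n]"
proof -
  have block: "concat (map box_factors (map (Hor m) (rev [2..<n]) @ [Corner m] @ map (Ver m) [2..<n])) =
      gamma_factors n (pvar (Xvar m))" for m
    by (simp add: gamma_factors_def comp_def concat_map_singleton)
  have row: "concat (map box_factors (map (Stair i) (rev [1..<n - i + 1]))) =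
      map (\<lambda>j. (Simple j, pvar (Zvar i))) (rev [i..<n])" if "i \<in> set [1..<n]" for i
  proof -
    \<comment> \<open>Column j of row i carries the letter i + j - 1, so the columns 1, ..., n - i
      yield i, ..., n - 1.\<close>
    have "[i..<n] = map (\<lambda>j. i + j - 1) [1..<n - i + 1]"
      using that by (intro nth_equalityI) (auto simp del: upt_Suc)
    moreover have "concat (map box_factors (map (Stair i) (rev [1..<n - i + 1]))) =
        map (\<lambda>j. (Simple (i + j - 1), pvar (Zvar i))) (rev [1..<n - i + 1])"
      by (simp add: comp_def concat_map_singleton del: upt_Suc)
    ultimately show ?thesis
      by (simp add: rev_map comp_def del: upt_Suc)
  qed
  have concat_map_concat: "concat (map f (concat (map g xs))) = concat (map (\<lambda>x. concat (map f (g x))) xs)"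
    for f :: "box \<Rightarrow> (letter \<times> mpoly) list" and g :: "nat \<Rightarrow> box list" and xs
    by (induction xs) auto
  have "concat (map box_factors (reading_order n k)) =
      concat (map (\<lambda>m. concat (map box_factors (map (Hor m) (rev [2..<n]) @ [Corner m] @ map (Ver m) [2..<n]))) (rev [1..<k + 1])) @
      concat (map (\<lambda>i. concat (map box_factors (map (Stair i) (rev [1..<n - i + 1])))) [1..<n])"
    unfolding reading_order_def map_append concat_append concat_map_concat ..
  also have "\<dots> = x_factors n (rev [1..<k + 1]) @ z_factors n [1..<n]"
    unfolding block x_factors_def z_factors_def
    by (intro arg_cong2[where f = "(@)"] refl arg_cong[where f = concat] map_cong row)
  finally show ?thesis .
qed

lemma tile_word_equiv:
  assumes "u \<in> tile_words b t"
  shows "word_perm u = word_perm (tile_word b t) \<and> length u = length (tile_word b t) \<and> set u = set (tile_word b t)"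
  using assms gen_Hat1_Simple1 by (cases t) (auto simp: word_perm_Cons)

lemma pd_words_equiv:
  assumes "list_all2 (\<lambda>b u. u \<in> tile_words b (D b)) bs us"
  shows "word_perm (concat us) = word_perm (dream_word bs D) \<and>
    length (concat us) = length (dream_word bs D) \<and> set (concat us) = set (dream_word bs D)"
  using assms
proof (induction rule: list_all2_induct)
  case (Cons b bs u us)
  then show ?case using tile_word_equiv[of u b "D b"] by (simp add: dream_word_def word_perm_append)
qed (simp add: dream_word_def)

text \<open>All words of a pipe dream have the same product, length and letters, so one of them
  decides.\<close>

lemma pd_words_reduced_iff: "pd_words n k D \<subseteq> reduced_words w \<longleftrightarrow> dream_word (reading_order n k) D \<in> reduced_words w"
proof
  have "list_all2 (\<lambda>b u. u \<in> tile_words b (D b)) (reading_order n k) (map (\<lambda>b. tile_word b (D b)) (reading_order n k))"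
  proof -
    have "tile_word b t \<in> tile_words b t" for b t by (cases t) auto
    then show ?thesis by (simp add: list_all2_conv_all_nth)
  qed
  then have "dream_word (reading_order n k) D \<in> pd_words n k D"
    unfolding pd_words_def dream_word_def by blast
  then show "pd_words n k D \<subseteq> reduced_words w \<Longrightarrow> dream_word (reading_order n k) D \<in> reduced_words w" by blast
next
  assume r: "dream_word (reading_order n k) D \<in> reduced_words w"
  show "pd_words n k D \<subseteq> reduced_words w"
  proof
    fix c assume "c \<in> pd_words n k D"
    then obtain us where us: "c = concat us" "list_all2 (\<lambda>b u. u \<in> tile_words b (D b)) (reading_order n k) us"
      by (auto simp: pd_words_def)
    show "c \<in> reduced_words w" using pd_words_equiv[OF us(2)] r us(1) by (auto simp: reduced_words_def)
  qed
qed

lemma pipe_dream_sum_steps: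
  assumes n: "2 \<le> n" and w: "w \<in> D_infty"
  shows "pipe_dream_sum n k w = steps (x_factors n (rev [1..<k + 1]) @ z_factors n [1..<n]) delta_id w"
proof -
  have fin: "finite (signed_pipe_dreams n k)"
  proof -
    have "finite (pd_base n k)" by (metis List.finite_set set_reading_order)
    moreover have "finite (allowed_tiles b)" for b by (cases b) auto
    ultimately show ?thesis unfolding signed_pipe_dreams_def by (intro finite_PiE) auto
  qed
  have weight: "Poly_Mapping.single (pd_monomial n k D) 1 = dream_weight (pd_base n k) D" for D
    by (simp add: pd_monomial_def dream_weight_def pvar_power prod_single)
  have "pipe_dream_sum n k w = dream_sum (reading_order n k) w"
    unfolding pipe_dream_sum_def dream_sum_def reduced_pipe_dreams_def pd_words_reduced_iff weight set_reading_order
      sum.inter_filter[OF fin] by (simp add: signed_pipe_dreams_def)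
  also have "\<dots> = steps (concat (map box_factors (reading_order n k))) delta_id w"
  proof (rule dream_sum_steps[OF distinct_reading_order _ w])
    show "\<forall>b\<in>set (reading_order n k). 1 \<le> box_index b"
      unfolding set_reading_order by (auto simp: pd_base_def)
  qed
  finally show ?thesis by (simp add: reading_order_factors[OF n])
qed

section \<open>Functions on words\<close>

text \<open>Functions on words are formal power series in noncommuting letters, and this is their
  product.\<close>

definition conv :: "(letter list \<Rightarrow> mpoly) \<Rightarrow> (letter list \<Rightarrow> mpoly) \<Rightarrow> letter list \<Rightarrow> mpoly" where
  "conv P Q c = (\<Sum>i\<le>length c. P (take i c) * Q (drop i c))"

definition one_fun :: "letter list \<Rightarrow> mpoly" where
  "one_fun c = (if c = [] then 1 else 0)"

definition letter_fun :: "letter \<Rightarrow> mpoly \<Rightarrow> letter list \<Rightarrow> mpoly" where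
  "letter_fun a t c = (if c = [] then 1 else if c = [a] then t else 0)"

definition prod_fun :: "(letter \<times> mpoly) list \<Rightarrow> letter list \<Rightarrow> mpoly" where
  "prod_fun fs = foldr (\<lambda>(a, t). conv (letter_fun a t)) fs one_fun"

text \<open>The projection of such a series to the nil-Coxeter algebra, in which words that are not
  reduced become 0.\<close>

definition coef :: "(letter list \<Rightarrow> mpoly) \<Rightarrow> (int \<Rightarrow> int) \<Rightarrow> mpoly" where
  "coef P w = (\<Sum>c\<in>reduced_words w. P c)"

lemma conv_Nil [simp]: "conv P Q [] = P [] * Q []"
  by (simp add: conv_def)

lemma conv_Cons: "conv P Q (x # c) = P [] * Q (x # c) + conv (\<lambda>a. P (x # a)) Q c"
  by (simp add: conv_def sum.atMost_Suc_shift del: sum.atMost_Suc)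

lemma conv_scale: "conv (\<lambda>a. t * P a) Q c = t * conv P Q c"
  by (simp add: conv_def sum_distrib_left mult.assoc)

lemma conv_add: "conv (\<lambda>a. P a + P' a) Q c = conv P Q c + conv P' Q c"
  by (simp add: conv_def sum.distrib distrib_right)

lemma conv_add_right: "conv P (\<lambda>a. Q a + Q' a) c = conv P Q c + conv P Q' c"
  by (simp add: conv_def sum.distrib distrib_left)

lemma conv_scale_right: "conv P (\<lambda>a. t * Q a) c = t * conv P Q c"
  by (simp add: conv_def sum_distrib_left mult.left_commute)

lemma conv_zero [simp]: "conv (\<lambda>a. 0) Q c = 0"
  by (simp add: conv_def)

lemma conv_assoc: "conv (conv P Q) R c = conv P (conv Q R) c"
proof (induction c arbitrary: P)
  case (Cons x c)
  have "conv (conv P Q) R (x # c) =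
      P [] * Q [] * R (x # c) + conv (\<lambda>a. P [] * Q (x # a) + conv (\<lambda>a. P (x # a)) Q a) R c"
    by (simp add: conv_Cons)
  also have "\<dots> = P [] * (Q [] * R (x # c) + conv (\<lambda>a. Q (x # a)) R c) + conv (conv (\<lambda>a. P (x # a)) Q) R c"
    by (simp add: conv_add conv_scale algebra_simps)
  finally show ?case by (simp add: conv_Cons Cons.IH)
qed simp

lemma conv_assoc': "conv (conv P Q) R = conv P (conv Q R)"
  by (rule ext) (rule conv_assoc)

lemma one_fun_simps [simp]: "one_fun [] = 1" "one_fun (x # c) = 0"
  by (simp_all add: one_fun_def)

lemma conv_one_left [simp]: "conv one_fun Q = Q"
proof
  fix c show "conv one_fun Q c = Q c" by (cases c) (auto simp: conv_Cons)
qed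

lemma conv_one_right [simp]: "conv P one_fun = P"
proof
  fix c show "conv P one_fun c = P c" by (induction c arbitrary: P) (auto simp: conv_Cons)
qed

lemma letter_fun_simps [simp]: "letter_fun a t [] = 1" "letter_fun a t (x # c) = (if x = a then t * one_fun c else 0)"
  by (auto simp: letter_fun_def one_fun_def)

lemma conv_letter_fun_Cons:
  "conv (letter_fun a t) Q (x # c) = Q (x # c) + (if x = a then t * Q c else 0)"
  by (simp add: conv_Cons conv_scale)

lemma prod_fun_simps [simp]:
  "prod_fun [] = one_fun" "prod_fun ((a, t) # fs) = conv (letter_fun a t) (prod_fun fs)"
  by (simp_all add: prod_fun_def)

lemma prod_fun_append: "prod_fun (fs @ gs) = conv (prod_fun fs) (prod_fun gs)"
  by (induction fs) (auto simp: conv_assoc')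

lemma conv_letter_fun_snoc:
  "conv P (letter_fun a t) c = P c + (if c \<noteq> [] \<and> last c = a then t * P (butlast c) else 0)"
proof (induction c arbitrary: P)
  case (Cons x c)
  show ?case
  proof (cases c)
    case Nil
    then show ?thesis by (auto simp: conv_Cons)
  next
    case (Cons y c')
    then have "one_fun c = 0" by simp
    then show ?thesis using Cons.IH[of "\<lambda>a. P (x # a)"] Cons by (simp add: conv_Cons[of _ _ x])
  qed
qed simp

lemma reduced_words_outside:
  assumes "w \<notin> D_infty"
  shows "reduced_words w = {}"
  using assms word_perm_in_D_infty by (auto simp: reduced_words_def)

lemma coef_outside: "w \<notin> D_infty \<Longrightarrow> coef P w = 0"
  by (simp add: coef_def reduced_words_outside)

lemma gen_outside: "a \<in> letters \<Longrightarrow> w \<notin> D_infty \<Longrightarrow> w \<circ> gen a \<notin> D_infty"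
  using D_infty_gen[of a "w \<circ> gen a"] by (auto simp: gen_comp_gen)

text \<open>If a is a descent, the reduced words of w ending in a are those of
  \<open>w \<circ> gen a\<close> followed by a; otherwise there are none. Outside
  \<open>D_infty\<close> both sides vanish, so the equality holds between functions and can be
  iterated.\<close>

lemma coef_conv_letter_fun:
  assumes a: "a \<in> letters"
  shows "coef (conv P (letter_fun a t)) = step a t (coef P)"
proof
  fix w
  show "coef (conv P (letter_fun a t)) w = step a t (coef P) w"
  proof (cases "w \<in> D_infty")
    case True
    let ?L = "{c \<in> reduced_words w. c \<noteq> [] \<and> last c = a}"
    have "coef (conv P (letter_fun a t)) w = coef P w + (\<Sum>c\<in>?L. t * P (butlast c))"
      by (simp add: coef_def conv_letter_fun_snoc sum.distrib sum.inter_filter[OF finite_reduced_words[OF True]])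
    also have "(\<Sum>c\<in>?L. t * P (butlast c)) = (if descent w a then t * coef P (w \<circ> gen a) else 0)"
    proof (cases "descent w a")
      case d: True
      have L: "?L = (\<lambda>b. b @ [a]) ` reduced_words (w \<circ> gen a)"
      proof (intro set_eqI iffI)
        fix c assume "c \<in> ?L"
        then have c: "c = butlast c @ [a]" "c \<in> reduced_words w" by auto
        then have "butlast c \<in> reduced_words (w \<circ> gen a)"
          using snoc_in_reduced_words[OF True, of "butlast c" a] by simp
        then show "c \<in> (\<lambda>b. b @ [a]) ` reduced_words (w \<circ> gen a)" using c(1) by (metis image_eqI)
      qed (use a d snoc_in_reduced_words[OF True] in auto)
      have "inj_on (\<lambda>b. b @ [a]) (reduced_words (w \<circ> gen a))" by (simp add: inj_on_def)
      then show ?thesis unfolding L using d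
        by (simp add: sum.reindex coef_def sum_distrib_left)
    next
      case d: False
      have L: "?L = {}"
      proof (rule equals0I)
        fix c assume "c \<in> ?L"
        then have c: "c = butlast c @ [a]" "c \<in> reduced_words w" by auto
        then show False using snoc_in_reduced_words[OF True, of "butlast c" a] d by simp
      qed
      show ?thesis unfolding L using d by simp
    qed
    finally show ?thesis by (simp add: step_def)
  qed (use gen_outside[OF a] in \<open>simp add: coef_outside step_def\<close>)
qed

lemma coef_conv_prod_fun:
  assumes "fst ` set fs \<subseteq> letters"
  shows "coef (conv P (prod_fun fs)) = steps fs (coef P)"
  using assms
proof (induction fs arbitrary: P)
  case (Cons p fs)
  obtain a t where p: "p = (a, t)" by force
  have "coef (conv P (prod_fun (p # fs))) = coef (conv (conv P (letter_fun a t)) (prod_fun fs))"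
    by (simp add: p conv_assoc')
  then show ?case using Cons by (simp add: p coef_conv_letter_fun)
qed simp

lemma coef_one: "coef one_fun = delta_id"
proof
  fix w
  show "coef one_fun w = delta_id w"
  proof (cases "w = id")
    case True
    then show ?thesis by (simp add: coef_def reduced_words_id delta_id_def)
  next
    case False
    then have "[] \<notin> reduced_words w" by (auto simp: reduced_words_def)
    then have "coef one_fun w = 0"
      unfolding coef_def by (intro sum.neutral) (auto simp: one_fun_def)
    then show ?thesis using False by (simp add: delta_id_def)
  qed
qed

section \<open>The words of a gamma block\<close>

text \<open>The two reduced words \<open>[Simple 1, Hat1]\<close> and \<open>[Hat1, Simple 1]\<close> share the weight of the elbow
  with two faucets evenly.\<close>

definition corner_fun :: "mpoly \<Rightarrow> letter list \<Rightarrow> mpoly" where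
  "corner_fun t c = const (1 / 2) * (conv (letter_fun (Simple 1) t) (letter_fun Hat1 t) c +
     conv (letter_fun Hat1 t) (letter_fun (Simple 1) t) c)"

definition gamma_fun :: "nat \<Rightarrow> mpoly \<Rightarrow> letter list \<Rightarrow> mpoly" where
  "gamma_fun n t = conv (prod_fun (map (\<lambda>i. (Simple i, t)) (rev [2..<n])))
     (conv (corner_fun t) (prod_fun (map (\<lambda>i. (Simple i, t)) [2..<n])))"

text \<open>The two generators commute, and neither changes whether the other is a descent.\<close>

lemma step_commute:
  "step Hat1 t (step (Simple 1) t (coef P)) = step (Simple 1) t (step Hat1 t (coef P))"
proof
  fix w
  have l: "Hat1 \<in> letters" "Simple 1 \<in> letters" by (auto simp: letters_def)
  show "step Hat1 t (step (Simple 1) t (coef P)) w = step (Simple 1) t (step Hat1 t (coef P)) w"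
  proof (cases "w \<in> D_infty")
    case True
    then have odd: "w (- i) = - w i" for i by (auto simp: D_infty_def D_group_odd)
    have "descent (w \<circ> gen (Simple 1)) Hat1 = descent w Hat1" "descent (w \<circ> gen Hat1) (Simple 1) = descent w (Simple 1)"
      using odd[of 1] odd[of 2] by (auto simp: descent_def gen_Hat1 gen_Simple)
    moreover have "w \<circ> gen (Simple 1) \<circ> gen Hat1 = w \<circ> gen Hat1 \<circ> gen (Simple 1)"
      by (metis comp_assoc gen_Hat1_Simple1)
    ultimately show ?thesis by (simp add: step_def algebra_simps)
  qed (use gen_outside l in \<open>simp add: step_def coef_outside\<close>)
qed

lemma half_double: "const (1 / 2) * (f + f) = f"
proof -
  have "const (1 / 2) * (f + f) = (const (1 / 2) + const (1 / 2)) * f" by (simp add: algebra_simps)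
  also have "\<dots> = f" by (simp flip: single_add)
  finally show ?thesis .
qed

text \<open>Both orders of the commuting letters project to the same two steps, hence so does their
  mean.\<close>

lemma coef_conv_corner_fun:
  "coef (conv P (corner_fun t)) = steps [(Simple 1, t), (Hat1, t)] (coef P)"
proof -
  have l: "Hat1 \<in> letters" "Simple 1 \<in> letters" by (auto simp: letters_def)
  let ?f = "conv (letter_fun (Simple 1) t) (letter_fun Hat1 t)"
  let ?g = "conv (letter_fun Hat1 t) (letter_fun (Simple 1) t)"
  have f: "coef (conv P ?f) = step Hat1 t (step (Simple 1) t (coef P))"
    and g: "coef (conv P ?g) = step Hat1 t (step (Simple 1) t (coef P))"
    by (simp_all add: coef_conv_letter_fun l step_commute flip: conv_assoc' One_nat_def)
  have "coef (conv P (corner_fun t)) w = const (1 / 2) * (coef (conv P ?f) w + coef (conv P ?g) w)" for w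
    unfolding corner_fun_def[abs_def] conv_scale_right conv_add_right coef_def
    by (simp add: sum_distrib_left[symmetric] sum.distrib)
  then show ?thesis
    unfolding fun_eq_iff by (simp only: f g half_double steps_Cons steps_Nil simp_thms)
qed

lemma coef_conv_gamma_fun:
  assumes "2 \<le> n"
  shows "coef (conv P (gamma_fun n t)) = steps (gamma_factors n t) (coef P)"
proof -
  have "fst ` set (map (\<lambda>i. (Simple i, t)) (rev [2..<n])) \<subseteq> letters"
    "fst ` set (map (\<lambda>i. (Simple i, t)) [2..<n]) \<subseteq> letters"
    by (auto simp: letters_def)
  note h = this[THEN coef_conv_prod_fun]
  have "coef (conv P (gamma_fun n t)) =
      coef (conv (conv (conv P (prod_fun (map (\<lambda>i. (Simple i, t)) (rev [2..<n])))) (corner_fun t))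
        (prod_fun (map (\<lambda>i. (Simple i, t)) [2..<n])))"
    by (simp add: gamma_fun_def conv_assoc')
  also have "\<dots> = steps (gamma_factors n t) (coef P)"
    unfolding h coef_conv_corner_fun by (simp add: gamma_factors_def)
  finally show ?thesis .
qed

section \<open>Monotone words as the words of the arms and rows\<close>

definition increasing :: "letter list \<Rightarrow> bool" where
  "increasing c \<longleftrightarrow> sorted_wrt (\<lambda>x y. letter_val x < letter_val y) c"

definition decreasing :: "letter list \<Rightarrow> bool" where
  "decreasing c \<longleftrightarrow> sorted_wrt (\<lambda>x y. letter_val x > letter_val y) c"

text \<open>The least letter m is either skipped or taken first, and an increasing word over these
  letters can contain it only there.\<close>

lemma prod_fun_up:
  assumes "m \<le> n"
  shows "prod_fun (map (\<lambda>i. (Simple i, t)) [m..<n]) c =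
    (if set c \<subseteq> Simple ` {m..<n} \<and> increasing c then t ^ length c else 0)"
  using assms
proof (induction m arbitrary: c rule: inc_induct)
  case base
  then show ?case by (auto simp: one_fun_def increasing_def)
next
  case (step m)
  have eq: "prod_fun (map (\<lambda>i. (Simple i, t)) [m..<n]) =
      conv (letter_fun (Simple m) t) (prod_fun (map (\<lambda>i. (Simple i, t)) [Suc m..<n]))"
    using step.hyps by (simp add: upt_conv_Cons)
  have S: "Simple ` {m..<n} = insert (Simple m) (Simple ` {Suc m..<n})"
    using step.hyps by (auto simp: image_iff)
  show ?case
  proof (cases c)
    case Nil
    then show ?thesis unfolding eq by (simp add: step.IH increasing_def)
  next
    case (Cons x c')
    show ?thesis
    proof (cases "x = Simple m")
      case True
      have "(set c' \<subseteq> Simple ` {m..<n} \<and> increasing (x # c')) = (set c' \<subseteq> Simple ` {Suc m..<n} \<and> increasing c')"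
        using True unfolding S increasing_def by fastforce
      moreover have "x \<notin> Simple ` {Suc m..<n}" "x \<in> Simple ` {m..<n}" using True step.hyps by auto
      ultimately show ?thesis
        unfolding eq Cons conv_letter_fun_Cons step.IH using True by auto
    next
      case False
      have "(set (x # c') \<subseteq> Simple ` {m..<n} \<and> increasing (x # c')) =
          (set (x # c') \<subseteq> Simple ` {Suc m..<n} \<and> increasing (x # c'))"
        using False unfolding S increasing_def by fastforce
      then show ?thesis
        unfolding eq Cons conv_letter_fun_Cons step.IH using False by simp
    qed
  qed
qed

lemma prod_fun_down:
  shows "prod_fun (map (\<lambda>i. (Simple i, t)) (rev [m..<n])) c =
    (if set c \<subseteq> Simple ` {m..<n} \<and> decreasing c then t ^ length c else 0)"
proof (induction n arbitrary: c)
  case 0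
  then show ?case by (auto simp: one_fun_def decreasing_def)
next
  case (Suc n)
  show ?case
  proof (cases "m \<le> n")
    case m: True
    have eq: "prod_fun (map (\<lambda>i. (Simple i, t)) (rev [m..<Suc n])) =
        conv (letter_fun (Simple n) t) (prod_fun (map (\<lambda>i. (Simple i, t)) (rev [m..<n])))"
      using m by simp
    have S: "Simple ` {m..<Suc n} = insert (Simple n) (Simple ` {m..<n})"
      using m by (auto simp: image_iff)
    show ?thesis
    proof (cases c)
      case Nil
      then show ?thesis unfolding eq by (simp add: Suc decreasing_def)
    next
      case (Cons x c')
      show ?thesis
      proof (cases "x = Simple n")
        case True
        have "(set c' \<subseteq> Simple ` {m..<Suc n} \<and> decreasing (x # c')) = (set c' \<subseteq> Simple ` {m..<n} \<and> decreasing c')"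
          using True unfolding S decreasing_def by fastforce
        moreover have "x \<notin> Simple ` {m..<n}" "x \<in> Simple ` {m..<Suc n}" using True m by auto
        ultimately show ?thesis
          unfolding eq Cons conv_letter_fun_Cons Suc using True by auto
      next
        case False
        have "(set (x # c') \<subseteq> Simple ` {m..<Suc n} \<and> decreasing (x # c')) =
            (set (x # c') \<subseteq> Simple ` {m..<n} \<and> decreasing (x # c'))"
          using False unfolding S decreasing_def by fastforce
        then show ?thesis
          unfolding eq Cons conv_letter_fun_Cons Suc using False by simp
      qed
    qed
  qed (auto simp: one_fun_def decreasing_def)
qed

text \<open>The local consequences of being reduced on which the peak argument rests. The last
  clause rules out alternations of \<open>Simple 1\<close> and \<open>Hat1\<close> of length
  three.\<close>

fun proper :: "letter list \<Rightarrow> bool" where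
  "proper (x # y # c) \<longleftrightarrow> x \<noteq> y \<and> proper (y # c) \<and>
     (c \<noteq> [] \<longrightarrow> \<not> (letter_val x = 1 \<and> letter_val y = 1 \<and> letter_val (hd c) = 1))"
| "proper c \<longleftrightarrow> True"

text \<open>The share of a single variable in the weighted sum: a nonempty segment contributes one
  distinct variable, and each letter of value 1 contributes a factor 1/2.\<close>

definition block_fun :: "mpoly \<Rightarrow> letter list \<Rightarrow> mpoly" where
  "block_fun t c = (if peaks c = {}
     then const (2 powi (of_bool (c \<noteq> []) - int (num_ones c))) * t ^ length c else 0)"

section \<open>Words without peaks\<close>

lemma peaks_short [simp]: "peaks [] = {}" "peaks [x] = {}" "peaks [x, y] = {}"
  by (auto simp: peaks_def)

lemma peaks_Cons_empty: "peaks (x # y # z # c) = {} \<longleftrightarrow>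
  \<not> (letter_val x < letter_val y \<and> letter_val z < letter_val y) \<and> peaks (y # z # c) = {}"
proof -
  have "peaks (x # y # z # c) =
      (if letter_val x < letter_val y \<and> letter_val z < letter_val y then {1} else {}) \<union> Suc ` peaks (y # z # c)"
    (is "?L = ?R")
  proof (intro set_eqI)
    fix i
    consider "i = 0" | "i = 1" | j where "i = Suc (Suc j)" by (metis One_nat_def not0_implies_Suc)
    then show "i \<in> ?L \<longleftrightarrow> i \<in> ?R"
      by cases (auto simp: peaks_def image_iff)
  qed
  then show ?thesis by auto
qed

lemma letter_val_one: "x \<in> letters \<Longrightarrow> letter_val x = 1 \<longleftrightarrow> x = Simple 1 \<or> x = Hat1"
  by (cases x) auto

lemma letter_val_pos: "x \<in> letters \<Longrightarrow> 1 \<le> letter_val x"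
  by (cases x) (auto simp: letters_def)

lemma increasing_Cons: "increasing (x # y # c) \<longleftrightarrow> letter_val x < letter_val y \<and> increasing (y # c)"
  unfolding increasing_def by fastforce

lemma letter_eqI:
  assumes "letter_val x = letter_val y" "2 \<le> letter_val x"
  shows "x = y"
  using assms by (cases x; cases y) auto

text \<open>After an ascent a peak-free word can never go down again. It cannot stay level either:
  equal values of at least 2 mean equal letters, which \<open>proper\<close> excludes for
  neighbours.\<close>

lemma peaks_after_ascent:
  assumes "proper (x # y # c)" "set (x # y # c) \<subseteq> letters" "letter_val x < letter_val y"
  shows "peaks (x # y # c) = {} \<longleftrightarrow> increasing (y # c)"
  using assms
proof (induction c arbitrary: x y)
  case (Cons z c)
  have "letter_val x \<ge> 1" using Cons.prems letter_val_pos by auto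
  then have "letter_val y \<noteq> letter_val z"
    using Cons.prems letter_eqI[of y z] by auto
  then show ?case
    using Cons.IH[of y z] Cons.prems by (auto simp: peaks_Cons_empty increasing_Cons)
qed (simp add: increasing_def)

lemma increasing_num_ones:
  assumes "increasing (y # c)" "2 \<le> letter_val y"
  shows "num_ones (y # c) = 0"
proof -
  have "2 \<le> letter_val z" if "z \<in> set (y # c)" for z
    using assms that by (force simp: increasing_def)
  then have "\<not> (z = Simple 1 \<or> z = Hat1)" if "z \<in> set (y # c)" for z
    using that by force
  then show ?thesis unfolding num_ones_def length_0_conv filter_empty_conv by blast
qed

definition up_fun :: "mpoly \<Rightarrow> letter list \<Rightarrow> mpoly" where
  "up_fun t c = (if increasing c then t ^ length c else 0)"

lemma prod_fun_up_eq:
  assumes n: "2 \<le> n" and c: "set (y # c) \<subseteq> rank_letters n" and y: "2 \<le> letter_val y"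
  shows "prod_fun (map (\<lambda>i. (Simple i, t)) [2..<n]) (y # c) = up_fun t (y # c)"
proof -
  have "set (y # c) \<subseteq> Simple ` {2..<n}" if i: "increasing (y # c)"
  proof
    fix z assume z: "z \<in> set (y # c)"
    then have "2 \<le> letter_val z" using i y by (force simp: increasing_def)
    then show "z \<in> Simple ` {2..<n}" using c z by (cases z) (auto simp: rank_letters_def)
  qed
  then show ?thesis by (auto simp: prod_fun_up[OF n] up_fun_def)
qed

definition tail_fun :: "nat \<Rightarrow> mpoly \<Rightarrow> letter list \<Rightarrow> mpoly" where
  "tail_fun n t = conv (corner_fun t) (prod_fun (map (\<lambda>i. (Simple i, t)) [2..<n]))"

lemma corner_fun_Nil: "corner_fun t [] = 1"
  using half_double[of 1] by (simp add: corner_fun_def)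

lemma corner_fun_single:
  "x \<in> letters \<Longrightarrow> corner_fun t [x] = (if letter_val x = 1 then t else 0)"
  using half_double[of t] by (cases x) (auto simp: corner_fun_def conv_letter_fun_Cons)

lemma corner_fun_pair:
  "x \<in> letters \<Longrightarrow> y \<in> letters \<Longrightarrow>
    corner_fun t [x, y] = (if letter_val x = 1 \<and> letter_val y = 1 \<and> x \<noteq> y then const (1 / 2) * t ^ 2 else 0)"
  by (cases x; cases y) (auto simp: corner_fun_def conv_letter_fun_Cons power2_eq_square)

lemma corner_fun_long: "corner_fun t (x # y # z # c) = 0"
  by (simp add: corner_fun_def conv_letter_fun_Cons)

lemma tail_fun_expand:
  defines "U \<equiv> \<lambda>n t. prod_fun (map (\<lambda>i. (Simple i, t)) [2..<n])"
  shows "tail_fun n t [] = U n t []"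
    "tail_fun n t [x] = U n t [x] + corner_fun t [x] * U n t []"
    "tail_fun n t (x # y # c) = U n t (x # y # c) + corner_fun t [x] * U n t (y # c) + corner_fun t [x, y] * U n t c"
proof -
  show "tail_fun n t [] = U n t []" "tail_fun n t [x] = U n t [x] + corner_fun t [x] * U n t []"
    by (simp_all add: tail_fun_def U_def conv_Cons corner_fun_Nil)
  have "conv (\<lambda>a. corner_fun t (x # y # a)) (U n t) c = corner_fun t [x, y] * U n t c"
    by (cases c) (simp_all add: conv_Cons corner_fun_long)
  then show "tail_fun n t (x # y # c) = U n t (x # y # c) + corner_fun t [x] * U n t (y # c) + corner_fun t [x, y] * U n t c"
    unfolding tail_fun_def U_def by (simp add: conv_Cons corner_fun_Nil add.assoc)
qed

lemma prod_fun_up_Nil: "2 \<le> n \<Longrightarrow> prod_fun (map (\<lambda>i. (Simple i, t)) [2..<n]) [] = 1"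
  by (simp add: prod_fun_up increasing_def)

lemma prod_fun_up_one:
  assumes "2 \<le> n" "letter_val x = 1"
  shows "prod_fun (map (\<lambda>i. (Simple i, t)) [2..<n]) (x # c) = 0"
  using assms by (auto simp: prod_fun_up)

lemma tail_fun_big:
  assumes n: "2 \<le> n" and c: "set (x # c) \<subseteq> rank_letters n" and x: "2 \<le> letter_val x"
  shows "tail_fun n t (x # c) = up_fun t (x # c)"
proof -
  have "x \<in> letters" using c rank_letters_subset by auto
  moreover have "y \<in> letters" if "y \<in> set c" for y using that c rank_letters_subset by auto
  ultimately show ?thesis
    using x prod_fun_up_eq[OF n c x]
    by (cases c) (auto simp: tail_fun_expand corner_fun_single corner_fun_pair)
qed

text \<open>The leading letters of value 1, at most two, fill the corner and the rest must ascend.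
  The corner weights 1 and 1/2 are 2^(1-1) and 2^(1-2).\<close>

lemma tail_fun_one:
  assumes n: "2 \<le> n" and c: "set (x # c) \<subseteq> rank_letters n" and p: "proper (x # c)" and x: "letter_val x = 1"
  shows "tail_fun n t (x # c) = block_fun t (x # c)"
proof -
  have l: "set (x # c) \<subseteq> letters" using c rank_letters_subset by auto
  have x1: "x = Simple 1 \<or> x = Hat1" using x l letter_val_one by auto
  show ?thesis
  proof (cases c)
    case Nil
    then show ?thesis using l x x1
      by (auto simp: tail_fun_expand prod_fun_up_one[OF n] prod_fun_up_Nil[OF n] corner_fun_single block_fun_def num_ones_def)
  next
    case c': (Cons y c')
    show ?thesis
    proof (cases "letter_val y = 1")
      case False
      then have y: "2 \<le> letter_val y" using letter_val_pos[of y] l c' by auto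
      have pk: "peaks (x # y # c') = {} \<longleftrightarrow> increasing (y # c')"
        using p l c' x y by (intro peaks_after_ascent) auto
      have "num_ones (x # y # c') = 1" if "increasing (y # c')"
        using increasing_num_ones[OF that y] x1 by (auto simp: num_ones_def)
      then show ?thesis
        using l x y c' prod_fun_up_one[OF n x] prod_fun_up_eq[OF n _ y, of c'] c pk
        by (auto simp: tail_fun_expand corner_fun_single corner_fun_pair up_fun_def block_fun_def)
    next
      case y: True
      have xy: "x \<noteq> y" using p c' by simp
      have y1: "y = Simple 1 \<or> y = Hat1" using y l c' letter_val_one by auto
      have e: "tail_fun n t (x # y # c') = const (1 / 2) * t ^ 2 * prod_fun (map (\<lambda>i. (Simple i, t)) [2..<n]) c'"
        using x y xy l c' by (simp add: tail_fun_expand prod_fun_up_one[OF n] corner_fun_pair)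
      show ?thesis
      proof (cases c')
        case Nil
        then show ?thesis using c' e x1 y1
          by (auto simp: block_fun_def num_ones_def power_int_minus power2_eq_square prod_fun_up_Nil[OF n])
      next
        case c'': (Cons z c'')
        then have "letter_val z \<noteq> 1" using p c' x y by auto
        then have z: "2 \<le> letter_val z" using letter_val_pos[of z] l c' c'' by auto
        have "peaks (y # z # c'') = {} \<longleftrightarrow> increasing (z # c'')"
          using p l c' c'' y z by (intro peaks_after_ascent) auto
        then have pk: "peaks (x # y # z # c'') = {} \<longleftrightarrow> increasing (z # c'')"
          using x y by (simp add: peaks_Cons_empty)
        have "num_ones (x # y # z # c'') = 2" if "increasing (z # c'')"
          using increasing_num_ones[OF that z] x1 y1 by (auto simp: num_ones_def)
        then show ?thesis
          using e c' c'' prod_fun_up_eq[OF n _ z, of c''] c pk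
          by (auto simp: up_fun_def block_fun_def power_int_minus power2_eq_square)
      qed
    qed
  qed
qed

lemma prod_fun_down_Cons:
  "prod_fun (map (\<lambda>i. (Simple i, t)) (rev [2..<m])) (x # c) =
    (if 2 \<le> letter_val x \<and> letter_val x < m
     then t * prod_fun (map (\<lambda>i. (Simple i, t)) (rev [2..<letter_val x])) c else 0)"
proof (cases x)
  case (Simple i)
  have "decreasing (Simple i # c) \<and> set c \<subseteq> Simple ` {2..<m} \<longleftrightarrow> decreasing c \<and> set c \<subseteq> Simple ` {2..<i}" if "i < m"
    using that unfolding decreasing_def by fastforce
  then show ?thesis using Simple by (auto simp: prod_fun_down)
qed (auto simp: prod_fun_down)

text \<open>Bounding the horizontal arm by m makes the induction on c work: once the arm has taken
  the letter x, only letters below x are left to it. A head of value at least m leaves the arm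
  empty.\<close>

lemma gamma_partial:
  assumes n: "2 \<le> n" and "set c \<subseteq> rank_letters n" "proper c" "2 \<le> m"
  shows "conv (prod_fun (map (\<lambda>i. (Simple i, t)) (rev [2..<m]))) (tail_fun n t) c =
    (if c = [] \<or> letter_val (hd c) < m then block_fun t c else tail_fun n t c)"
  using assms(2-4)
proof (induction c arbitrary: m)
  case Nil
  then show ?case
    by (simp add: tail_fun_expand prod_fun_up_Nil[OF n] prod_fun_down decreasing_def block_fun_def num_ones_def)
next
  case (Cons x c)
  have l: "set (x # c) \<subseteq> letters" using Cons.prems rank_letters_subset by auto
  have pc: "proper c" using Cons.prems by (cases c) auto
  have down_Nil: "prod_fun (map (\<lambda>i. (Simple i, t)) (rev [2..<m])) [] = 1"
    by (simp add: prod_fun_down decreasing_def)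
  let ?i = "letter_val x"
  have rec: "conv (prod_fun (map (\<lambda>i. (Simple i, t)) (rev [2..<m]))) (tail_fun n t) (x # c) =
      tail_fun n t (x # c) + (if 2 \<le> ?i \<and> ?i < m
        then t * conv (prod_fun (map (\<lambda>i. (Simple i, t)) (rev [2..<?i]))) (tail_fun n t) c else 0)"
    by (cases "2 \<le> ?i \<and> ?i < m")
      (auto simp: conv_Cons[of _ _ x] down_Nil prod_fun_down_Cons conv_scale)
  consider "?i = 1" | "m \<le> ?i" | "2 \<le> ?i" "?i < m" using letter_val_pos[of x] l by force
  then show ?case
  proof cases
    case 1
    then show ?thesis using tail_fun_one[OF n Cons.prems(1,2) 1] Cons.prems(3) unfolding rec by simp
  next
    case 2
    then show ?thesis unfolding rec by simp
  next
    case 3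
    have big: "tail_fun n t (x # c) = up_fun t (x # c)"
      using tail_fun_big[OF n _ 3(1)] Cons.prems by auto
    have x1: "x \<noteq> Simple 1" "x \<noteq> Hat1" using 3 by auto
    \<comment> \<open>Either x opens the vertical arm or it lies in the horizontal one. For a
      peak-free word both are possible exactly when x is its least letter, which produces the factor
      2.\<close>
    have "up_fun t (x # c) + t * (if c = [] \<or> letter_val (hd c) < ?i then block_fun t c else tail_fun n t c) = block_fun t (x # c)"
    proof (cases c)
      case Nil
      then show ?thesis using x1
        by (simp add: up_fun_def block_fun_def increasing_def num_ones_def flip: mult_2)
    next
      case c': (Cons y c')
      have "letter_val y \<noteq> ?i" using letter_eqI[of x y] 3 Cons.prems c' by auto
      then consider "letter_val y < ?i" | "?i < letter_val y" by linarith
      then show ?thesis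
      proof cases
        case 1
        have "peaks (x # y # c') = {} \<longleftrightarrow> peaks (y # c') = {}"
          using 1 by (cases c') (auto simp: peaks_Cons_empty)
        then show ?thesis using 1 c' x1
          by (simp add: up_fun_def increasing_Cons block_fun_def num_ones_def)
      next
        case 2
        have "peaks (x # y # c') = {} \<longleftrightarrow> increasing (y # c')"
          using Cons.prems l c' 2 by (intro peaks_after_ascent) auto
        moreover have "num_ones (x # y # c') = 0" if "increasing (y # c')"
          using increasing_num_ones[of x "y # c'"] that 2 3 by (simp add: increasing_Cons)
        moreover have "tail_fun n t (y # c') = up_fun t (y # c')"
          using 2 3 Cons.prems c' by (intro tail_fun_big[OF n]) auto
        ultimately show ?thesis using 2 c'
          by (cases "increasing (y # c')") (simp_all add: up_fun_def increasing_Cons block_fun_def flip: mult_2)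
      qed
    qed
    then show ?thesis
      unfolding rec using 3 big Cons.IH[of ?i] pc Cons.prems by simp
  qed
qed

lemma gamma_fun_eq_block_fun:
  assumes "2 \<le> n" "set c \<subseteq> rank_letters n" "proper c"
  shows "gamma_fun n t c = block_fun t c"
proof -
  have "c = [] \<or> letter_val (hd c) < n"
    using assms(1,2) by (cases c) (auto simp: rank_letters_def)
  then show ?thesis
    using gamma_partial[OF assms assms(1), of t] by (auto simp: gamma_fun_def tail_fun_def)
qed

section \<open>Admissible sequences\<close>

text \<open>Equal neighbours cancel. Three letters of value 1 without equal neighbours have the form
  x y x with commuting involutions, whose product is that of y alone.\<close>

lemma reduced_imp_proper: "c \<in> reduced_words (word_perm c) \<Longrightarrow> proper c"
proof (induction c rule: proper.induct)
  case (1 x y c)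
  have "proper (y # c)"
    using 1(1) reduced_words_append(2)[of "[x]" "y # c"] 1(2) by simp
  moreover have l: "x \<in> letters" "y \<in> letters" using 1(2) by (auto simp: reduced_words_def)
  moreover have xy: "x \<noteq> y"
  proof
    assume "x = y"
    have "[x, y] \<in> reduced_words (word_perm [x, y])"
      using reduced_words_append(1)[of "[x, y]" c] 1(2) by simp
    moreover have "word_perm [x, y] = id"
      using \<open>x = y\<close> l by (auto simp: word_perm_Cons fun_eq_iff gen_involution)
    ultimately show False by (simp add: reduced_words_id)
  qed
  moreover have "\<not> (letter_val x = 1 \<and> letter_val y = 1 \<and> letter_val z = 1)" if c: "c = z # c'" for z c'
  proof
    assume v: "letter_val x = 1 \<and> letter_val y = 1 \<and> letter_val z = 1"
    have zl: "z \<in> letters" using 1(2) c by (auto simp: reduced_words_def)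
    have "y \<noteq> z" using \<open>proper (y # c)\<close> c by simp
    then have z: "z = x" and comm: "gen x \<circ> gen y = gen y \<circ> gen x"
      using v xy l zl letter_val_one gen_Hat1_Simple1 by metis+
    have "gen x \<circ> (gen y \<circ> gen x) = gen y"
      unfolding comm[symmetric] using l by (auto simp: fun_eq_iff gen_involution)
    then have "word_perm [x, y, z] = word_perm [y]" by (simp add: z word_perm_Cons)
    moreover have "[x, y, z] \<in> reduced_words (word_perm [x, y, z])"
      using reduced_words_append(1)[of "[x, y, z]" c'] 1(2) c by simp
    ultimately show False using cox_length_le[of "[y]"] l by (simp add: reduced_words_def)
  qed
  ultimately show ?case by (cases c) auto
qed auto

section \<open>Splitting sequences for x into segments\<close>

definition x_sequences :: "nat \<Rightarrow> letter list \<Rightarrow> nat list set" where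
  "x_sequences k a = {js. x_admissible a js \<and> set js \<subseteq> {1..k}}"

definition x_fun :: "nat \<Rightarrow> letter list \<Rightarrow> mpoly" where
  "x_fun k a = (\<Sum>js\<in>x_sequences k a.
     const (2 powi (int (card (set js)) - int (num_ones a))) * (\<Prod>j\<leftarrow>js. pvar (Xvar j)))"

lemma finite_x_sequences: "finite (x_sequences k a)"
proof (rule finite_subset)
  show "x_sequences k a \<subseteq> {js. set js \<subseteq> {1..k} \<and> length js = length a}"
    by (auto simp: x_sequences_def x_admissible_def)
qed (simp add: finite_lists_length_eq)

lemma peaks_take: "peaks (take i a) = {p \<in> peaks a. p + 1 < i}"
  by (auto simp: peaks_def)

lemma peaks_drop: "p \<in> peaks (drop i a) \<longleftrightarrow> 1 \<le> p \<and> p + i \<in> peaks a"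
proof -
  have "i + (p - Suc 0) = p + i - Suc 0" "i + Suc p = Suc (p + i)" if "1 \<le> p" using that by auto
  then show ?thesis by (auto simp: peaks_def add.commute)
qed

text \<open>Three consecutive equal entries lie entirely in the initial segment or entirely in the
  rest, so the peak conditions on the two parts are independent.\<close>

lemma x_admissible_append:
  assumes js: "set js \<subseteq> {1..k}"
  shows "x_admissible a (replicate i (Suc k) @ js) \<longleftrightarrow>
    i \<le> length a \<and> peaks (take i a) = {} \<and> x_admissible (drop i a) js"
proof
  assume adm: "x_admissible a (replicate i (Suc k) @ js)"
  let ?js = "replicate i (Suc k) @ js"
  have len: "i + length js = length a" using adm by (simp add: x_admissible_def)
  have pk: "p \<notin> peaks a" if "1 \<le> p" "p + 1 < length a" "?js ! (p - 1) = ?js ! p" "?js ! p = ?js ! (p + 1)" for p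
    using adm that len by (auto simp: x_admissible_def)
  have "peaks (take i a) = {}"
  proof -
    have "p \<notin> peaks a" if "1 \<le> p" "p + 1 < i" for p
      using that len by (intro pk) (auto simp: nth_append)
    then show ?thesis by (auto simp: peaks_take peaks_def)
  qed
  moreover have "p \<notin> peaks (drop i a)" if "1 \<le> p" "p + 1 < length js" "js ! (p - 1) = js ! p" "js ! p = js ! (p + 1)" for p
  proof -
    have "p + i - 1 - i = p - 1" "p + i + 1 - i = p + 1" using that by auto
    then have "p + i \<notin> peaks a" using that len by (intro pk) (auto simp: nth_append)
    then show ?thesis by (simp add: peaks_drop)
  qed
  ultimately show "i \<le> length a \<and> peaks (take i a) = {} \<and> x_admissible (drop i a) js"
    using adm len by (auto simp: x_admissible_def sorted_wrt_append)
next
  assume r: "i \<le> length a \<and> peaks (take i a) = {} \<and> x_admissible (drop i a) js"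
  let ?js = "replicate i (Suc k) @ js"
  have len: "i + length js = length a" using r by (simp add: x_admissible_def)
  have "p \<notin> peaks a" if p: "1 \<le> p" "p + 1 < length ?js" "?js ! (p - 1) = ?js ! p" "?js ! p = ?js ! (p + 1)" for p
  proof -
    consider "p + 1 < i" | "i \<le> p - 1" | "p - 1 < i" "i \<le> p + 1" by linarith
    then show ?thesis
    proof cases
      case 1
      then show ?thesis using r by (auto simp: peaks_take)
    next
      case 2
      then obtain q where "p - 1 = i + q" using le_Suc_ex by blast
      then have q: "p = i + Suc q" using p(1) by simp
      have "Suc q \<notin> peaks (drop i a)"
        using r p q by (simp add: x_admissible_def nth_append)
      then show ?thesis using q by (simp add: peaks_drop add.commute)
    next
      case 3
      \<comment> \<open>A window across the cut begins with \<open>Suc k\<close> and ends with a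
        smaller entry, so its entries cannot all be equal.\<close>
      then have "?js ! (p - 1) = Suc k" "?js ! (p + 1) = js ! (p + 1 - i)" by (simp_all add: nth_append)
      moreover have "p + 1 < i + length js" using p(2) by simp
      then have "p + 1 - i < length js" using 3(2) by linarith
      then have "js ! (p + 1 - i) \<in> set js" by (rule nth_mem)
      ultimately show ?thesis using p(3,4) js by (metis Suc_n_not_le_n atLeastAtMost_iff subsetD)
    qed
  qed
  moreover have "sorted_wrt (\<ge>) (replicate i (Suc k))" by (simp add: sorted_wrt_iff_nth_less)
  moreover have "\<forall>y\<in>set js. y \<le> Suc k" using js by force
  ultimately show "x_admissible a ?js"
    using r by (auto simp: x_admissible_def sorted_wrt_append)
qed

lemma x_sequences_Suc: "x_sequences (Suc k) a =
  (\<lambda>(i, js). replicate i (Suc k) @ js) ` (SIGMA i : {i. i \<le> length a \<and> peaks (take i a) = {}}. x_sequences k (drop i a))"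
proof (intro set_eqI iffI)
  fix js assume js: "js \<in> x_sequences (Suc k) a"
  let ?t = "takeWhile (\<lambda>j. j = Suc k) js" and ?d = "dropWhile (\<lambda>j. j = Suc k) js"
  have t: "?t = replicate (length ?t) (Suc k)"
    by (rule replicate_eqI) (auto dest: set_takeWhileD)
  have split: "js = replicate (length ?t) (Suc k) @ ?d" by (metis t takeWhile_dropWhile_id)
  have "set ?d \<subseteq> {1..k}"
  proof (cases ?d)
    case (Cons x d)
    have x: "x \<noteq> Suc k" using Cons hd_dropWhile[of "\<lambda>j. j = Suc k" js] by auto
    have "sorted_wrt (\<ge>) ?d" using js split by (metis (no_types, lifting) mem_Collect_eq sorted_wrt_append x_admissible_def x_sequences_def)
    moreover have "set ?d \<subseteq> {1..Suc k}" using js set_dropWhileD[of _ "\<lambda>j. j = Suc k" js] by (auto simp: x_sequences_def)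
    ultimately have "y \<le> x \<and> 1 \<le> y \<and> x \<le> Suc k" if "y \<in> set ?d" for y using that Cons by auto
    then show ?thesis using x by fastforce
  next
    case Nil
    show ?thesis unfolding Nil by simp
  qed
  moreover from this have "x_admissible a (replicate (length ?t) (Suc k) @ ?d)"
    using js split by (simp add: x_sequences_def)
  ultimately have "(length ?t, ?d) \<in> (SIGMA i : {i. i \<le> length a \<and> peaks (take i a) = {}}. x_sequences k (drop i a))"
    using x_admissible_append[of ?d k a "length ?t"] by (simp add: x_sequences_def)
  then show "js \<in> (\<lambda>(i, js). replicate i (Suc k) @ js) ` (SIGMA i : {i. i \<le> length a \<and> peaks (take i a) = {}}. x_sequences k (drop i a))"
    using split by (intro image_eqI[of _ _ "(length ?t, ?d)"]) auto
next
  fix js assume "js \<in> (\<lambda>(i, js). replicate i (Suc k) @ js) ` (SIGMA i : {i. i \<le> length a \<and> peaks (take i a) = {}}. x_sequences k (drop i a))"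
  then obtain i js' where "js = replicate i (Suc k) @ js'" "i \<le> length a" "peaks (take i a) = {}" "js' \<in> x_sequences k (drop i a)"
    by auto
  then show "js \<in> x_sequences (Suc k) a"
    using x_admissible_append[of js' k a i] by (force simp: x_sequences_def)
qed

lemma replicate_append_inject:
  assumes "replicate i x @ xs = replicate i' x @ xs'" "x \<notin> set xs" "x \<notin> set xs'"
  shows "i = i' \<and> xs = xs'"
proof -
  have tw: "takeWhile (\<lambda>y. y = x) (replicate i x @ xs) = replicate i x" if "x \<notin> set xs" for i xs
    using that by (subst takeWhile_append2) (auto simp: takeWhile_eq_Nil_iff dest: hd_in_set)
  have "replicate i x = replicate i' x" using tw[OF assms(2), of i] tw[OF assms(3), of i'] assms(1) by simp
  then show ?thesis using assms(1) by (metis length_replicate same_append_eq)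
qed

lemma num_ones_append: "num_ones (a @ b) = num_ones a + num_ones b"
  by (simp add: num_ones_def)

text \<open>The weight is multiplicative: the segment of \<open>Suc k\<close> adds one distinct
  variable exactly if it is nonempty, and letters of value 1 are counted in both parts.\<close>

lemma x_fun_Suc: "x_fun (Suc k) a = conv (block_fun (pvar (Xvar (Suc k)))) (x_fun k) a"
proof -
  let ?I = "{i. i \<le> length a \<and> peaks (take i a) = {}}"
  let ?w = "\<lambda>a js. const (2 powi (int (card (set js)) - int (num_ones a))) * (\<Prod>j\<leftarrow>js. pvar (Xvar j))"
  have inj: "inj_on (\<lambda>(i, js). replicate i (Suc k) @ js) (SIGMA i : ?I. x_sequences k (drop i a))"
  proof (rule inj_onI)
    fix p q assume "p \<in> (SIGMA i : ?I. x_sequences k (drop i a))" "q \<in> (SIGMA i : ?I. x_sequences k (drop i a))"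
      and e: "(\<lambda>(i, js). replicate i (Suc k) @ js) p = (\<lambda>(i, js). replicate i (Suc k) @ js) q"
    then have "Suc k \<notin> set (snd p)" "Suc k \<notin> set (snd q)" by (auto simp: x_sequences_def)
    then show "p = q" using replicate_append_inject[of "fst p" "Suc k" "snd p" "fst q" "snd q"] e
      by (auto simp: case_prod_beta prod_eq_iff)
  qed
  have weight: "?w a (replicate i (Suc k) @ js) = block_fun (pvar (Xvar (Suc k))) (take i a) * ?w (drop i a) js"
    if i: "i \<in> ?I" and js: "js \<in> x_sequences k (drop i a)" for i js
  proof -
    have "Suc k \<notin> set js" using js by (auto simp: x_sequences_def)
    moreover have "set (replicate i (Suc k) @ js) = (if i = 0 then set js else insert (Suc k) (set js))" by simp
    ultimately have "card (set (replicate i (Suc k) @ js)) = of_bool (take i a \<noteq> []) + card (set js)"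
      using i by auto
    moreover have "num_ones a = num_ones (take i a) + num_ones (drop i a)"
      by (metis num_ones_append append_take_drop_id)
    ultimately have "2 powi (int (card (set (replicate i (Suc k) @ js))) - int (num_ones a)) =
        2 powi (of_bool (take i a \<noteq> []) - int (num_ones (take i a))) * (2 powi (int (card (set js)) - int (num_ones (drop i a))) :: rat)"
      by (simp add: power_int_add[symmetric] algebra_simps)
    moreover have "length (take i a) = i" using i by simp
    ultimately show ?thesis using i
      by (simp add: block_fun_def const_mult prod_list_replicate mult_ac del: length_take take_eq_Nil)
  qed
  have "x_fun (Suc k) a = (\<Sum>(i, js) \<in> (SIGMA i : ?I. x_sequences k (drop i a)). ?w a (replicate i (Suc k) @ js))"
    unfolding x_fun_def x_sequences_Suc sum.reindex[OF inj] by (simp add: case_prod_beta comp_def)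
  also have "\<dots> = (\<Sum>(i, js) \<in> (SIGMA i : ?I. x_sequences k (drop i a)).
      block_fun (pvar (Xvar (Suc k))) (take i a) * ?w (drop i a) js)"
    using weight by (intro sum.cong) auto
  also have "\<dots> = (\<Sum>i\<in>?I. block_fun (pvar (Xvar (Suc k))) (take i a) * x_fun k (drop i a))"
    by (subst sum.Sigma[symmetric]) (auto simp: finite_x_sequences x_fun_def sum_distrib_left)
  also have "\<dots> = conv (block_fun (pvar (Xvar (Suc k)))) (x_fun k) a"
    unfolding conv_def by (intro sum.mono_neutral_left) (auto simp: block_fun_def)
  finally show ?thesis .
qed

lemma x_fun_0: "x_fun 0 a = one_fun a"
proof -
  have "x_sequences 0 a = (if a = [] then {[]} else {})"
    by (auto simp: x_sequences_def x_admissible_def)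
  then show ?thesis by (simp add: x_fun_def one_fun_def num_ones_def)
qed

definition gamma_prod :: "nat \<Rightarrow> nat list \<Rightarrow> letter list \<Rightarrow> mpoly" where
  "gamma_prod n ms = foldr conv (map (\<lambda>m. gamma_fun n (pvar (Xvar m))) ms) one_fun"

text \<open>\<open>block_fun\<close> and \<open>gamma_fun\<close> are known to agree on proper words
  only, so they are exchanged segment by segment; the segments of a reduced word are reduced and
  hence proper.\<close>

lemma x_fun_gamma_prod:
  assumes n: "2 \<le> n"
  shows "set a \<subseteq> rank_letters n \<Longrightarrow> a \<in> reduced_words (word_perm a) \<Longrightarrow>
    x_fun k a = gamma_prod n (rev [1..<k + 1]) a"
proof (induction k arbitrary: a)
  case 0
  then show ?case by (simp add: x_fun_0 gamma_prod_def)
next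
  case (Suc k)
  have "block_fun (pvar (Xvar (Suc k))) (take i a) * x_fun k (drop i a) =
      gamma_fun n (pvar (Xvar (Suc k))) (take i a) * gamma_prod n (rev [1..<k + 1]) (drop i a)" for i
  proof -
    have "take i a @ drop i a \<in> reduced_words (word_perm a)" using Suc.prems by simp
    note r = reduced_words_append(1,2)[OF this]
    have "set (take i a) \<subseteq> rank_letters n" "set (drop i a) \<subseteq> rank_letters n"
      using Suc.prems(1) set_take_subset[of i a] set_drop_subset[of i a] by auto
    then show ?thesis using gamma_fun_eq_block_fun[OF n _ reduced_imp_proper] Suc.IH r by simp
  qed
  then show ?case unfolding x_fun_Suc by (simp add: conv_def gamma_prod_def)
qed

lemma coef_conv_gamma_prod:
  assumes "2 \<le> n"
  shows "coef (conv P (gamma_prod n ms)) = steps (x_factors n ms) (coef P)"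
proof (induction ms arbitrary: P)
  case (Cons m ms)
  have "coef (conv P (gamma_prod n (m # ms))) = coef (conv (conv P (gamma_fun n (pvar (Xvar m)))) (gamma_prod n ms))"
    by (simp add: gamma_prod_def conv_assoc')
  then show ?case by (simp add: Cons coef_conv_gamma_fun[OF assms] x_factors_def)
qed (simp add: gamma_prod_def x_factors_def)

section \<open>Splitting sequences for z into segments\<close>

definition z_sequences :: "nat \<Rightarrow> letter list \<Rightarrow> nat list set" where
  "z_sequences m b = {js. z_admissible b js \<and> set js \<subseteq> {m..}}"

text \<open>The value 0 at words with \<open>Hat1\<close> builds in the condition that v lies in the
  symmetric group and agrees with the staircase rows, which lack this letter.\<close>

definition z_fun :: "nat \<Rightarrow> letter list \<Rightarrow> mpoly" where
  "z_fun m b = (if Hat1 \<in> set b then 0 else \<Sum>js\<in>z_sequences m b. \<Prod>j\<leftarrow>js. pvar (Zvar j))"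

text \<open>Each entry is at most the value of its letter; the sum of all values is a bound common
  to all positions.\<close>

lemma finite_z_sequences: "finite (z_sequences m b)"
proof (rule finite_subset)
  show "z_sequences m b \<subseteq> {js. set js \<subseteq> {0..sum_list (map letter_val b)} \<and> length js = length b}"
  proof
    fix js assume "js \<in> z_sequences m b"
    then have l: "length js = length b" and le: "\<forall>i < length js. js ! i \<le> letter_val (b ! i)"
      by (auto simp: z_sequences_def z_admissible_def)
    have "js ! i \<le> sum_list (map letter_val b)" if "i < length js" for i
    proof -
      have "letter_val (b ! i) \<le> sum_list (map letter_val b)"
        using that l by (intro member_le_sum_list) auto
      then show ?thesis using le that by force
    qed
    then have "set js \<subseteq> {0..sum_list (map letter_val b)}" by (force simp: in_set_conv_nth)
    then show "js \<in> {js. set js \<subseteq> {0..sum_list (map letter_val b)} \<and> length js = length b}" using l by simp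
  qed
qed (simp add: finite_lists_length_eq)

lemma decreasing_iff_nth: "decreasing c \<longleftrightarrow> (\<forall>i. i + 1 < length c \<longrightarrow> letter_val (c ! i) > letter_val (c ! (i + 1)))"
  unfolding decreasing_def by (subst sorted_wrt_iff_nth_Suc_transp) (auto simp: transp_def)

text \<open>Equal neighbours occur only inside the segment of m or inside the rest, since the
  entries at the cut differ. Inside the segment they force strict descents.\<close>

lemma z_admissible_append:
  assumes js: "set js \<subseteq> {Suc m..}" and m: "1 \<le> m"
  shows "z_admissible b (replicate i m @ js) \<longleftrightarrow>
    i \<le> length b \<and> decreasing (take i b) \<and> (\<forall>x\<in>set (take i b). m \<le> letter_val x) \<and> z_admissible (drop i b) js"
proof
  let ?js = "replicate i m @ js"
  assume adm: "z_admissible b ?js"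
  have len: "i + length js = length b" using adm by (simp add: z_admissible_def)
  have le: "?js ! p \<le> letter_val (b ! p)" if "p < length b" for p
    using adm that len by (simp add: z_admissible_def)
  have dec: "letter_val (b ! (p + 1)) < letter_val (b ! p)" if "p + 1 < length b" "?js ! p = ?js ! (p + 1)" for p
    using adm that len by (simp add: z_admissible_def)
  have "decreasing (take i b)"
    unfolding decreasing_iff_nth using dec len by (auto simp: nth_append)
  moreover have "m \<le> letter_val x" if "x \<in> set (take i b)" for x
  proof -
    obtain p where "p < i" "p < length b" "x = b ! p" using \<open>x \<in> set (take i b)\<close> by (auto simp: in_set_conv_nth)
    then show ?thesis using le[of p] by (simp add: nth_append)
  qed
  moreover have "js ! p \<le> letter_val (drop i b ! p)" if "p < length js" for p
    using le[of "i + p"] that len by (simp add: nth_append)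
  moreover have "letter_val (drop i b ! (p + 1)) < letter_val (drop i b ! p)"
    if "p + 1 < length js" "js ! p = js ! (p + 1)" for p
    using dec[of "i + p"] that len by (simp add: nth_append)
  ultimately show "i \<le> length b \<and> decreasing (take i b) \<and> (\<forall>x\<in>set (take i b). m \<le> letter_val x) \<and> z_admissible (drop i b) js"
    using adm len by (auto simp: z_admissible_def sorted_wrt_append)
next
  let ?js = "replicate i m @ js"
  assume r: "i \<le> length b \<and> decreasing (take i b) \<and> (\<forall>x\<in>set (take i b). m \<le> letter_val x) \<and> z_admissible (drop i b) js"
  have len: "i + length js = length b" using r by (simp add: z_admissible_def)
  have "?js ! p \<le> letter_val (b ! p)" if "p < length ?js" for p
  proof (cases "p < i")
    case True
    then have "b ! p \<in> set (take i b)" using r by (auto simp: in_set_conv_nth)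
    then show ?thesis using r True by (auto simp: nth_append)
  next
    case False
    then obtain q where q: "p = i + q" using le_Suc_ex by (metis not_less)
    have "js ! q \<le> letter_val (drop i b ! q)"
      using r that q by (simp add: z_admissible_def)
    then show ?thesis using q r by (simp add: nth_append)
  qed
  moreover have "letter_val (b ! (p + 1)) < letter_val (b ! p)" if p: "p + 1 < length ?js" "?js ! p = ?js ! (p + 1)" for p
  proof -
    consider "p + 1 < i" | "i \<le> p" | "p < i" "i \<le> p + 1" by linarith
    then show ?thesis
    proof cases
      case 1
      have "decreasing (take i b)" using r by simp
      then show ?thesis using 1 r unfolding decreasing_iff_nth by auto
    next
      case 2
      then obtain q where q: "p = i + q" using le_Suc_ex by blast
      have "letter_val (drop i b ! (q + 1)) < letter_val (drop i b ! q)"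
        using r p q by (simp add: z_admissible_def nth_append)
      then show ?thesis using q r by simp
    next
      case 3
      then have "?js ! p = m" "?js ! (p + 1) = js ! (p + 1 - i)" by (simp_all add: nth_append)
      moreover have "p + 1 < i + length js" using p(1) by simp
      then have "p + 1 - i < length js" using 3(2) by linarith
      then have "js ! (p + 1 - i) \<in> set js" by (rule nth_mem)
      ultimately show ?thesis using p(2) js by (metis Suc_n_not_le_n atLeast_iff subsetD)
    qed
  qed
  ultimately show "z_admissible b ?js"
    using r js m by (fastforce simp: z_admissible_def sorted_wrt_append sorted_wrt_iff_nth_less[of _ "replicate i m"])
qed

lemma z_sequences_Suc:
  assumes m: "1 \<le> m"
  shows "z_sequences m b = (\<lambda>(i, js). replicate i m @ js) `
    (SIGMA i : {i. i \<le> length b \<and> decreasing (take i b) \<and> (\<forall>x\<in>set (take i b). m \<le> letter_val x)}. z_sequences (Suc m) (drop i b))"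
    (is "_ = ?f ` ?S")
proof (intro set_eqI iffI)
  fix js assume js: "js \<in> z_sequences m b"
  let ?t = "takeWhile (\<lambda>j. j = m) js" and ?d = "dropWhile (\<lambda>j. j = m) js"
  have t: "?t = replicate (length ?t) m"
    by (rule replicate_eqI) (auto dest: set_takeWhileD)
  have split: "js = replicate (length ?t) m @ ?d" by (metis t takeWhile_dropWhile_id)
  have "set ?d \<subseteq> {Suc m..}"
  proof (cases ?d)
    case (Cons x d)
    have x: "x \<noteq> m" using Cons hd_dropWhile[of "\<lambda>j. j = m" js] by auto
    have "sorted_wrt (\<le>) ?d" using js split by (metis (no_types, lifting) mem_Collect_eq sorted_wrt_append z_admissible_def z_sequences_def)
    moreover have "set ?d \<subseteq> {m..}" using js set_dropWhileD[of _ "\<lambda>j. j = m" js] by (auto simp: z_sequences_def)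
    ultimately have "x \<le> y \<and> m \<le> x" if "y \<in> set ?d" for y using that Cons by auto
    then show ?thesis using x by fastforce
  next
    case Nil
    show ?thesis unfolding Nil by simp
  qed
  moreover from this have "z_admissible b (replicate (length ?t) m @ ?d)"
    using js split by (simp add: z_sequences_def)
  ultimately have "(length ?t, ?d) \<in> ?S"
    using z_admissible_append[of ?d m b "length ?t"] m by (simp add: z_sequences_def)
  then show "js \<in> ?f ` ?S"
    using split by (intro image_eqI[of _ _ "(length ?t, ?d)"]) auto
next
  fix js assume "js \<in> ?f ` ?S"
  then obtain i js' where "js = replicate i m @ js'" "i \<le> length b" "decreasing (take i b)"
      "\<forall>x\<in>set (take i b). m \<le> letter_val x" "js' \<in> z_sequences (Suc m) (drop i b)"
    by auto
  then show "js \<in> z_sequences m b"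
    using z_admissible_append[of js' m b i] m by (force simp: z_sequences_def)
qed

text \<open>The first segment is a decreasing word in the letters m, ..., n - 1, that is, a word of
  staircase row m.\<close>

lemma z_fun_Suc:
  assumes m: "1 \<le> m" and b: "set b \<subseteq> rank_letters n"
  shows "z_fun m b = conv (prod_fun (map (\<lambda>j. (Simple j, pvar (Zvar m))) (rev [m..<n]))) (z_fun (Suc m)) b"
proof -
  let ?row = "prod_fun (map (\<lambda>j. (Simple j, pvar (Zvar m))) (rev [m..<n]))"
  have row_hat: "?row c = 0" if "Hat1 \<in> set c" for c
    using that by (auto simp: prod_fun_down)
  show ?thesis
  proof (cases "Hat1 \<in> set b")
    case True
    have "?row (take i b) * z_fun (Suc m) (drop i b) = 0" for i
      using row_hat[of "take i b"] True append_take_drop_id[of i b] set_append[of "take i b" "drop i b"]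
      by (auto simp: z_fun_def)
    then have "conv ?row (z_fun (Suc m)) b = 0" unfolding conv_def by (intro sum.neutral ballI)
    then show ?thesis using True by (simp add: z_fun_def[of m])
  next
    case False
    let ?I = "{i. i \<le> length b \<and> decreasing (take i b) \<and> (\<forall>x\<in>set (take i b). m \<le> letter_val x)}"
    let ?w = "\<lambda>js. \<Prod>j\<leftarrow>js. pvar (Zvar j)"
    have row: "?row (take i b) = (if i \<in> ?I then pvar (Zvar m) ^ i else 0)" if "i \<le> length b" for i
    proof -
      have "x \<in> Simple ` {m..<n} \<longleftrightarrow> m \<le> letter_val x" if "x \<in> set b" for x
        using that b False by (cases x) (auto simp: rank_letters_def)
      then have "set (take i b) \<subseteq> Simple ` {m..<n} \<longleftrightarrow> (\<forall>x\<in>set (take i b). m \<le> letter_val x)"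
        using set_take_subset[of i b] by (auto simp: subset_iff)
      then show ?thesis using that by (simp add: prod_fun_down min_def)
    qed
    have inj: "inj_on (\<lambda>(i, js). replicate i m @ js) (SIGMA i : ?I. z_sequences (Suc m) (drop i b))"
    proof (rule inj_onI)
      fix p q assume "p \<in> (SIGMA i : ?I. z_sequences (Suc m) (drop i b))" "q \<in> (SIGMA i : ?I. z_sequences (Suc m) (drop i b))"
        and e: "(\<lambda>(i, js). replicate i m @ js) p = (\<lambda>(i, js). replicate i m @ js) q"
      then have "m \<notin> set (snd p)" "m \<notin> set (snd q)" by (auto simp: z_sequences_def)
      then show "p = q" using replicate_append_inject[of "fst p" m "snd p" "fst q" "snd q"] e
        by (auto simp: case_prod_beta prod_eq_iff)
    qed
    have nd: "Hat1 \<notin> set (drop i b)" for i using False set_drop_subset[of i b] by auto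
    have "z_fun m b = (\<Sum>(i, js) \<in> (SIGMA i : ?I. z_sequences (Suc m) (drop i b)). ?w (replicate i m @ js))"
      using False unfolding z_fun_def z_sequences_Suc[OF m] sum.reindex[OF inj] by (simp add: case_prod_beta comp_def)
    also have "\<dots> = (\<Sum>i\<in>?I. pvar (Zvar m) ^ i * z_fun (Suc m) (drop i b))"
      by (subst sum.Sigma[symmetric]) (auto simp: finite_z_sequences z_fun_def nd sum_distrib_left prod_list_replicate)
    also have "\<dots> = conv ?row (z_fun (Suc m)) b"
      unfolding conv_def by (intro sum.mono_neutral_cong_left) (auto simp: row)
    finally show ?thesis .
  qed
qed

lemma z_fun_prod_fun:
  assumes "1 \<le> m" "m \<le> n" "set b \<subseteq> rank_letters n"
  shows "z_fun m b = prod_fun (z_factors n [m..<n]) b"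
  using assms(2,1,3)
proof (induction m arbitrary: b rule: inc_induct)
  case base
  \<comment> \<open>An entry of at least n would exceed its letter, whose value is below n.\<close>
  have "z_sequences n b = (if b = [] then {[]} else {})" if "Hat1 \<notin> set b"
  proof -
    have "js = []" if js: "js \<in> z_sequences n b" for js
    proof (rule ccontr)
      assume "js \<noteq> []"
      moreover have "n \<le> j" if "j \<in> set js" for j using that js by (auto simp: z_sequences_def)
      ultimately have "n \<le> js ! 0" by simp
      then have l: "0 < length js" "length js = length b" "js ! 0 \<le> letter_val (b ! 0)" "n \<le> js ! 0"
        using js \<open>js \<noteq> []\<close> by (auto simp: z_sequences_def z_admissible_def)
      then have "b ! 0 \<in> set b" by auto
      then have "letter_val (b ! 0) < n" using base \<open>Hat1 \<notin> set b\<close> by (auto simp: rank_letters_def)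
      then show False using l by simp
    qed
    moreover have "[] \<in> z_sequences n b \<longleftrightarrow> b = []" by (auto simp: z_sequences_def z_admissible_def)
    ultimately show ?thesis by auto
  qed
  then show ?case by (auto simp: z_factors_def z_fun_def one_fun_def)
next
  case (step m)
  have "prod_fun (z_factors n [m..<n]) =
      conv (prod_fun (map (\<lambda>j. (Simple j, pvar (Zvar m))) (rev [m..<n]))) (prod_fun (z_factors n [Suc m..<n]))"
    using step.hyps by (simp add: z_factors_def upt_conv_Cons[of m n] flip: prod_fun_append)
  moreover have "z_fun (Suc m) (drop i b) = prod_fun (z_factors n [Suc m..<n]) (drop i b)" for i
    using step.IH step.prems set_drop_subset[of i b] by auto
  ultimately show ?case
    using z_fun_Suc[OF step.prems] by (simp add: conv_def)
qed

section \<open>Admissible monomials\<close>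

definition sequence_monomial :: "(nat \<Rightarrow> mvar) \<Rightarrow> nat list \<Rightarrow> monomial" where
  "sequence_monomial V js = (\<Sum>j\<leftarrow>js. Poly_Mapping.single (V j) 1)"

lemma lookup_sequence_monomial:
  assumes "inj V"
  shows "Poly_Mapping.lookup (sequence_monomial V js) (V j) = count_list js j"
  using assms by (induction js) (auto simp: sequence_monomial_def lookup_add lookup_single when_def inj_def)

lemma keys_sequence_monomial: "Poly_Mapping.keys (sequence_monomial V js) = V ` set js"
proof (induction js)
  case (Cons j js)
  have "Poly_Mapping.keys (a + b) = Poly_Mapping.keys a \<union> Poly_Mapping.keys b" for a b :: monomial
    by (auto simp: in_keys_iff lookup_add)
  then show ?case using Cons by (simp add: sequence_monomial_def)
qed (simp add: sequence_monomial_def)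

lemma single_sequence_monomial:
  "(Poly_Mapping.single (sequence_monomial V js) 1 :: mpoly) = (\<Prod>j\<leftarrow>js. pvar (V j))"
proof (induction js)
  case (Cons j js)
  have "(Poly_Mapping.single (sequence_monomial V (j # js)) 1 :: mpoly) =
      pvar (V j) * Poly_Mapping.single (sequence_monomial V js) 1"
    by (simp add: sequence_monomial_def pvar_def mult_single)
  then show ?case using Cons by simp
qed (simp add: sequence_monomial_def)

lemma sequence_monomial_mset:
  assumes "inj V" "sequence_monomial V js = sequence_monomial V js'"
  shows "mset js = mset js'"
proof (rule multiset_eqI)
  fix j
  have "count_list js j = count_list js' j"
    using lookup_sequence_monomial[OF assms(1)] assms(2) by metis
  then show "count (mset js) j = count (mset js') j" by (simp add: count_mset)
qed

lemma sorted_mset_inject: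
  assumes "sorted xs" "sorted ys" "mset xs = mset ys"
  shows "xs = ys"
  using assms by (metis properties_for_sort)

text \<open>The monomial determines the multiset of indices, and the sequence is the only monotone
  arrangement of it. Sums over monomials thus become sums over sequences.\<close>

lemma inj_on_x_sequences: "inj_on (sequence_monomial Xvar) (x_sequences k a)"
proof (rule inj_onI)
  fix js js' assume js: "js \<in> x_sequences k a" "js' \<in> x_sequences k a"
    and "sequence_monomial Xvar js = sequence_monomial Xvar js'"
  then have "mset (rev js) = mset (rev js')" using sequence_monomial_mset[of Xvar js js'] by (simp add: inj_def)
  moreover have "sorted (rev js)" "sorted (rev js')"
    using js by (auto simp: x_sequences_def x_admissible_def sorted_wrt_rev)
  ultimately show "js = js'" using sorted_mset_inject by fastforce
qed

lemma inj_on_z_sequences: "inj_on (sequence_monomial Zvar) (z_sequences m b)"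
proof (rule inj_onI)
  fix js js' assume js: "js \<in> z_sequences m b" "js' \<in> z_sequences m b"
    and "sequence_monomial Zvar js = sequence_monomial Zvar js'"
  then have "mset js = mset js'" using sequence_monomial_mset[of Zvar js js'] by (simp add: inj_def)
  then show "js = js'" using sorted_mset_inject js by (auto simp: z_sequences_def z_admissible_def)
qed

lemma truncated_x_monomials:
  "{\<alpha> \<in> x_monomials a. \<forall>j>k. Poly_Mapping.lookup \<alpha> (Xvar j) = 0} = sequence_monomial Xvar ` x_sequences k a"
proof -
  have "set js \<subseteq> {1..k} \<longleftrightarrow> (\<forall>j>k. Poly_Mapping.lookup (sequence_monomial Xvar js) (Xvar j) = 0)"
    if "\<forall>j\<in>set js. 1 \<le> j" for js
  proof -
    have "inj Xvar" by (simp add: inj_def)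
    then show ?thesis using that by (auto simp: lookup_sequence_monomial count_list_0_iff) (metis not_le)
  qed
  then show ?thesis
    unfolding x_monomials_def x_sequences_def sequence_monomial_def[symmetric]
    by (auto simp: x_admissible_def)
qed

lemma z_monomials_eq: "z_monomials b = sequence_monomial Zvar ` z_sequences 1 b"
  unfolding z_monomials_def z_sequences_def sequence_monomial_def by (auto simp: z_admissible_def)

lemma x_fun_monomials:
  "x_fun k a = (\<Sum>\<alpha>\<in>{\<alpha> \<in> x_monomials a. \<forall>j>k. Poly_Mapping.lookup \<alpha> (Xvar j) = 0}.
     const (2 powi (int (num_vars \<alpha>) - int (num_ones a))) * Poly_Mapping.single \<alpha> 1)"
proof -
  have "card (Xvar ` A) = card A" for A by (intro card_image) (simp add: inj_on_def)
  then show ?thesis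
    unfolding truncated_x_monomials sum.reindex[OF inj_on_x_sequences]
    by (simp add: x_fun_def num_vars_def keys_sequence_monomial single_sequence_monomial)
qed

lemma z_fun_monomials:
  "Hat1 \<notin> set b \<Longrightarrow> z_fun 1 b = (\<Sum>\<beta>\<in>z_monomials b. Poly_Mapping.single \<beta> 1)"
  unfolding z_monomials_eq sum.reindex[OF inj_on_z_sequences]
  by (simp add: z_fun_def single_sequence_monomial)

text \<open>Reduced words of u and v in a length-additive factorization of w amount to one reduced
  word of w with a cut; the factorization is read off from the cut.\<close>

lemma admissible_sum_eq_coef:
  assumes n: "2 \<le> n" and w: "w \<in> D_group n"
  shows "admissible_sum n k w = coef (conv (x_fun k) (z_fun 1)) w"
proof -
  have wi: "w \<in> D_infty" using w by (rule D_group_subset_D_infty)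
  let ?S = "{(u, v). u \<in> D_group n \<and> v \<in> S_group n \<and> u \<circ> v = w \<and>
    cox_length u + cox_length v = cox_length w}"
  let ?T = "SIGMA (u, v) : ?S. reduced_words u \<times> reduced_words v"
  let ?A = "\<lambda>a. {\<alpha> \<in> x_monomials a. \<forall>j>k. Poly_Mapping.lookup \<alpha> (Xvar j) = 0}"
  have SD: "S_group n \<subseteq> D_group n"
    unfolding S_group_def using word_perm_in_D_group[OF n] by (fastforce simp: rank_letters_def)
  have fin_D: "finite (D_group n)"
  proof (rule finite_subset)
    have "{i::int. 1 \<le> \<bar>i\<bar> \<and> \<bar>i\<bar> \<le> int n} \<subseteq> {- int n..int n}" by auto
    then show "finite {w. w permutes {i::int. 1 \<le> \<bar>i\<bar> \<and> \<bar>i\<bar> \<le> int n}}"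
      by (intro finite_permutations) (auto intro: finite_subset)
  qed (auto simp: D_group_def)
  have fin_S: "finite ?S"
    by (rule finite_subset[of _ "D_group n \<times> D_group n"]) (use SD fin_D in auto)
  have fin_R: "finite (reduced_words u)" if "u \<in> D_group n" for u
    using that finite_reduced_words D_group_subset_D_infty by blast
  have fin_A: "finite (?A a)" "finite (z_monomials a)" for a
    unfolding truncated_x_monomials z_monomials_eq by (simp_all add: finite_x_sequences finite_z_sequences)
  have inner: "(\<Sum>(a, \<alpha>) \<in> {(a, \<alpha>). a \<in> reduced_words u \<and> \<alpha> \<in> x_monomials a \<and>
        (\<forall>j > k. Poly_Mapping.lookup \<alpha> (Xvar j) = 0)}.
      \<Sum>(b, \<beta>) \<in> {(b, \<beta>). b \<in> reduced_words v \<and> \<beta> \<in> z_monomials b}.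
        Poly_Mapping.single (\<alpha> + \<beta>) (2 powi (int (num_vars \<alpha>) - int (num_ones a)))) =
      (\<Sum>(a, b)\<in>reduced_words u \<times> reduced_words v. x_fun k a * z_fun 1 b)"
    if uv: "u \<in> D_group n" "v \<in> S_group n" for u v
  proof -
    have v: "v \<in> D_group n" using uv SD by auto
    have nh: "Hat1 \<notin> set b" if "b \<in> reduced_words v" for b
      using S_group_reduced_words[OF n uv(2) that] by auto
    have sg: "Poly_Mapping.single (\<alpha> + \<beta>) c = const c * Poly_Mapping.single \<alpha> 1 * Poly_Mapping.single \<beta> 1"
      for \<alpha> \<beta> :: monomial and c :: rat by (simp add: mult_single)
    have s1: "{(a, \<alpha>). a \<in> reduced_words u \<and> \<alpha> \<in> x_monomials a \<and> (\<forall>j > k. Poly_Mapping.lookup \<alpha> (Xvar j) = 0)} =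
        (SIGMA a : reduced_words u. ?A a)" by auto
    have s2: "{(b, \<beta>). b \<in> reduced_words v \<and> \<beta> \<in> z_monomials b} = (SIGMA b : reduced_words v. z_monomials b)" by auto
    have "(\<Sum>(a, \<alpha>) \<in> (SIGMA a : reduced_words u. ?A a). \<Sum>(b, \<beta>) \<in> (SIGMA b : reduced_words v. z_monomials b).
        Poly_Mapping.single (\<alpha> + \<beta>) (2 powi (int (num_vars \<alpha>) - int (num_ones a)))) =
      (\<Sum>(a, \<alpha>) \<in> (SIGMA a : reduced_words u. ?A a).
          const (2 powi (int (num_vars \<alpha>) - int (num_ones a))) * Poly_Mapping.single \<alpha> 1) *
      (\<Sum>(b, \<beta>) \<in> (SIGMA b : reduced_words v. z_monomials b). Poly_Mapping.single \<beta> 1)"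
      unfolding sum_product sg by (simp add: case_prod_beta)
    also have "(\<Sum>(a, \<alpha>) \<in> (SIGMA a : reduced_words u. ?A a).
          const (2 powi (int (num_vars \<alpha>) - int (num_ones a))) * Poly_Mapping.single \<alpha> 1) =
        (\<Sum>a\<in>reduced_words u. x_fun k a)"
      unfolding x_fun_monomials using fin_R[OF uv(1)] fin_A(1) by (subst sum.Sigma) auto
    also have "(\<Sum>(b, \<beta>) \<in> (SIGMA b : reduced_words v. z_monomials b). Poly_Mapping.single \<beta> 1) =
        (\<Sum>b\<in>reduced_words v. \<Sum>\<beta>\<in>z_monomials b. Poly_Mapping.single \<beta> 1 :: mpoly)"
      using fin_R[OF v] fin_A(2) by (subst sum.Sigma) auto
    also have "\<dots> = (\<Sum>b\<in>reduced_words v. z_fun 1 b)"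
      using nh by (intro sum.cong refl z_fun_monomials[symmetric])
    finally show ?thesis
      unfolding s1 s2 sum_product sum.cartesian_product .
  qed
  have "admissible_sum n k w = (\<Sum>p\<in>?S. \<Sum>(a, b)\<in>reduced_words (fst p) \<times> reduced_words (snd p). x_fun k a * z_fun 1 b)"
    unfolding admissible_sum_def case_prod_beta[of _ "_ :: (int \<Rightarrow> int) \<times> (int \<Rightarrow> int)"]
    by (intro sum.cong refl inner) auto
  also have "\<dots> = (\<Sum>(p, a, b)\<in>(SIGMA p : ?S. reduced_words (fst p) \<times> reduced_words (snd p)). x_fun k a * z_fun 1 b)"
    by (subst sum.Sigma) (use fin_S fin_R SD in \<open>auto simp: case_prod_beta\<close>)
  \<comment> \<open>The part of a reduced word after the cut represents an element of
    \<open>S_group n\<close> exactly if it avoids \<open>Hat1\<close>.\<close>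
  also have "\<dots> = (\<Sum>(c, i)\<in>{(c, i) \<in> (SIGMA c : reduced_words w. {..length c}). Hat1 \<notin> set (drop i c)}.
      x_fun k (take i c) * z_fun 1 (drop i c))"
  proof (rule sum.reindex_bij_witness[where
        i = "\<lambda>(c, i). ((word_perm (take i c), word_perm (drop i c)), take i c, drop i c)" and
        j = "\<lambda>(p, a, b). (a @ b, length a)"])
    fix q assume q: "q \<in> (SIGMA p : ?S. reduced_words (fst p) \<times> reduced_words (snd p))"
    obtain u v a b where e: "q = ((u, v), a, b)" by (metis surj_pair)
    have uv: "u \<in> D_group n" "v \<in> S_group n" "u \<circ> v = w" "cox_length u + cox_length v = cox_length w"
      and ab: "a \<in> reduced_words u" "b \<in> reduced_words v" using q e by auto
    have "Hat1 \<notin> set b" using S_group_reduced_words[OF n uv(2) ab(2)] by auto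
    moreover have "a @ b \<in> reduced_words w" using uv ab by (auto simp: reduced_words_def word_perm_append)
    ultimately show "(case q of (p, a, b) \<Rightarrow> (a @ b, length a)) \<in>
        {(c, i) \<in> (SIGMA c : reduced_words w. {..length c}). Hat1 \<notin> set (drop i c)}"
      by (simp add: e)
    show "(case case q of (p, a, b) \<Rightarrow> (a @ b, length a) of (c, i) \<Rightarrow>
        ((word_perm (take i c), word_perm (drop i c)), take i c, drop i c)) = q"
      using ab by (simp add: e reduced_words_def)
    show "(case case q of (p, a, b) \<Rightarrow> (a @ b, length a) of (c, i) \<Rightarrow> x_fun k (take i c) * z_fun 1 (drop i c)) =
        (case q of (p, a, b) \<Rightarrow> x_fun k a * z_fun 1 b)"
      by (simp add: e)
  next
    fix q assume q: "q \<in> {(c, i) \<in> (SIGMA c : reduced_words w. {..length c}). Hat1 \<notin> set (drop i c)}"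
    obtain c i where e: "q = (c, i)" by force
    have c: "c \<in> reduced_words w" "i \<le> length c" "Hat1 \<notin> set (drop i c)" using q e by auto
    have c': "take i c @ drop i c \<in> reduced_words w" using c by simp
    have r: "set (take i c) \<subseteq> rank_letters n" "set (drop i c) \<subseteq> rank_letters n"
      using reduced_words_rank[OF n w c(1)] set_take_subset[of i c] set_drop_subset[of i c] by auto
    then have "set (drop i c) \<subseteq> simple_letters n" using c(3) by (auto simp: rank_letters_def)
    then have "word_perm (drop i c) \<in> S_group n" unfolding S_group_def by blast
    moreover have "word_perm (take i c) \<in> D_group n" using word_perm_in_D_group[OF n r(1)] .
    moreover have "word_perm (take i c) \<circ> word_perm (drop i c) = w"
      using c' by (simp add: reduced_words_def word_perm_append[symmetric])
    ultimately show "(case q of (c, i) \<Rightarrow> ((word_perm (take i c), word_perm (drop i c)), take i c, drop i c)) \<in>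
        (SIGMA p : ?S. reduced_words (fst p) \<times> reduced_words (snd p))"
      using reduced_words_append[OF c'] by (simp add: e)
    show "(case case q of (c, i) \<Rightarrow> ((word_perm (take i c), word_perm (drop i c)), take i c, drop i c) of
        (p, a, b) \<Rightarrow> (a @ b, length a)) = q"
      using c(2) by (simp add: e)
  qed
  \<comment> \<open>The cuts left out so far contribute 0, because \<open>z_fun\<close> vanishes on
    words with \<open>Hat1\<close>.\<close>
  also have "\<dots> = (\<Sum>(c, i)\<in>(SIGMA c : reduced_words w. {..length c}). x_fun k (take i c) * z_fun 1 (drop i c))"
    using finite_reduced_words[OF wi]
    by (intro sum.mono_neutral_left) (auto simp: z_fun_def)
  also have "\<dots> = coef (conv (x_fun k) (z_fun 1)) w"
    unfolding coef_def conv_def using finite_reduced_words[OF wi] by (subst sum.Sigma) auto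
  finally show ?thesis .
qed

lemma admissible_sum_steps:
  assumes n: "2 \<le> n" and w: "w \<in> D_group n"
  shows "admissible_sum n k w = steps (x_factors n (rev [1..<k + 1]) @ z_factors n [1..<n]) delta_id w"
proof -
  \<comment> \<open>Agreement on reduced words suffices, as \<open>coef\<close> sees no
    others.\<close>
  have "conv (x_fun k) (z_fun 1) c = conv (gamma_prod n (rev [1..<k + 1])) (prod_fun (z_factors n [1..<n])) c"
    if c: "c \<in> reduced_words w" for c
    unfolding conv_def
  proof (intro sum.cong refl arg_cong2[where f = "(*)"])
    fix i
    have "take i c @ drop i c \<in> reduced_words w" using c by simp
    note r = reduced_words_append(1)[OF this]
    have rank: "set (take i c) \<subseteq> rank_letters n" "set (drop i c) \<subseteq> rank_letters n"
      using reduced_words_rank[OF n w c] set_take_subset[of i c] set_drop_subset[of i c] by auto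
    show "x_fun k (take i c) = gamma_prod n (rev [1..<k + 1]) (take i c)"
      by (rule x_fun_gamma_prod[OF n rank(1) r])
    show "z_fun 1 (drop i c) = prod_fun (z_factors n [1..<n]) (drop i c)"
      using n rank(2) by (intro z_fun_prod_fun) auto
  qed
  \<comment> \<open>The unit \<open>one_fun\<close> is put in front as the series that projects to
    \<open>delta_id\<close>, the start of the steps.\<close>
  then have "admissible_sum n k w =
      coef (conv (conv one_fun (gamma_prod n (rev [1..<k + 1]))) (prod_fun (z_factors n [1..<n]))) w"
    by (simp add: admissible_sum_eq_coef[OF n w] coef_def)
  also have "\<dots> = steps (z_factors n [1..<n]) (steps (x_factors n (rev [1..<k + 1])) delta_id) w"
  proof -
    have "fst ` set (z_factors n [1..<n]) \<subseteq> letters"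
      using z_factors_rank[of "[1..<n]" n] rank_letters_subset by fastforce
    then show ?thesis by (simp only: coef_conv_prod_fun coef_conv_gamma_prod[OF n] coef_one)
  qed
  finally show ?thesis by simp
qed

theorem theorem3p11:
  fixes n k :: nat
    and w :: "int \<Rightarrow> int"
    and \<DD> :: "(int \<Rightarrow> int) \<Rightarrow> mpoly"
  assumes "2 \<le> n"
    and "w \<in> D_group n"
    and "schubert_D_family \<DD>"
  shows "pipe_dream_sum n k w = admissible_sum n k w \<and>
         admissible_sum n k w = x_truncation k (\<DD> w)"
proof -
  interpret schubert_family \<DD> n using assms(1,3) by unfold_locales
  show ?thesis
    using pipe_dream_sum_steps[OF assms(1) D_group_subset_D_infty[OF assms(2)]]
      admissible_sum_steps[OF assms(1,2)] x_truncation_family[OF assms(2)]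
    by simp
qed

end
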